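(* Let $\mathbb{G}$ be a filiform group of step $s\geq 3$. (i) If $\mathbb{G}$ is a type I filiform group, then $\mathrm{Abn}_{\mathbb{G}}$ is a horizontal line. (ii) If $\mathbb{G}$ is a type II filiform group, then $\mathrm{Abn}_{\mathbb{G}}$ is an algebraic variety of dimension $3$.
   Context: A Carnot group $\mathbb{G}$ of step $s$ is a connected, simply connected, nilpotent Lie group whose Lie algebra $\mathfrak{g}$ (identified with the tangent space at the identity $e$) admits a stratification $\mathfrak{g}=\mathfrak{g}_1\oplus\dots\oplus\mathfrak{g}_s$ with $\mathfrak{g}_{i+1}=[\mathfrak{g},\mathfrak{g}_i]$ for $1\le i\le s-1$ and $[\mathfrak{g},\mathfrak{g}_s]=\{0\}$. The exponential map $\exp:\mathfrak{g}\to\mathbb{G}$ is a diffeomorphism, used to identify $\mathbb{G}$ with $\mathfrak{g}$. Endpoint map and abnormal set. For $u\in L^1([0,1],\mathfrak{g}_1)$ let $\gamma_u:[0,1]\to\mathbb{G}$ be the absolutely continuous curve with $\gamma_u(0)=e$ and $\gamma_u'(t)=(dL_{\gamma_u(t)})_e u(t)$ for a.e. $t$, where $L_g$ is left translation by $g$. The endpoint map is $F:L^1([0,1],\mathfrak{g}_1)\to\mathbb{G}$, $F(u)=\gamma_u(1)$. A control $u$ is singular if the differential $d_uF$ is not surjective. The abnormal set is $\mathrm{Abn}_{\mathbb{G}}=\{\gamma_u(1)\mid u \text{ is a singular control}\}$. A horizontal line (through $e$) is a set of the form $\{\exp(tX)\mid t\in\mathbb{R}\}$ with $X\in\mathfrak{g}_1\setminus\{0\}$.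 Filiform groups. A filiform group is a Carnot group with $\dim\mathfrak{g}_1=2$ and $\dim\mathfrak{g}_2=\dots=\dim\mathfrak{g}_s=1$. One can fix a basis $X_1,\dots,X_{s+1}$ of $\mathfrak{g}$ with $\mathfrak{g}_1=\mathrm{span}\{X_1,X_2\}$ and $\mathfrak{g}_j=\mathrm{span}\{X_{j+1}\}$ for $j=2,\dots,s$, such that $\mathbb{G}$ belongs to one of the following classes. Type I: the only non-trivial bracket relations (up to skew-symmetry) are $X_{j+1}=[X_1,X_j]$ for $j=2,\dots,s$. Type II: $s$ is odd and the only non-trivial bracket relations (up to skew-symmetry) are $X_{j+1}=[X_1,X_j]$ for $j=2,\dots,s-1$, and $X_{s+1}=(-1)^i[X_i,X_{s+2-i}]$ for $i=2,\dots,s$. Since for $s=3$ the two types are isomorphic (Engel group), by convention the step of a type II filiform group is an odd integer $s\ge5$.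
   Formalization: In (ii) Abn_G is never closed, so not an algebraic variety; proved instead: Abn_G = (V−W)∪L, V an irreducible variety of dimension 3, W a proper algebraic subset of V, L an algebraic subset of W. The stratification is read as g_{i+1}=[g_1,g_i], as the printed [g,g_i] is inconsistent. *)

theory Defs
  imports "HOL-Analysis.Analysis" "HOL-Algebra.Group"
begin

section \<open>Lie groups in exponential coordinates\<close>

primrec C_k :: "nat \<Rightarrow> ('a::euclidean_space \<Rightarrow> 'b::euclidean_space) \<Rightarrow> bool" where
  "C_k 0 f \<longleftrightarrow> continuous_on UNIV f"
| "C_k (Suc k) f \<longleftrightarrow>
     (\<forall>x. f differentiable (at x)) \<and> (\<forall>v. C_k k (\<lambda>x. frechet_derivative f (at x) v))"

definition smooth :: "('a::euclidean_space \<Rightarrow> 'b::euclidean_space) \<Rightarrow> bool" where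
  "smooth f \<longleftrightarrow> (\<forall>k. C_k k f)"

text \<open>The differential at the identity of the left translation by \<open>x\<close>.\<close>

definition left_diff :: "'a::euclidean_space monoid \<Rightarrow> 'a \<Rightarrow> 'a \<Rightarrow> 'a" where
  "left_diff G x = frechet_derivative (\<lambda>y. x \<otimes>\<^bsub>G\<^esub> y) (at \<one>\<^bsub>G\<^esub>)"

text \<open>The value at the identity of the commutator of the left-invariant vector fields
  \<open>\<lambda>x. left_diff G x X\<close> and \<open>\<lambda>x. left_diff G x Y\<close>, computed in the global chart.\<close>

definition lie_bracket :: "'a::euclidean_space monoid \<Rightarrow> 'a \<Rightarrow> 'a \<Rightarrow> 'a" where
  "lie_bracket G X Y =
     frechet_derivative (\<lambda>x. left_diff G x Y) (at \<one>\<^bsub>G\<^esub>) X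
   - frechet_derivative (\<lambda>x. left_diff G x X) (at \<one>\<^bsub>G\<^esub>) Y"

definition one_parameter_subgroup :: "'a::euclidean_space monoid \<Rightarrow> (real \<Rightarrow> 'a) \<Rightarrow> bool" where
  "one_parameter_subgroup G \<phi> \<longleftrightarrow> (\<forall>a b. \<phi> (a + b) = \<phi> a \<otimes>\<^bsub>G\<^esub> \<phi> b)"

text \<open>
  The exponential map of a connected, simply connected, nilpotent Lie group is a diffeomorphism
  and is used to identify the group with its Lie algebra.  Accordingly the underlying manifold
  is a Euclidean space \<open>'a\<close>, which is at the same time the Lie algebra, and \<open>exp\<close> is the
  identity map: the one-parameter subgroup with initial velocity \<open>X\<close> is \<open>\<lambda>t. t *\<^sub>R X\<close>.
  The inner product of \<open>'a\<close> plays no role beyond fixing a norm.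

  The strata satisfy \<open>g (i + 1) = [g 1, g i]\<close>; nilpotency is a consequence of the stratification.
\<close>

locale carnot_group = group G for G :: "'a::euclidean_space monoid" (structure) +
  fixes g :: "nat \<Rightarrow> 'a set" and s :: nat
  assumes carrier_eq: "carrier G = UNIV"
    and smooth_mult: "smooth (\<lambda>p. fst p \<otimes> snd p)"
    and exp_id: "\<And>X. one_parameter_subgroup G (\<lambda>t. t *\<^sub>R X)"
    and step_pos: "s \<ge> 1"
    and strata_subspace: "\<And>i. i \<in> {1..s} \<Longrightarrow> subspace (g i)"
    and strata_direct_sum:
      "\<And>X. \<exists>!Y. Y \<in> (\<Pi>\<^sub>E i\<in>{1..s}. g i) \<and> X = (\<Sum>i\<in>{1..s}. Y i)"
    and strata_bracket:
      "\<And>i. 1 \<le> i \<Longrightarrow> i < s \<Longrightarrow>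
         g (Suc i) = span {lie_bracket G X Y |X Y. X \<in> g 1 \<and> Y \<in> g i}"
    and top_stratum_central: "\<And>X Y. Y \<in> g s \<Longrightarrow> lie_bracket G X Y = 0"


section \<open>Endpoint map and abnormal set\<close>

definition absolutely_continuous_on_interval ::
    "real \<Rightarrow> real \<Rightarrow> (real \<Rightarrow> 'a::euclidean_space) \<Rightarrow> bool" where
  "absolutely_continuous_on_interval a b \<gamma> \<longleftrightarrow>
     (\<forall>\<epsilon>>0. \<exists>\<delta>>0. \<forall>\<D> S. \<D> division_of S \<and> S \<subseteq> {a..b} \<and> (\<Sum>K\<in>\<D>. Sup K - Inf K) < \<delta> \<longrightarrow>
        (\<Sum>K\<in>\<D>. norm (\<gamma> (Sup K) - \<gamma> (Inf K))) < \<epsilon>)"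

text \<open>Representatives of the elements of \<open>L\<^sup>1([0,1], V)\<close>, with the seminorm whose null space
  consists of the functions that vanish almost everywhere on \<open>[0,1]\<close>.\<close>

definition controls :: "'a::euclidean_space set \<Rightarrow> (real \<Rightarrow> 'a) set" where
  "controls V = {u. u absolutely_integrable_on {0..1} \<and> (\<forall>t\<in>{0..1}. u t \<in> V)}"

definition L1_norm :: "(real \<Rightarrow> 'a::euclidean_space) \<Rightarrow> real" where
  "L1_norm u = integral {0..1} (\<lambda>t. norm (u t))"

definition horizontal_curve ::
    "'a::euclidean_space monoid \<Rightarrow> (real \<Rightarrow> 'a) \<Rightarrow> (real \<Rightarrow> 'a) \<Rightarrow> bool" where
  "horizontal_curve G u \<gamma> \<longleftrightarrow>
     absolutely_continuous_on_interval 0 1 \<gamma> \<and> \<gamma> 0 = \<one>\<^bsub>G\<^esub> \<and>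
     (AE t in lebesgue. t \<in> {0..1} \<longrightarrow>
        (\<gamma> has_vector_derivative left_diff G (\<gamma> t) (u t)) (at t within {0..1}))"

definition endpoint :: "'a::euclidean_space monoid \<Rightarrow> (real \<Rightarrow> 'a) \<Rightarrow> 'a" where
  "endpoint G u = (THE x. \<exists>\<gamma>. horizontal_curve G u \<gamma> \<and> x = \<gamma> 1)"

text \<open>\<open>D\<close> is the Frechet differential at \<open>u\<close> of \<open>F : L\<^sup>1([0,1], V) \<rightarrow> 'a\<close>: a bounded linear
  map with \<open>F (u + v) = F u + D v + o(\<parallel>v\<parallel>)\<close>.  Boundedness makes \<open>D\<close> constant on almost everywhere
  equality classes.  The tangent spaces of the target are all identified with \<open>'a\<close> by the
  global chart.\<close>

definition has_L1_differential ::
    "'a::euclidean_space set \<Rightarrow> ((real \<Rightarrow> 'a) \<Rightarrow> 'a) \<Rightarrow> ((real \<Rightarrow> 'a) \<Rightarrow> 'a) \<Rightarrow> (real \<Rightarrow> 'a) \<Rightarrow> bool"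
  where
  "has_L1_differential V F D u \<longleftrightarrow>
     (\<forall>v\<in>controls V. \<forall>w\<in>controls V. \<forall>a b.
        D (\<lambda>t. a *\<^sub>R v t + b *\<^sub>R w t) = a *\<^sub>R D v + b *\<^sub>R D w) \<and>
     (\<exists>C. \<forall>v\<in>controls V. norm (D v) \<le> C * L1_norm v) \<and>
     (\<forall>\<epsilon>>0. \<exists>\<delta>>0. \<forall>v\<in>controls V. L1_norm v < \<delta> \<longrightarrow>
        norm (F (\<lambda>t. u t + v t) - F u - D v) \<le> \<epsilon> * L1_norm v)"

definition singular_control ::
    "'a::euclidean_space monoid \<Rightarrow> 'a set \<Rightarrow> (real \<Rightarrow> 'a) \<Rightarrow> bool" where
  "singular_control G V u \<longleftrightarrow>
     u \<in> controls V \<and>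
     (\<exists>D. has_L1_differential V (endpoint G) D u \<and> D ` controls V \<noteq> UNIV)"

definition abnormal_set :: "'a::euclidean_space monoid \<Rightarrow> 'a set \<Rightarrow> 'a set" where
  "abnormal_set G V = {endpoint G u |u. singular_control G V u}"

text \<open>Here \<open>t *\<^sub>R X\<close> is \<open>exp (t X)\<close>.\<close>

definition horizontal_line :: "'a::euclidean_space set \<Rightarrow> 'a set \<Rightarrow> bool" where
  "horizontal_line V A \<longleftrightarrow> (\<exists>X\<in>V. X \<noteq> 0 \<and> A = {t *\<^sub>R X |t. True})"


section \<open>Filiform groups\<close>

definition filiform_group :: "'a::euclidean_space monoid \<Rightarrow> (nat \<Rightarrow> 'a set) \<Rightarrow> nat \<Rightarrow> bool" where
  "filiform_group G g s \<longleftrightarrow>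
     carnot_group G g s \<and> dim (g 1) = 2 \<and> (\<forall>j\<in>{2..s}. dim (g j) = 1)"

definition filiform_basis :: "(nat \<Rightarrow> 'a::euclidean_space set) \<Rightarrow> nat \<Rightarrow> (nat \<Rightarrow> 'a) \<Rightarrow> bool" where
  "filiform_basis g s X \<longleftrightarrow>
     inj_on X {1..s+1} \<and> independent (X ` {1..s+1}) \<and> span (X ` {1..s+1}) = UNIV \<and>
     g 1 = span {X 1, X 2} \<and> (\<forall>j\<in>{2..s}. g j = span {X (j+1)})"

definition type_I :: "'a::euclidean_space monoid \<Rightarrow> (nat \<Rightarrow> 'a set) \<Rightarrow> nat \<Rightarrow> bool" where
  "type_I G g s \<longleftrightarrow>
     (\<exists>X. filiform_basis g s X \<and>
        (\<forall>j\<in>{2..s}. X (j+1) = lie_bracket G (X 1) (X j)) \<and>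
        (\<forall>i j. 1 \<le> i \<and> i < j \<and> j \<le> s+1 \<and> \<not> (i = 1 \<and> j \<le> s) \<longrightarrow>
           lie_bracket G (X i) (X j) = 0))"

definition type_II :: "'a::euclidean_space monoid \<Rightarrow> (nat \<Rightarrow> 'a set) \<Rightarrow> nat \<Rightarrow> bool" where
  "type_II G g s \<longleftrightarrow>
     odd s \<and> s \<ge> 5 \<and>
     (\<exists>X. filiform_basis g s X \<and>
        (\<forall>j\<in>{2..s-1}. X (j+1) = lie_bracket G (X 1) (X j)) \<and>
        (\<forall>i\<in>{2..s}. X (s+1) = (-1) ^ i *\<^sub>R lie_bracket G (X i) (X (s+2-i))) \<and>
        (\<forall>i j. 1 \<le> i \<and> i < j \<and> j \<le> s+1 \<and> \<not> (i = 1 \<and> j \<le> s-1) \<and> \<not> (2 \<le> i \<and> i + j = s+2) \<longrightarrow>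
           lie_bracket G (X i) (X j) = 0))"


section \<open>Real algebraic varieties\<close>

definition algebraic_set :: "'a::euclidean_space set \<Rightarrow> bool" where
  "algebraic_set V \<longleftrightarrow>
     (\<exists>P. (\<forall>p\<in>P. real_polynomial_function p) \<and> V = {x. \<forall>p\<in>P. p x = 0})"

definition algebraic_variety :: "'a::euclidean_space set \<Rightarrow> bool" where
  "algebraic_variety V \<longleftrightarrow>
     algebraic_set V \<and> V \<noteq> {} \<and>
     (\<forall>V1 V2. algebraic_set V1 \<and> algebraic_set V2 \<and> V = V1 \<union> V2 \<longrightarrow> V = V1 \<or> V = V2)"

text \<open>The restrictions of the polynomials \<open>f 0, \<dots>, f (n - 1)\<close> to \<open>V\<close> are algebraically independent
  over the reals.  An exponent vector is an extensional function on \<open>{..<n}\<close>.\<close>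

definition algebraically_independent_on ::
    "'a::euclidean_space set \<Rightarrow> nat \<Rightarrow> (nat \<Rightarrow> 'a \<Rightarrow> real) \<Rightarrow> bool" where
  "algebraically_independent_on V n f \<longleftrightarrow>
     (\<forall>i<n. real_polynomial_function (f i)) \<and>
     (\<forall>M c. finite M \<and> M \<subseteq> ({..<n} \<rightarrow>\<^sub>E (UNIV :: nat set)) \<and>
        (\<forall>x\<in>V. (\<Sum>m\<in>M. c m * (\<Prod>i<n. f i x ^ m i)) = (0::real)) \<longrightarrow> (\<forall>m\<in>M. c m = 0))"

text \<open>Dimension as the transcendence degree of the coordinate ring.\<close>

definition has_algebraic_dim :: "'a::euclidean_space set \<Rightarrow> nat \<Rightarrow> bool" where
  "has_algebraic_dim V d \<longleftrightarrow>
     (\<exists>f. algebraically_independent_on V d f) \<and>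
     (\<forall>n f. algebraically_independent_on V n f \<longrightarrow> n \<le> d)"

text \<open>
  For a type II filiform group the abnormal set
  \<open>{exp (a X\<^sub>2) exp (b X\<^sub>1) exp (d X\<^sub>2) | a b d}\<close> is not closed, hence not itself an
  algebraic set: for fixed \<open>\<tau>\<close> and \<open>b \<rightarrow> 0\<close>, the choice \<open>d = - a = \<tau> / b\<close> gives points
  that converge to \<open>\<tau> X\<^sub>3\<close>, but \<open>0\<close> is the only multiple of \<open>X\<^sub>3\<close> in the set.  Being a variety
  of dimension 3 is therefore stated in the form \<open>(V - W) \<union> L\<close>, where \<open>V\<close> is an (irreducible)
  algebraic variety of dimension 3, \<open>W\<close> a proper algebraic subset of \<open>V\<close>, and \<open>L\<close> an algebraic
  subset of \<open>W\<close>; the set is an algebraic variety in the strict sense exactly when \<open>L = W\<close>.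
\<close>

end

theory Submission
  imports Defs
begin

text \<open>
  The proof rests on one identity for the endpoint map \<open>F\<close>. Let \<open>\<gamma>\<close> be the curve of the control
  \<open>u\<close>. If \<open>\<delta>\<close> is the curve of the control \<open>Ad (\<gamma> t) (v t)\<close>, whose values are no longer horizontal,
  then the product \<open>\<delta> \<gamma>\<close> is the curve of \<open>u + v\<close>. Hence \<open>F (u + v) = E (Ad \<gamma> v) F u\<close>, where \<open>E\<close>
  is the endpoint map for controls with values in the whole Lie algebra. As \<open>E \<eta>\<close> is the integral
  of \<open>\<eta>\<close> to first order, the differential of \<open>F\<close> at \<open>u\<close> is the integral of \<open>Ad (\<gamma> t) (v t)\<close>,
  translated to \<open>F u\<close>, and \<open>u\<close> is singular iff there is a covector \<open>l \<noteq> 0\<close> such that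
  \<open>l (Ad (\<gamma> t) X) = 0\<close> for all times \<open>t\<close> and all horizontal \<open>X\<close> (\<open>singular_control_iff\<close>).

  The group law enters only through the fact that in exponential coordinates every continuous
  one-parameter subgroup is linear (\<open>continuous_hom_linear\<close>). It makes the adjoint action linear
  and yields the few product formulas that are needed. In both types the Lie algebra is the sum of
  a line \<open>\<real> X\<^sub>1\<close> and an ideal, spanned by the other \<open>X\<^sub>i\<close>, whose brackets are central. Therefore the
  curve of any integrable control is obtained by two successive integrations
  (\<open>velocity_trajectory\<close>), which gives existence of curves and the expansion of \<open>E\<close>. Uniqueness
  holds because an absolutely continuous curve with vanishing derivative almost everywhere is
  constant.

  Now let \<open>P\<^sub>k t = l (Ad (\<gamma> t) X\<^sub>k)\<close> for a singular control \<open>u = u\<^sub>1 X\<^sub>1 + u\<^sub>2 X\<^sub>2\<close>. Then \<open>P\<^sub>1 = P\<^sub>2 = 0\<close>,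
  and \<open>P\<^sub>k' = u\<^sub>1 P\<^sub>k\<^sub>+\<^sub>1\<close> along the chain generated by \<open>X\<^sub>1\<close>. If \<open>P\<^sub>k = 0\<close>, then \<open>u\<^sub>1 P\<^sub>k\<^sub>+\<^sub>1 = 0\<close> almost
  everywhere, so the square of \<open>P\<^sub>k\<^sub>+\<^sub>1\<close> is constant as long as the chain continues. Consequently
  either \<open>u\<^sub>1 = 0\<close> almost everywhere or the whole chain vanishes except possibly its last member
  (\<open>abnormal_chain\<close>). In type I the last member is constant and \<open>u\<^sub>1 = 0\<close> follows, so that the
  abnormal set is the line through \<open>X\<^sub>2\<close>. In type II the last member is an affine function of the
  second coordinate \<open>w\<close> of the curve, and one obtains \<open>u\<^sub>1 (w - c) = 0\<close> almost everywhere for a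
  constant \<open>c\<close>. The curve \<open>exp (c X\<^sub>2) exp (y X\<^sub>1) exp ((w - c) X\<^sub>2)\<close>, with \<open>y\<close> the integral of \<open>u\<^sub>1\<close>,
  then has the same control. So the abnormal set consists of the points
  \<open>exp (c X\<^sub>2) exp (b X\<^sub>1) exp (d X\<^sub>2)\<close>; conversely, a suitable covector shows that all of them are
  endpoints of singular controls (\<open>X2_X1_X2_abnormal\<close>).

  In the parameters \<open>(b, c + d, d b)\<close> these points depend polynomially on the parameters, and the
  parameters are polynomials in the exponential coordinates of the point. So they lie on a variety
  that is isomorphic to three-space, and the values that the parameters take, \<open>b \<noteq> 0\<close> or
  \<open>d b = 0\<close>, describe the abnormal set inside it (\<open>abnormal_set_constructible\<close>).
\<close>

section \<open>Absolutely continuous curves\<close>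

abbreviation (input) AC :: "real \<Rightarrow> real \<Rightarrow> (real \<Rightarrow> 'a::euclidean_space) \<Rightarrow> bool" where
  "AC \<equiv> absolutely_continuous_on_interval"

text \<open>The one-interval case of the definition, from which continuity follows.\<close>

lemma AC_increment_small:
  assumes "AC a b f" "e > 0"
  shows "\<exists>d>0. \<forall>x y. a \<le> x \<longrightarrow> x \<le> y \<longrightarrow> y \<le> b \<longrightarrow> y - x < d \<longrightarrow> norm (f y - f x) < e"
proof -
  obtain d where d: "d > 0" and *: "\<And>\<D> S. \<D> division_of S \<Longrightarrow> S \<subseteq> {a..b} \<Longrightarrow> (\<Sum>K\<in>\<D>. Sup K - Inf K) < d \<Longrightarrow>
      (\<Sum>K\<in>\<D>. norm (f (Sup K) - f (Inf K))) < e"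
    using assms unfolding absolutely_continuous_on_interval_def by meson
  have "norm (f y - f x) < e" if "a \<le> x" "x \<le> y" "y \<le> b" "y - x < d" for x y
  proof -
    have "{{x..y}} division_of {x..y}"
      using division_of_self[of x y] that by simp
    from *[OF this] show ?thesis using that by simp
  qed
  with d show ?thesis by blast
qed

lemma AC_imp_continuous_on:
  assumes "AC a b f"
  shows "continuous_on {a..b} f"
  unfolding continuous_on_iff
proof (intro ballI allI impI)
  fix x and e :: real assume x: "x \<in> {a..b}" and "e > 0"
  obtain d where d: "d > 0" and *: "\<And>x y. a \<le> x \<Longrightarrow> x \<le> y \<Longrightarrow> y \<le> b \<Longrightarrow> y - x < d \<Longrightarrow> norm (f y - f x) < e"
    using AC_increment_small[OF assms \<open>e > 0\<close>] by blast
  have "dist (f y) (f x) < e" if "y \<in> {a..b}" "dist y x < d" for y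
    using *[of x y] *[of y x] that x by (cases "x \<le> y") (auto simp: dist_norm norm_minus_commute)
  with d show "\<exists>d>0. \<forall>x'\<in>{a..b}. dist x' x < d \<longrightarrow> dist (f x') (f x) < e" by blast
qed

lemma AC_subinterval:
  assumes "AC a b f" "a \<le> c" "d \<le> b"
  shows "AC c d f"
proof -
  have "{c..d} \<subseteq> {a..b}" using assms by auto
  then show ?thesis using assms(1) unfolding absolutely_continuous_on_interval_def by (meson subset_trans)
qed

lemma division_Sup_Inf_subset:
  fixes K :: "real set"
  assumes "\<D> division_of S" "S \<subseteq> {a..b}" "K \<in> \<D>"
  shows "K = {Inf K..Sup K}" "Inf K \<le> Sup K" "Inf K \<in> {a..b}" "Sup K \<in> {a..b}"
proof -
  obtain u v where K: "K = {u..v}" using division_ofD(4)[OF assms(1,3)] by auto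
  have "K \<noteq> {}" "K \<subseteq> {a..b}" using division_ofD(2,3)[OF assms(1,3)] assms(2) by auto
  with K show "K = {Inf K..Sup K}" "Inf K \<le> Sup K" "Inf K \<in> {a..b}" "Sup K \<in> {a..b}" by auto
qed

text \<open>Every closure property of absolute continuity used below is an instance: a sum, a bilinear
  product or a group product of two curves has increments bounded by a constant times the
  increments of its factors.\<close>

lemma AC_Lipschitz_combination:
  assumes f: "AC a b f" and g: "AC a b g"
    and L: "\<And>s t. s \<in> {a..b} \<Longrightarrow> t \<in> {a..b} \<Longrightarrow>
        norm (h t - h s) \<le> L * (norm (f t - f s) + norm (g t - g s))"
  shows "AC a b h"
  unfolding absolutely_continuous_on_interval_def
proof (intro allI impI)
  fix e :: real assume "e > 0"
  define M where "M = \<bar>L\<bar> + 1"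
  have M: "M > 0" "L \<le> M" by (auto simp: M_def)
  have e': "e / (2 * M) > 0" using \<open>e > 0\<close> M by simp
  obtain d1 where d1: "d1 > 0" "\<And>\<D> S. \<D> division_of S \<Longrightarrow> S \<subseteq> {a..b} \<Longrightarrow> (\<Sum>K\<in>\<D>. Sup K - Inf K) < d1 \<Longrightarrow>
      (\<Sum>K\<in>\<D>. norm (f (Sup K) - f (Inf K))) < e / (2 * M)"
    using f e' unfolding absolutely_continuous_on_interval_def by meson
  obtain d2 where d2: "d2 > 0" "\<And>\<D> S. \<D> division_of S \<Longrightarrow> S \<subseteq> {a..b} \<Longrightarrow> (\<Sum>K\<in>\<D>. Sup K - Inf K) < d2 \<Longrightarrow>
      (\<Sum>K\<in>\<D>. norm (g (Sup K) - g (Inf K))) < e / (2 * M)"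
    using g e' unfolding absolutely_continuous_on_interval_def by meson
  have "(\<Sum>K\<in>\<D>. norm (h (Sup K) - h (Inf K))) < e"
    if D: "\<D> division_of S" "S \<subseteq> {a..b}" "(\<Sum>K\<in>\<D>. Sup K - Inf K) < min d1 d2" for \<D> S
  proof -
    have "(\<Sum>K\<in>\<D>. norm (h (Sup K) - h (Inf K)))
        \<le> (\<Sum>K\<in>\<D>. M * (norm (f (Sup K) - f (Inf K)) + norm (g (Sup K) - g (Inf K))))"
    proof (rule sum_mono)
      fix K assume "K \<in> \<D>"
      note K = division_Sup_Inf_subset[OF D(1,2) this]
      have "norm (h (Sup K) - h (Inf K)) \<le> L * (norm (f (Sup K) - f (Inf K)) + norm (g (Sup K) - g (Inf K)))"
        using L K by blast
      also have "\<dots> \<le> M * (norm (f (Sup K) - f (Inf K)) + norm (g (Sup K) - g (Inf K)))"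
        using M by (intro mult_right_mono) auto
      finally show "norm (h (Sup K) - h (Inf K)) \<le> \<dots>" .
    qed
    also have "\<dots> = M * ((\<Sum>K\<in>\<D>. norm (f (Sup K) - f (Inf K))) + (\<Sum>K\<in>\<D>. norm (g (Sup K) - g (Inf K))))"
      by (simp only: sum_distrib_left sum.distrib distrib_left)
    also have "\<dots> < M * (e / (2 * M) + e / (2 * M))"
      using d1(2)[OF D(1,2)] d2(2)[OF D(1,2)] D(3) M by (intro mult_strict_left_mono add_strict_mono) auto
    also have "\<dots> = e" using M by (simp add: field_simps)
    finally show ?thesis .
  qed
  then show "\<exists>d>0. \<forall>\<D> S. \<D> division_of S \<and> S \<subseteq> {a..b} \<and> (\<Sum>K\<in>\<D>. Sup K - Inf K) < d \<longrightarrow>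
        (\<Sum>K\<in>\<D>. norm (h (Sup K) - h (Inf K))) < e"
    using d1(1) d2(1) by (intro exI[of _ "min d1 d2"]) auto
qed

lemma AC_const: "AC a b (\<lambda>t. c)"
  unfolding absolutely_continuous_on_interval_def by (auto intro!: exI[of _ 1])

lemma AC_Lipschitz:
  assumes f: "AC a b f"
    and L: "\<And>s t. s \<in> {a..b} \<Longrightarrow> t \<in> {a..b} \<Longrightarrow> norm (h t - h s) \<le> L * norm (f t - f s)"
  shows "AC a b h"
  by (rule AC_Lipschitz_combination[OF f AC_const[of a b 0], of _ L]) (use L in auto)

lemma AC_add: "AC a b f \<Longrightarrow> AC a b g \<Longrightarrow> AC a b (\<lambda>t. f t + g t)"
  by (rule AC_Lipschitz_combination[of a b f g _ 1]) (auto simp: add_diff_add norm_triangle_ineq)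

lemma AC_bounded_linear:
  assumes "AC a b f" "bounded_linear h"
  shows "AC a b (\<lambda>t. h (f t))"
proof -
  interpret bounded_linear h by fact
  obtain K where K: "\<And>x. norm (h x) \<le> norm x * K" using bounded by blast
  show ?thesis
    by (rule AC_Lipschitz[OF assms(1), of _ K]) (use K in \<open>simp add: diff[symmetric] mult.commute\<close>)
qed

lemma AC_bounded_bilinear:
  assumes f: "AC a b f" and g: "AC a b g" and h: "bounded_bilinear h"
  shows "AC a b (\<lambda>t. h (f t) (g t))"
proof -
  interpret bounded_bilinear h by fact
  obtain K where K: "\<And>x y. norm (h x y) \<le> norm x * norm y * K" "K \<ge> 0"
    using nonneg_bounded by blast
  obtain B where B: "\<And>t. t \<in> {a..b} \<Longrightarrow> norm (f t) \<le> B" "B \<ge> 0"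
    using continuous_on_compact_bound[OF compact_Icc AC_imp_continuous_on[OF f]] by metis
  obtain C where C: "\<And>t. t \<in> {a..b} \<Longrightarrow> norm (g t) \<le> C" "C \<ge> 0"
    using continuous_on_compact_bound[OF compact_Icc AC_imp_continuous_on[OF g]] by metis
  show ?thesis
  proof (rule AC_Lipschitz_combination[OF f g, of _ "K * (B + C)"])
    fix s t assume st: "s \<in> {a..b}" "t \<in> {a..b}"
    have "h (f t) (g t) - h (f s) (g s) = h (f t - f s) (g t) + h (f s) (g t - g s)"
      by (simp add: diff_left diff_right)
    also have "norm \<dots> \<le> norm (f t - f s) * norm (g t) * K + norm (f s) * norm (g t - g s) * K"
      by (intro order.trans[OF norm_triangle_ineq] add_mono K)
    also have "\<dots> \<le> norm (f t - f s) * C * K + B * norm (g t - g s) * K"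
      using st B C K by (intro add_mono mult_right_mono mult_left_mono) auto
    also have "\<dots> \<le> norm (f t - f s) * (B + C) * K + (B + C) * norm (g t - g s) * K"
      using B C K by (intro add_mono mult_right_mono mult_left_mono) auto
    also have "\<dots> = K * (B + C) * (norm (f t - f s) + norm (g t - g s))" by (simp add: algebra_simps)
    finally show "norm (h (f t) (g t) - h (f s) (g s)) \<le> \<dots>" .
  qed
qed

lemma AE_lebesgue_negligible:
  assumes "AE t in lebesgue. P t"
  obtains N where "negligible N" "\<And>t. t \<notin> N \<Longrightarrow> P t"
  using assms unfolding eventually_ae_filter_negligible by blast

lemma negligible_AE_lebesgue:
  assumes "negligible N" "\<And>t. t \<notin> N \<Longrightarrow> P t"
  shows "AE t in lebesgue. P t"
  using assms unfolding eventually_ae_filter_negligible by blast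

lemma negligible_open_cover:
  fixes N :: "real set"
  assumes "negligible N" "d > 0"
  obtains U where "open U" "N \<subseteq> U" "U \<in> lmeasurable" "measure lebesgue U < d"
proof -
  obtain U where U: "open U" "N \<subseteq> U" "U - N \<in> lmeasurable" "emeasure lebesgue (U - N) < ennreal d"
    using sets_lebesgue_outer_open[OF negligible_imp_sets[OF assms(1)] assms(2)] by metis
  have UN: "U = (U - N) \<union> N" using U(2) by auto
  have Um: "U \<in> lmeasurable"
    using U(3) negligible_imp_measurable[OF assms(1)] UN by (metis fmeasurable.Un)
  have "measure lebesgue U = measure lebesgue (U - N)"
    using negligible_imp_measure0[OF assms(1)] U(2) Um assms(1)
    by (simp add: measure_Diff_null_set negligible_iff_null_sets[symmetric] fmeasurable.sets_into_space fmeasurableD)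
  also have "\<dots> < d" using U(3,4) assms(2)
    by (simp add: emeasure_eq_measure2 ennreal_less_iff)
  finally show ?thesis using that U Um by blast
qed

text \<open>Let \<open>f\<close> have derivative \<open>0\<close> outside a null set \<open>N\<close>. In a sufficiently fine tagged
  division, the intervals tagged outside \<open>N\<close> contribute at most \<open>e * (b - a)\<close> to the total
  increment, because \<open>f\<close> is flat at the tags, while those tagged in \<open>N\<close> lie in an open set of
  small measure, where absolute continuity bounds their contribution.\<close>

lemma AC_zero_derivative_endpoints:
  assumes f: "AC a b f" and "a \<le> b"
    and der: "AE t in lebesgue. t \<in> {a..b} \<longrightarrow> (f has_vector_derivative 0) (at t within {a..b})"
  shows "f b = f a"
proof -
  obtain N where N: "negligible N"
    and der: "\<And>t. t \<notin> N \<Longrightarrow> t \<in> {a..b} \<Longrightarrow> (f has_vector_derivative 0) (at t within {a..b})"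
    using AE_lebesgue_negligible[OF der] by blast
  have bound: "norm (f b - f a) \<le> e * (1 + (b - a))" if "e > 0" for e
  proof -
    obtain d where d: "d > 0" and *: "\<And>\<D> S. \<D> division_of S \<Longrightarrow> S \<subseteq> {a..b} \<Longrightarrow> (\<Sum>K\<in>\<D>. Sup K - Inf K) < d \<Longrightarrow>
      (\<Sum>K\<in>\<D>. norm (f (Sup K) - f (Inf K))) < e"
      using f \<open>e > 0\<close> unfolding absolutely_continuous_on_interval_def by meson
    obtain U where U: "open U" "N \<subseteq> U" "U \<in> lmeasurable" "measure lebesgue U < d"
      using negligible_open_cover[OF N d] by blast
    have "\<exists>r>0. \<forall>y\<in>{a..b}. \<bar>y - x\<bar> < r \<longrightarrow> norm (f y - f x) \<le> e * \<bar>y - x\<bar>" if "x \<notin> N" "x \<in> {a..b}" for x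
      using der[OF that] \<open>e > 0\<close> unfolding has_vector_derivative_def has_derivative_within_alt by simp
    then obtain r where r: "\<And>x. x \<notin> N \<Longrightarrow> x \<in> {a..b} \<Longrightarrow> r x > 0"
      and rb: "\<And>x y. x \<notin> N \<Longrightarrow> x \<in> {a..b} \<Longrightarrow> y \<in> {a..b} \<Longrightarrow> \<bar>y - x\<bar> < r x \<Longrightarrow> norm (f y - f x) \<le> e * \<bar>y - x\<bar>"
      by metis
    define \<gamma> where "\<gamma> = (\<lambda>x. if x \<in> N then U else if x \<in> {a..b} then ball x (r x) else UNIV)"
    have "gauge \<gamma>" using U r by (auto simp: gauge_def \<gamma>_def)
    then obtain p where p: "p tagged_division_of {a..b}" "\<gamma> fine p"
      using fine_division_exists_real by blast
    define q where "q = {(x,K) \<in> p. x \<in> N}"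
    have qp: "q \<subseteq> p" by (auto simp: q_def)
    have finp: "finite p" using p(1) by blast
    have Kp: "\<exists>u v. K = {u..v} \<and> u \<le> x \<and> x \<le> v \<and> a \<le> u \<and> v \<le> b \<and> Inf K = u \<and> Sup K = v" if xK: "(x,K) \<in> p" for x K
    proof -
      obtain u v where "K = {u..v}" using tagged_division_ofD(4)[OF p(1) xK] by auto
      moreover have "x \<in> K" "K \<subseteq> {a..b}" using tagged_division_ofD(2,3)[OF p(1) xK] by auto
      ultimately show ?thesis by auto
    qed
    have "f b - f a = (\<Sum>(x,K)\<in>p. f (Sup K) - f (Inf K))"
      by (rule additive_tagged_division_1[OF \<open>a \<le> b\<close> p(1), symmetric])
    also have "\<dots> = (\<Sum>(x,K)\<in>q. f (Sup K) - f (Inf K)) + (\<Sum>(x,K)\<in>p - q. f (Sup K) - f (Inf K))"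
      using finp qp by (metis (no_types, lifting) sum.subset_diff add.commute)
    finally have split: "norm (f b - f a) \<le> norm (\<Sum>(x,K)\<in>q. f (Sup K) - f (Inf K)) + norm (\<Sum>(x,K)\<in>p - q. f (Sup K) - f (Inf K))"
      by (simp add: norm_triangle_ineq)
    have "norm (\<Sum>(x,K)\<in>p - q. f (Sup K) - f (Inf K)) \<le> (\<Sum>(x,K)\<in>p - q. e * (Sup K - Inf K))"
    proof (rule sum_norm_le, clarify)
      fix x K assume xK: "(x,K) \<in> p" "(x,K) \<notin> q"
      then have xN: "x \<notin> N" by (auto simp: q_def)
      obtain u v where uv: "K = {u..v}" "u \<le> x" "x \<le> v" "a \<le> u" "v \<le> b" "Inf K = u" "Sup K = v" using Kp[OF xK(1)] by blast
      have "K \<subseteq> ball x (r x)" using p(2) xK(1) xN uv by (fastforce simp: fine_def \<gamma>_def)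
      then have "u \<in> ball x (r x)" "v \<in> ball x (r x)" unfolding uv(1) using uv(2,3) by (meson atLeastAtMost_iff order_refl order_trans subsetD)+
      then have "norm (f u - f x) \<le> e * (x - u)" "norm (f v - f x) \<le> e * (v - x)"
        using rb[OF xN, of u] rb[OF xN, of v] uv by (auto simp: dist_real_def)
      then have "norm (f v - f u) \<le> e * (v - x) + e * (x - u)"
        by (smt (verit) norm_minus_commute norm_triangle_sub norm_diff_triangle_ineq diff_add_cancel norm_triangle_ineq4 add_diff_cancel_left' diff_diff_eq2)
      then show "norm (f (Sup K) - f (Inf K)) \<le> e * (Sup K - Inf K)" using uv by (simp add: algebra_simps)
    qed
    also have "\<dots> \<le> (\<Sum>(x,K)\<in>p. e * (Sup K - Inf K))"
      using finp Kp \<open>e > 0\<close> by (intro sum_mono2) (auto, fastforce)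
    also have "\<dots> = e * (\<Sum>(x,K)\<in>p. (Sup K - Inf K))" by (simp add: sum_distrib_left case_prod_unfold)
    also have "(\<Sum>(x,K)\<in>p. (Sup K - Inf K)) = b - a"
      using additive_tagged_division_1[OF \<open>a \<le> b\<close> p(1), of "\<lambda>x. x"] by simp
    finally have off: "norm (\<Sum>(x,K)\<in>p - q. f (Sup K) - f (Inf K)) \<le> e * (b - a)" .
    have q: "q tagged_division_of (\<Union>(snd ` q))"
      using tagged_partial_division_of_Union_self tagged_partial_division_subset[OF _ qp] p(1)
      unfolding tagged_division_of_def by metis
    have qd: "snd ` q division_of (\<Union>(snd ` q))" using division_of_tagged_division[OF q] .
    have qsub: "\<Union>(snd ` q) \<subseteq> {a..b}"
    proof (rule Union_least)
      fix K assume "K \<in> snd ` q"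
      then obtain x where "(x, K) \<in> p" using qp by auto
      then show "K \<subseteq> {a..b}" by (rule tagged_division_ofD(3)[OF p(1)])
    qed
    have qU: "\<Union>(snd ` q) \<subseteq> U" using p(2) by (fastforce simp: fine_def \<gamma>_def q_def)
    have "(\<Sum>K\<in>snd ` q. Sup K - Inf K) = (\<Sum>K\<in>snd ` q. measure lebesgue K)"
    proof (rule sum.cong[OF refl])
      fix K assume "K \<in> snd ` q"
      then obtain x where "(x, K) \<in> p" using qp by auto
      from Kp[OF this] obtain v w where "K = {v..w}" "v \<le> w" "Inf K = v" "Sup K = w" by force
      then show "Sup K - Inf K = measure lebesgue K" by simp
    qed
    also have "\<dots> = measure lebesgue (\<Union>(snd ` q))" using content_division[OF qd] by simp
    also have "\<dots> \<le> measure lebesgue U"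
      using qd qU U(3) by (intro measure_mono_fmeasurable) (auto intro!: fmeasurableD lmeasurable_division)
    finally have "(\<Sum>K\<in>snd ` q. Sup K - Inf K) < d" using U(4) by simp
    from *[OF qd qsub this] have S: "(\<Sum>K\<in>snd ` q. norm (f (Sup K) - f (Inf K))) < e" .
    define \<Delta> where "\<Delta> K = (if K = {} then 0 else norm (f (Sup K) - f (Inf K)))" for K
    have \<Delta>: "\<Delta> K = norm (f (Sup K) - f (Inf K))" if "(x, K) \<in> q" for x K
      using Kp[of x K] qp that by (fastforce simp: \<Delta>_def)
    have "(\<Sum>(x,K)\<in>q. \<Delta> K) = sum \<Delta> (snd ` q)"
    proof (rule sum.over_tagged_division_lemma[OF q])
      fix u v :: real assume "box u v = {}"
      then have "v \<le> u" by simp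
      then show "\<Delta> (cbox u v) = 0"
        by (cases "u = v") (auto simp: \<Delta>_def)
    qed
    moreover have "(\<Sum>(x,K)\<in>q. \<Delta> K) = (\<Sum>(x,K)\<in>q. norm (f (Sup K) - f (Inf K)))"
      using \<Delta> by (intro sum.cong) auto
    moreover have "sum \<Delta> (snd ` q) = (\<Sum>K\<in>snd ` q. norm (f (Sup K) - f (Inf K)))"
      using \<Delta> by (intro sum.cong) auto
    ultimately have "(\<Sum>(x,K)\<in>q. norm (f (Sup K) - f (Inf K))) = (\<Sum>K\<in>snd ` q. norm (f (Sup K) - f (Inf K)))"
      by simp
    then have "norm (\<Sum>(x,K)\<in>q. f (Sup K) - f (Inf K)) \<le> e"
      using S norm_sum[of "\<lambda>(x,K). f (Sup K) - f (Inf K)" q] by (simp add: case_prod_unfold)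
    with split off show ?thesis by (simp add: algebra_simps)
  qed
  have "norm (f b - f a) \<le> 0"
  proof (rule field_le_epsilon)
    fix e :: real assume "e > 0"
    moreover have c: "1 + (b - a) > 0" using \<open>a \<le> b\<close> by simp
    moreover have "e / (1 + (b - a)) * (1 + (b - a)) = e" 
    proof -
      have "x / c * c = x" if "c > 0" for x c :: real using that by simp
      from this[OF c] show ?thesis .
    qed
    ultimately show "norm (f b - f a) \<le> 0 + e"
      using bound[of "e / (1 + (b - a))"] by simp
  qed
  then show ?thesis by simp
qed


lemma AC_zero_derivative_const:
  assumes f: "AC a b f"
    and der: "AE t in lebesgue. t \<in> {a..b} \<longrightarrow> (f has_vector_derivative 0) (at t within {a..b})"
    and t: "t \<in> {a..b}"
  shows "f t = f a"
proof (rule AC_zero_derivative_endpoints)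
  show "AC a t f" using AC_subinterval[OF f, of a t] t by simp
  show "AE x in lebesgue. x \<in> {a..t} \<longrightarrow> (f has_vector_derivative 0) (at x within {a..t})"
    using der by (rule AE_mp) (use t in \<open>auto intro!: AE_I2 intro: has_vector_derivative_within_subset\<close>)
qed (use t in simp)

lemma integral_Icc_diff:
  fixes u :: "real \<Rightarrow> 'a::euclidean_space"
  assumes "u integrable_on {a..b}" "a \<le> x" "x \<le> y" "y \<le> b"
  shows "integral {a..y} u - integral {a..x} u = integral {x..y} u"
proof -
  have "u integrable_on {a..y}" using assms by (auto intro: integrable_subinterval_real)
  from Henstock_Kurzweil_Integration.integral_combine[OF _ _ this, of x] show ?thesis
    using assms by (simp add: algebra_simps)
qed

text \<open>Truncate \<open>norm u\<close> at a height \<open>k\<close> so large that the integral of the excess is below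
  \<open>e / 2\<close>; over a union of intervals of total length less than \<open>d\<close> the truncated part
  contributes at most \<open>k * d\<close>.\<close>

lemma AC_indefinite_integral:
  fixes u :: "real \<Rightarrow> 'a::euclidean_space"
  assumes u: "u absolutely_integrable_on {a..b}"
  shows "AC a b (\<lambda>t. integral {a..t} u)"
  unfolding absolutely_continuous_on_interval_def
proof (intro allI impI)
  fix e :: real assume "e > 0"
  define g where "g = (\<lambda>(k::nat) t. min (norm (u t)) (real k))"
  have n: "(\<lambda>t. norm (u t)) absolutely_integrable_on {a..b}" using u by (simp add: absolutely_integrable_on_def)
  then have ni: "(\<lambda>t. norm (u t)) integrable_on {a..b}" by (simp add: absolutely_integrable_on_def)
  have g: "g k integrable_on {a..b}" for k
    unfolding g_def using absolutely_integrable_min_1[OF n, of "\<lambda>t. real k"] integrable_const_ivl[of "real k" a b]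
    by (simp add: absolutely_integrable_on_def)
  have "(\<lambda>k. integral {a..b} (g k)) \<longlonglongrightarrow> integral {a..b} (\<lambda>t. norm (u t))"
  proof (rule dominated_convergence(2)[OF g ni])
    show "norm (g k t) \<le> norm (u t)" for k t by (simp add: g_def)
    fix t
    obtain m :: nat where "norm (u t) \<le> real m" using real_arch_simple by blast
    then have "eventually (\<lambda>k. g k t = norm (u t)) sequentially"
      unfolding eventually_sequentially g_def by (intro exI[of _ m]) (auto simp: min_def)
    then show "(\<lambda>k. g k t) \<longlonglongrightarrow> norm (u t)" by (rule tendsto_eventually)
  qed
  then have "eventually (\<lambda>k. dist (integral {a..b} (g k)) (integral {a..b} (\<lambda>t. norm (u t))) < e / 2) sequentially"
    using \<open>e > 0\<close> by (intro tendstoD) auto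
  then obtain k where "dist (integral {a..b} (g k)) (integral {a..b} (\<lambda>t. norm (u t))) < e / 2"
    by (auto simp: eventually_sequentially)
  then have k: "integral {a..b} (\<lambda>t. norm (u t) - g k t) < e / 2"
    using integral_diff[OF ni g[of k]] by (auto simp: dist_real_def abs_if split: if_splits)
  define d where "d = e / (2 * (real k + 1))"
  have d: "d > 0" using \<open>e > 0\<close> by (simp add: d_def)
  have "(\<Sum>K\<in>\<D>. norm (integral {a..Sup K} u - integral {a..Inf K} u)) < e"
    if D: "\<D> division_of S" "S \<subseteq> {a..b}" "(\<Sum>K\<in>\<D>. Sup K - Inf K) < d" for \<D> S
  proof -
    have ui: "u integrable_on {a..b}" using u by (simp add: absolutely_integrable_on_def)
    have sub: "K \<subseteq> {a..b}" if K: "K \<in> \<D>" for K using division_ofD(2)[OF D(1) K] D(2) by blast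
    have on: "h integrable_on K" if h: "h integrable_on {a..b}" and K: "K \<in> \<D>" for h :: "real \<Rightarrow> real" and K
      using integrable_subinterval_real[OF h, of "Inf K" "Sup K"] division_Sup_Inf_subset(1)[OF D(1,2) K] sub[OF K] by simp
    have "(\<Sum>K\<in>\<D>. norm (integral {a..Sup K} u - integral {a..Inf K} u))
        \<le> (\<Sum>K\<in>\<D>. integral K (\<lambda>t. norm (u t) - g k t) + real k * (Sup K - Inf K))"
    proof (rule sum_mono)
      fix K assume K: "K \<in> \<D>"
      note KI = division_Sup_Inf_subset[OF D(1,2) K]
      have "integral {a..Sup K} u - integral {a..Inf K} u = integral {Inf K..Sup K} u"
        using KI by (intro integral_Icc_diff[OF ui]) auto
      then have "norm (integral {a..Sup K} u - integral {a..Inf K} u) = norm (integral K u)"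
        using KI(1) by simp
      also have "\<dots> \<le> integral K (\<lambda>t. norm (u t))"
        using KI(1) sub[OF K] by (intro integral_norm_bound_integral on[OF ni K]) (metis integrable_subinterval_real ui, simp)
      also have "\<dots> = integral K (\<lambda>t. norm (u t) - g k t) + integral K (g k)"
        using integral_diff[OF on[OF ni K] on[OF g K, of k]] by simp
      also have "integral K (g k) \<le> integral K (\<lambda>t. real k)"
        using KI(1) by (intro integral_le on[OF g K]) (metis integrable_const_ivl, simp add: g_def)
      also have "integral K (\<lambda>t. real k) = real k * (Sup K - Inf K)"
        using KI(1,2) by (metis integral_const_real content_real mult.commute real_scaleR_def)
      finally show "norm (integral {a..Sup K} u - integral {a..Inf K} u) \<le> integral K (\<lambda>t. norm (u t) - g k t) + real k * (Sup K - Inf K)"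
        by simp
    qed
    also have "\<dots> = (\<Sum>K\<in>\<D>. integral K (\<lambda>t. norm (u t) - g k t)) + real k * (\<Sum>K\<in>\<D>. Sup K - Inf K)"
      by (simp only: sum.distrib sum_distrib_left)
    also have "(\<Sum>K\<in>\<D>. integral K (\<lambda>t. norm (u t) - g k t)) = integral S (\<lambda>t. norm (u t) - g k t)"
      by (rule integral_combine_division_topdown[OF integrable_on_subdivision[OF D(1) integrable_diff[OF ni g] D(2)] D(1), symmetric])
    also have "\<dots> \<le> integral {a..b} (\<lambda>t. norm (u t) - g k t)"
      by (rule integral_subset_le[OF D(2)])
        (auto intro!: integrable_diff ni g integrable_on_subdivision[OF D(1) _ D(2)], simp add: g_def)
    also have "\<dots> + real k * (\<Sum>K\<in>\<D>. Sup K - Inf K) \<le> integral {a..b} (\<lambda>t. norm (u t) - g k t) + real k * d"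
      using D(3) by (intro add_left_mono mult_left_mono) auto
    also have "\<dots> < e / 2 + e / 2"
      using k \<open>e > 0\<close> by (intro add_less_le_mono) (auto simp: d_def field_simps)
    finally show ?thesis by simp
  qed
  with d show "\<exists>d>0. \<forall>\<D> S. \<D> division_of S \<and> S \<subseteq> {a..b} \<and> (\<Sum>K\<in>\<D>. Sup K - Inf K) < d \<longrightarrow>
      (\<Sum>K\<in>\<D>. norm (integral {a..Sup K} u - integral {a..Inf K} u)) < e" by blast
qed

text \<open>Lebesgue differentiation with respect to the intervals to the right of a point. Applying
  it to \<open>f\<close> and to its reflection yields the two-sided derivative in the next lemma.\<close>

lemma indefinite_integral_right_derivative:
  fixes f :: "real \<Rightarrow> 'a::euclidean_space"
  assumes "\<And>a b. f integrable_on {a..b}"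
  obtains N where "negligible N"
    "\<And>x e. x \<notin> N \<Longrightarrow> 0 < e \<Longrightarrow> \<exists>d>0. \<forall>h. 0 < h \<and> h < d \<longrightarrow> norm (integral {x..x + h} f - h *\<^sub>R f x) \<le> e * h"
proof -
  have bound: "norm (integral {x..x + h} f - h *\<^sub>R f x) \<le> e * h"
    if "0 < h" "norm (integral (cbox x (x + h *\<^sub>R One)) f /\<^sub>R h ^ DIM(real) - f x) < e" for x h e :: real
  proof -
    have "integral {x..x + h} f - h *\<^sub>R f x = h *\<^sub>R (integral (cbox x (x + h *\<^sub>R One)) f /\<^sub>R h ^ DIM(real) - f x)"
      using that by (simp add: scaleR_diff_right)
    also have "norm \<dots> = h * norm (integral (cbox x (x + h *\<^sub>R One)) f /\<^sub>R h ^ DIM(real) - f x)"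
      using that(1) by simp
    also have "\<dots> \<le> h * e" using that by (intro mult_left_mono) auto
    finally show ?thesis by (simp only: mult.commute)
  qed
  have "f integrable_on cbox a b" for a b using assms by simp
  then show ?thesis
  proof (rule integrable_ccontinuous_explicit[of f])
    fix N :: "real set"
    assume N: "negligible N"
    assume *: "\<And>(x::real) e. x \<notin> N \<Longrightarrow> 0 < e \<Longrightarrow> \<exists>d>0. \<forall>h. 0 < h \<and> h < d \<longrightarrow>
        norm (integral (cbox x (x + h *\<^sub>R (One::real))) f /\<^sub>R h ^ DIM(real) - f x) < e"
    show ?thesis
    proof (rule that[OF N])
      fix x and e :: real assume "x \<notin> N" "0 < e"
      from *[OF this] obtain d where "d > 0" "\<forall>h. 0 < h \<and> h < d \<longrightarrow>
        norm (integral (cbox x (x + h *\<^sub>R One)) f /\<^sub>R h ^ DIM(real) - f x) < e" by (elim exE conjE)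
      with bound show "\<exists>d>0. \<forall>h. 0 < h \<and> h < d \<longrightarrow> norm (integral {x..x + h} f - h *\<^sub>R f x) \<le> e * h"
        by (intro exI[of _ d]) simp
    qed
  qed
qed

lemma AE_indefinite_integral_has_vector_derivative:
  fixes u :: "real \<Rightarrow> 'a::euclidean_space"
  assumes u: "u integrable_on {a..b}"
  shows "AE t in lebesgue. t \<in> {a..b} \<longrightarrow>
    ((\<lambda>t. integral {a..t} u) has_vector_derivative u t) (at t within {a..b})"
proof -
  define f where "f = (\<lambda>x. if x \<in> {a..b} then u x else 0)"
  have "f integrable_on UNIV" unfolding f_def using u integrable_restrict_UNIV by blast
  then have f: "f integrable_on {c..d}" for c d
    by (metis UNIV_I box_real(2) integrable_on_subcbox subsetI)
  then have fr: "(\<lambda>x. f (- x)) integrable_on {c..d}" for c d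
    using Henstock_Kurzweil_Integration.integrable_reflect_real[of f "- c" "- d"] f[of "- d" "- c"]
    by (simp only: minus_minus)
  obtain N1 where N1: "negligible N1"
    "\<And>x e. x \<notin> N1 \<Longrightarrow> 0 < e \<Longrightarrow> \<exists>d>0. \<forall>h. 0 < h \<and> h < d \<longrightarrow> norm (integral {x..x + h} f - h *\<^sub>R f x) \<le> e * h"
    using indefinite_integral_right_derivative[OF f] by blast
  obtain N2 where N2: "negligible N2"
    "\<And>x e. x \<notin> N2 \<Longrightarrow> 0 < e \<Longrightarrow> \<exists>d>0. \<forall>h. 0 < h \<and> h < d \<longrightarrow> norm (integral {x..x + h} (\<lambda>x. f (- x)) - h *\<^sub>R f (- x)) \<le> e * h"
    using indefinite_integral_right_derivative[OF fr] by blast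
  have N: "negligible (N1 \<union> uminus ` N2)"
    by (intro negligible_Un N1(1) negligible_differentiable_image_negligible[OF order_refl N2(1)]
        differentiable_on_minus differentiable_on_ident)
  have "((\<lambda>t. integral {a..t} u) has_vector_derivative u t) (at t within {a..b})"
    if tN: "t \<notin> N1 \<union> uminus ` N2" and t: "t \<in> {a..b}" for t
    unfolding has_vector_derivative_def has_derivative_within_alt
  proof (intro conjI allI impI)
    show "bounded_linear (\<lambda>x. x *\<^sub>R u t)" by (simp add: bounded_linear_scaleR_left)
    fix e :: real assume "e > 0"
    obtain d1 where d1: "d1 > 0" "\<And>h. 0 < h \<Longrightarrow> h < d1 \<Longrightarrow> norm (integral {t..t + h} f - h *\<^sub>R f t) \<le> e * h"
      using N1(2)[of t e] tN \<open>e > 0\<close> by (meson UnI1)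
    have "- t \<notin> N2" using tN by (metis UnCI image_eqI minus_minus)
    then obtain d2 where d2: "d2 > 0" "\<And>h. 0 < h \<Longrightarrow> h < d2 \<Longrightarrow> norm (integral {- t..- t + h} (\<lambda>x. f (- x)) - h *\<^sub>R f t) \<le> e * h"
      using N2(2)[of "- t" e, unfolded minus_minus] \<open>e > 0\<close> by meson
    have "norm (integral {a..y} u - integral {a..t} u - (y - t) *\<^sub>R u t) \<le> e * norm (y - t)"
      if y: "y \<in> {a..b}" "norm (y - t) < min d1 d2" for y
    proof -
      have fu: "integral {c..d} f = integral {c..d} u" if "a \<le> c" "d \<le> b" for c d
        by (rule integral_cong) (use that in \<open>auto simp: f_def\<close>)
      have ft: "f t = u t" using t by (simp add: f_def)
      consider "y = t" | "t < y" | "y < t" by linarith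
      then show ?thesis
      proof cases
        case 2
        have "integral {a..y} u - integral {a..t} u = integral {t..y} f"
          using integral_Icc_diff[OF u, of t y] t y 2 fu[of t y] by simp
        moreover have "norm (integral {t..t + (y - t)} f - (y - t) *\<^sub>R f t) \<le> e * (y - t)"
          by (rule d1(2)) (use 2 y in auto)
        ultimately show ?thesis using 2 ft by simp
      next
        case 3
        have "integral {a..t} u - integral {a..y} u = integral {y..t} f"
          using integral_Icc_diff[OF u, of y t] t y 3 fu[of y t] by simp
        also have "\<dots> = integral {- t..- y} (\<lambda>x. f (- x))"
          using Henstock_Kurzweil_Integration.integral_reflect_real[of t y f] by simp
        finally have *: "integral {a..y} u - integral {a..t} u - (y - t) *\<^sub>R u t
            = - (integral {- t..- y} (\<lambda>x. f (- x)) - (t - y) *\<^sub>R f t)"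
          using ft by (simp add: algebra_simps)
        have "norm (integral {- t..- y} (\<lambda>x. f (- x)) - (t - y) *\<^sub>R f t) \<le> e * (t - y)"
          using d2(2)[of "t - y"] 3 y(2) by simp
        then show ?thesis unfolding * norm_minus_cancel using 3 by simp
      qed auto
    qed
    moreover have "min d1 d2 > 0" using d1(1) d2(1) by simp
    ultimately show "\<exists>d>0. \<forall>y\<in>{a..b}. norm (y - t) < d \<longrightarrow>
        norm (integral {a..y} u - integral {a..t} u - (y - t) *\<^sub>R u t) \<le> e * norm (y - t)"
      by blast
  qed
  then show ?thesis by (intro negligible_AE_lebesgue[OF N]) simp
qed

lemma AC_eq_integral_derivative:
  fixes f g :: "real \<Rightarrow> 'a::euclidean_space"
  assumes f: "AC a b f" and g: "g absolutely_integrable_on {a..b}"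
    and der: "AE t in lebesgue. t \<in> {a..b} \<longrightarrow> (f has_vector_derivative g t) (at t within {a..b})"
    and t: "t \<in> {a..b}"
  shows "f t = f a + integral {a..t} g"
proof -
  have gi: "g integrable_on {a..b}" using g by (simp add: absolutely_integrable_on_def)
  have "AC a b (\<lambda>t. - integral {a..t} g)"
    by (rule AC_bounded_linear[OF AC_indefinite_integral[OF g]]) (rule bounded_linear_minus[OF bounded_linear_ident])
  from AC_add[OF f this] have "AC a b (\<lambda>t. f t - integral {a..t} g)" by simp
  moreover have "AE t in lebesgue. t \<in> {a..b} \<longrightarrow> ((\<lambda>t. f t - integral {a..t} g) has_vector_derivative 0) (at t within {a..b})"
    using der AE_indefinite_integral_has_vector_derivative[OF gi]
  proof eventually_elim
    case (elim t)
    then show ?case using has_vector_derivative_diff[of f "g t" "at t within {a..b}" "\<lambda>t. integral {a..t} g" "g t"] by simp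
  qed
  ultimately have "f t - integral {a..t} g = f a - integral {a..a} g"
    using t by (rule AC_zero_derivative_const)
  then show ?thesis by (simp add: algebra_simps)
qed

section \<open>Smooth maps and groups in exponential coordinates\<close>

lemma smooth_differentiable: "smooth f \<Longrightarrow> f differentiable (at x)"
  unfolding smooth_def by (metis C_k.simps(2))

lemma smooth_frechet_derivative: "smooth f \<Longrightarrow> smooth (\<lambda>x. frechet_derivative f (at x) v)"
  unfolding smooth_def by (metis C_k.simps(2))

lemma smooth_continuous: "smooth f \<Longrightarrow> continuous_on S f"
  unfolding smooth_def by (metis C_k.simps(1) continuous_on_subset subset_UNIV)

lemma smooth_has_derivative: "smooth f \<Longrightarrow> (f has_derivative frechet_derivative f (at x)) (at x)"
  using smooth_differentiable frechet_derivative_works by blast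

lemma smooth_has_vector_derivative_line:
  assumes "smooth f"
  shows "((\<lambda>t. f (x + t *\<^sub>R v)) has_vector_derivative frechet_derivative f (at (x + t *\<^sub>R v)) v) (at t)"
proof -
  have "((\<lambda>t. x + t *\<^sub>R v) has_derivative (\<lambda>h. h *\<^sub>R v)) (at t)" by (auto intro!: derivative_eq_intros)
  from has_derivative_compose[OF this smooth_has_derivative[OF assms]]
  have "((\<lambda>t. f (x + t *\<^sub>R v)) has_derivative (\<lambda>h. frechet_derivative f (at (x + t *\<^sub>R v)) (h *\<^sub>R v))) (at t)" .
  moreover have "frechet_derivative f (at (x + t *\<^sub>R v)) (h *\<^sub>R v) = h *\<^sub>R frechet_derivative f (at (x + t *\<^sub>R v)) v" for h
    using linear_frechet_derivative[OF smooth_differentiable[OF assms]] by (rule linear_cmul)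
  ultimately show ?thesis by (simp add: has_vector_derivative_def)
qed

text \<open>Two applications of the mean value theorem. Evaluating the symmetric second difference in
  the two possible orders gives the symmetry of second derivatives below.\<close>

lemma second_difference_mean_value:
  fixes f :: "'a::euclidean_space \<Rightarrow> 'b::euclidean_space"
  assumes f: "smooth f" and "r > 0"
  shows "\<exists>\<xi>\<in>{0..r}. \<exists>\<eta>\<in>{0..r}.
    (f (x + r *\<^sub>R v + r *\<^sub>R w) - f (x + r *\<^sub>R v) - f (x + r *\<^sub>R w) + f x) \<bullet> b
    = r * (r * (frechet_derivative (\<lambda>x. frechet_derivative f (at x) v) (at (x + \<xi> *\<^sub>R v + \<eta> *\<^sub>R w)) w \<bullet> b))"
proof -
  define Dv where "Dv = (\<lambda>x. frechet_derivative f (at x) v)"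
  have Dv: "smooth Dv" unfolding Dv_def by (rule smooth_frechet_derivative[OF f])
  define \<phi> where "\<phi> = (\<lambda>s. (f ((x + r *\<^sub>R w) + s *\<^sub>R v) - f (x + s *\<^sub>R v)) \<bullet> b)"
  have "DERIV \<phi> s :> (Dv ((x + r *\<^sub>R w) + s *\<^sub>R v) - Dv (x + s *\<^sub>R v)) \<bullet> b" for s
    unfolding \<phi>_def Dv_def has_real_derivative_iff_has_vector_derivative
    by (intro bounded_linear.has_vector_derivative[OF bounded_linear_inner_left] has_vector_derivative_diff
        smooth_has_vector_derivative_line f)
  then obtain \<xi> where \<xi>: "0 < \<xi>" "\<xi> < r" "\<phi> r - \<phi> 0 = (r - 0) * ((Dv ((x + r *\<^sub>R w) + \<xi> *\<^sub>R v) - Dv (x + \<xi> *\<^sub>R v)) \<bullet> b)"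
    using MVT2[OF \<open>r > 0\<close>, of \<phi> "\<lambda>s. (Dv ((x + r *\<^sub>R w) + s *\<^sub>R v) - Dv (x + s *\<^sub>R v)) \<bullet> b"] by blast
  define \<psi> where "\<psi> = (\<lambda>t. Dv ((x + \<xi> *\<^sub>R v) + t *\<^sub>R w) \<bullet> b)"
  have "DERIV \<psi> t :> frechet_derivative Dv (at ((x + \<xi> *\<^sub>R v) + t *\<^sub>R w)) w \<bullet> b" for t
    unfolding \<psi>_def has_real_derivative_iff_has_vector_derivative
    by (intro bounded_linear.has_vector_derivative[OF bounded_linear_inner_left] smooth_has_vector_derivative_line Dv)
  then obtain \<eta> where \<eta>: "0 < \<eta>" "\<eta> < r" "\<psi> r - \<psi> 0 = (r - 0) * (frechet_derivative Dv (at ((x + \<xi> *\<^sub>R v) + \<eta> *\<^sub>R w)) w \<bullet> b)"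
    using MVT2[OF \<open>r > 0\<close>, of \<psi> "\<lambda>t. frechet_derivative Dv (at ((x + \<xi> *\<^sub>R v) + t *\<^sub>R w)) w \<bullet> b"] by blast
  have "(f (x + r *\<^sub>R v + r *\<^sub>R w) - f (x + r *\<^sub>R v) - f (x + r *\<^sub>R w) + f x) \<bullet> b = \<phi> r - \<phi> 0"
    by (simp add: \<phi>_def algebra_simps inner_diff_left inner_add_left)
  also have "\<dots> = r * (\<psi> r - \<psi> 0)" unfolding \<xi>(3) by (simp add: \<psi>_def algebra_simps)
  finally show ?thesis using \<xi>(1,2) \<eta> unfolding Dv_def by (intro bexI[of _ \<xi>] bexI[of _ \<eta>]) auto
qed

text \<open>Both second derivatives are limits of the same second difference quotient. The vector \<open>b\<close>
  against which the difference is tested is the difference itself.\<close>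

lemma smooth_mixed_derivatives_commute:
  fixes f :: "'a::euclidean_space \<Rightarrow> 'b::euclidean_space"
  assumes f: "smooth f"
  shows "frechet_derivative (\<lambda>x. frechet_derivative f (at x) v) (at x) w
    = frechet_derivative (\<lambda>x. frechet_derivative f (at x) w) (at x) v"
proof -
  define A where "A = (\<lambda>y. frechet_derivative (\<lambda>x. frechet_derivative f (at x) v) (at y) w)"
  define B where "B = (\<lambda>y. frechet_derivative (\<lambda>x. frechet_derivative f (at x) w) (at y) v)"
  have "continuous_on UNIV A" "continuous_on UNIV B"
    unfolding A_def B_def by (intro smooth_continuous smooth_frechet_derivative f)+
  then have cA: "isCont A x" and cB: "isCont B x"
    by (simp_all add: continuous_on_eq_continuous_at)
  have "norm (A x - B x) \<le> 0"
  proof (rule field_le_epsilon)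
    fix e :: real assume "e > 0"
    obtain d1 where d1: "d1 > 0" "\<And>y. dist y x < d1 \<Longrightarrow> dist (A y) (A x) < e / 2"
      using cA \<open>e > 0\<close> unfolding continuous_at_eps_delta by (meson half_gt_zero)
    obtain d2 where d2: "d2 > 0" "\<And>y. dist y x < d2 \<Longrightarrow> dist (B y) (B x) < e / 2"
      using cB \<open>e > 0\<close> unfolding continuous_at_eps_delta by (meson half_gt_zero)
    \<comment> \<open>Within distance \<open>min d1 d2\<close> of \<open>x\<close> both second derivatives vary by less than \<open>e / 2\<close>; the points produced by the mean value theorem are that close.\<close>
    define r where "r = min d1 d2 / (2 * (norm v + norm w + 1))"
    have nn: "norm v + norm w + 1 > 0" by (smt (verit) norm_ge_zero)
    have r: "r > 0" using d1 d2 nn by (simp add: r_def)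
    have near: "dist (x + \<xi> *\<^sub>R p + \<eta> *\<^sub>R q) x < min d1 d2"
      if "\<xi> \<in> {0..r}" "\<eta> \<in> {0..r}" "norm p + norm q = norm v + norm w" for \<xi> \<eta> p q
    proof -
      have "dist (x + \<xi> *\<^sub>R p + \<eta> *\<^sub>R q) x \<le> \<xi> * norm p + \<eta> * norm q"
        using that norm_triangle_ineq[of "\<xi> *\<^sub>R p" "\<eta> *\<^sub>R q"] by (simp add: dist_norm add.assoc)
      also have "\<dots> \<le> r * norm p + r * norm q" using that by (intro add_mono mult_right_mono) auto
      also have "\<dots> = r * (norm v + norm w)" using that by (metis distrib_left)
      also have "\<dots> < r * (2 * (norm v + norm w + 1))" using r nn by (intro mult_strict_left_mono) auto
      also have "\<dots> = min d1 d2" using nn by (simp add: r_def)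
      finally show ?thesis .
    qed
    define b where "b = A x - B x"
    obtain \<xi> \<eta> where 1: "\<xi> \<in> {0..r}" "\<eta> \<in> {0..r}"
      "(f (x + r *\<^sub>R v + r *\<^sub>R w) - f (x + r *\<^sub>R v) - f (x + r *\<^sub>R w) + f x) \<bullet> b = r * (r * (A (x + \<xi> *\<^sub>R v + \<eta> *\<^sub>R w) \<bullet> b))"
      using second_difference_mean_value[OF f r, of x v w b] unfolding A_def by blast
    obtain \<xi>' \<eta>' where 2: "\<xi>' \<in> {0..r}" "\<eta>' \<in> {0..r}"
      "(f (x + r *\<^sub>R w + r *\<^sub>R v) - f (x + r *\<^sub>R w) - f (x + r *\<^sub>R v) + f x) \<bullet> b = r * (r * (B (x + \<xi>' *\<^sub>R w + \<eta>' *\<^sub>R v) \<bullet> b))"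
      using second_difference_mean_value[OF f r, of x w v b] unfolding B_def by blast
    define p where "p = A (x + \<xi> *\<^sub>R v + \<eta> *\<^sub>R w)"
    define q where "q = B (x + \<xi>' *\<^sub>R w + \<eta>' *\<^sub>R v)"
    have "p \<bullet> b = q \<bullet> b" using 1(3) 2(3) r by (simp add: p_def q_def algebra_simps)
    then have "b \<bullet> b = (A x - p) \<bullet> b + (q - B x) \<bullet> b" by (simp add: b_def algebra_simps)
    also have "\<dots> \<le> norm (A x - p) * norm b + norm (q - B x) * norm b"
      by (intro add_mono norm_cauchy_schwarz)
    also have "\<dots> \<le> e / 2 * norm b + e / 2 * norm b"
      using d1(2)[of "x + \<xi> *\<^sub>R v + \<eta> *\<^sub>R w"] d2(2)[of "x + \<xi>' *\<^sub>R w + \<eta>' *\<^sub>R v"] near[OF 1(1,2)] near[OF 2(1,2)]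
      by (intro add_mono mult_right_mono) (auto simp: p_def q_def dist_norm norm_minus_commute add.commute)
    finally have "norm b * norm b \<le> e * norm b" by (simp add: dot_square_norm power2_eq_square)
    then have "norm b \<le> e" using \<open>e > 0\<close> by (cases "b = 0") auto
    then show "norm (A x - B x) \<le> 0 + e" by (simp add: b_def)
  qed
  then show ?thesis by (simp add: A_def B_def)
qed

lemma smooth_Lipschitz_on_compact_convex:
  fixes f :: "'a::euclidean_space \<Rightarrow> 'b::euclidean_space"
  assumes f: "smooth f" and S: "compact S" "convex S"
  obtains L where "L \<ge> 0" "\<And>x y. x \<in> S \<Longrightarrow> y \<in> S \<Longrightarrow> norm (f x - f y) \<le> L * norm (x - y)"
proof -
  have "\<exists>B. \<forall>x\<in>S. norm (frechet_derivative f (at x) b) \<le> B" for b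
    using continuous_on_compact_bound[OF S(1) smooth_continuous[OF smooth_frechet_derivative[OF f, of b]]] by metis
  then obtain B where B: "\<And>b x. x \<in> S \<Longrightarrow> norm (frechet_derivative f (at x) b) \<le> B b" by metis
  define L where "L = (\<Sum>b\<in>Basis. \<bar>B b\<bar>)"
  have on: "onorm (frechet_derivative f (at x)) \<le> L" if "x \<in> S" for x
    unfolding L_def
  proof (rule onorm_componentwise_le)
    show "bounded_linear (frechet_derivative f (at x))"
      using smooth_has_derivative[OF f] by (rule has_derivative_bounded_linear)
    show "(\<Sum>i\<in>Basis. norm (frechet_derivative f (at x) i)) \<le> (\<Sum>b\<in>Basis. \<bar>B b\<bar>)"
      using B[OF that] by (intro sum_mono) (meson abs_ge_self order_trans)
  qed
  have "norm (f x - f y) \<le> L * norm (x - y)" if "x \<in> S" "y \<in> S" for x y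
    by (rule differentiable_bound[OF S(2) _ on that]) (auto intro: has_derivative_at_withinI smooth_has_derivative[OF f])
  moreover have "L \<ge> 0" unfolding L_def by (simp add: sum_nonneg)
  ultimately show ?thesis using that by blast
qed

text \<open>This is what turns the adjoint action, which is homogeneous because one-parameter
  subgroups are linear, into a linear map.\<close>

lemma homogeneous_differentiable_eq_derivative:
  fixes h :: "'a::euclidean_space \<Rightarrow> 'b::euclidean_space"
  assumes hom: "\<And>t y. h (t *\<^sub>R y) = t *\<^sub>R h y" and D: "(h has_derivative D) (at 0)"
  shows "h = D"
proof
  fix y :: 'a
  have "((\<lambda>t::real. t *\<^sub>R y) has_derivative (\<lambda>t. t *\<^sub>R y)) (at 0)" by (auto intro!: derivative_eq_intros)
  moreover have "(h has_derivative D) (at (0 *\<^sub>R y))" using D by simp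
  ultimately have "((\<lambda>t. h (t *\<^sub>R y)) has_derivative (\<lambda>t. D (t *\<^sub>R y))) (at 0)"
    by (rule has_derivative_compose)
  moreover have "((\<lambda>t. h (t *\<^sub>R y)) has_derivative (\<lambda>t. t *\<^sub>R h y)) (at 0)"
    unfolding hom by (auto intro!: derivative_eq_intros)
  ultimately have "(\<lambda>t. D (t *\<^sub>R y)) = (\<lambda>t. t *\<^sub>R h y)" by (rule has_derivative_unique)
  from fun_cong[OF this, of 1] show "h y = D y" by simp
qed

text \<open>A Lie group on a vector space whose exponential map is the identity. The bracket enters
  through the adjoint action, whose derivative it is.\<close>

locale exponential_group = group G for G :: "'a::euclidean_space monoid" (structure) +
  assumes carrier_UNIV: "carrier G = UNIV"
    and smooth_multiplication: "smooth (\<lambda>p. fst p \<otimes> snd p)"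
    and rays_one_parameter: "\<And>X. one_parameter_subgroup G (\<lambda>t. t *\<^sub>R X)"
begin

lemma in_carrier [simp]: "x \<in> carrier G" by (simp add: carrier_UNIV)

lemma mult_assoc: "(x \<otimes> y) \<otimes> z = x \<otimes> (y \<otimes> z)" by (rule m_assoc) auto

lemma scaleR_mult_scaleR: "(a *\<^sub>R x) \<otimes> (b *\<^sub>R x) = (a + b) *\<^sub>R x"
  using rays_one_parameter[of x] by (simp add: one_parameter_subgroup_def)

lemma one_eq_0: "\<one> = 0"
proof -
  have "0 \<otimes> 0 = 0" using scaleR_mult_scaleR[of 0 0 0] by simp
  then show ?thesis using l_cancel_one[of 0 0] by simp
qed

lemma mult_0 [simp]: "x \<otimes> 0 = x" "0 \<otimes> x = x"
  using r_one[of x] l_one[of x] by (simp_all add: one_eq_0)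

lemma mult_minus [simp]: "x \<otimes> (- x) = 0" "(- x) \<otimes> x = 0"
  using scaleR_mult_scaleR[of 1 x "-1"] scaleR_mult_scaleR[of "-1" x 1] by simp_all

lemma mult_minus_cancel [simp]: "x \<otimes> (- x \<otimes> y) = y" "- x \<otimes> (x \<otimes> y) = y"
  by (simp_all add: mult_assoc[symmetric])

lemma mult_left_cancel [simp]: "x \<otimes> y = x \<otimes> z \<longleftrightarrow> y = z"
proof
  assume "x \<otimes> y = x \<otimes> z"
  then have "- x \<otimes> (x \<otimes> y) = - x \<otimes> (x \<otimes> z)" by (rule arg_cong)
  then show "y = z" by simp
qed simp

lemma minus_mult: "- (x \<otimes> y) = - y \<otimes> - x"
proof -
  have "(x \<otimes> y) \<otimes> (- y \<otimes> - x) = (x \<otimes> y) \<otimes> - (x \<otimes> y)"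
    unfolding mult_minus(1) by (simp add: mult_assoc)
  then show ?thesis unfolding mult_left_cancel by (rule sym)
qed

text \<open>Powers are multiples, so the claim holds for rational \<open>t\<close>, and then for all \<open>t\<close> by
  continuity. Below, products are computed by exhibiting a one-parameter subgroup and
  differentiating it at \<open>0\<close>.\<close>

lemma continuous_hom_linear:
  fixes \<phi> :: "real \<Rightarrow> 'a"
  assumes hom: "\<And>a b. \<phi> (a + b) = \<phi> a \<otimes> \<phi> b" and cont: "continuous_on UNIV \<phi>"
  shows "\<phi> t = t *\<^sub>R \<phi> 1"
proof -
  have \<phi>0: "\<phi> 0 = 0" 
  proof -
    have "\<phi> 0 \<otimes> \<phi> 0 = \<phi> 0 \<otimes> 0" using hom[of 0 0] by simp
    then show ?thesis unfolding mult_left_cancel .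
  qed
  have nat: "\<phi> (real n * r) = real n *\<^sub>R \<phi> r" for n r
  proof (induction n)
    case (Suc n)
    have "\<phi> (real (Suc n) * r) = \<phi> (real n * r) \<otimes> \<phi> r" using hom[of "real n * r" r] by (simp add: algebra_simps)
    also have "\<dots> = real (Suc n) *\<^sub>R \<phi> r" using Suc scaleR_mult_scaleR[of "real n" "\<phi> r" 1] by (simp add: add.commute)
    finally show ?case .
  qed (simp add: \<phi>0)
  have neg: "\<phi> (- r) = - \<phi> r" for r
  proof -
    have "\<phi> r \<otimes> \<phi> (- r) = \<phi> r \<otimes> - \<phi> r" using hom[of r "- r"] \<phi>0 by simp
    then show ?thesis unfolding mult_left_cancel .
  qed
  have int: "\<phi> (of_int n * r) = of_int n *\<^sub>R \<phi> r" for n r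
  proof (cases "n \<ge> 0")
    case True then show ?thesis using nat[of "nat n" r] by simp
  next
    case False
    then have "\<phi> (- (of_int n * r)) = - (of_int n *\<^sub>R \<phi> r)" using nat[of "nat (- n)" r] by simp
    then show ?thesis unfolding neg by simp
  qed
  have rat: "\<phi> q = q *\<^sub>R \<phi> 1" if "q \<in> \<rat>" for q
  proof -
    obtain m n where q: "q = of_int m / of_int n" "n > 0"
      using \<open>q \<in> \<rat>\<close> by (rule Rats_cases')
    have nq: "of_int n * q = of_int m * 1" using q by simp
    have "of_int n *\<^sub>R \<phi> q = \<phi> (of_int m * 1)" using int[of n q] unfolding nq by (rule sym)
    also have "\<dots> = of_int m *\<^sub>R \<phi> 1" by (rule int)
    finally have "(1 / of_int n :: real) *\<^sub>R of_int n *\<^sub>R \<phi> q = (1 / of_int n :: real) *\<^sub>R of_int m *\<^sub>R \<phi> 1" by simp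
    then show ?thesis using q(2) unfolding q(1) by simp
  qed
  have "continuous_on UNIV (\<lambda>t. t *\<^sub>R \<phi> 1)" by (intro continuous_intros)
  then have "closed {t. \<phi> t = t *\<^sub>R \<phi> 1}"
    by (rule closed_Collect_eq[OF cont])
  moreover have "\<rat> \<subseteq> {t. \<phi> t = t *\<^sub>R \<phi> 1}" using rat by blast
  ultimately have "closure \<rat> \<subseteq> {t. \<phi> t = t *\<^sub>R \<phi> 1}"
    by (intro closure_minimal)
  then show ?thesis unfolding Rats_closure_real by blast
qed

end

section \<open>Translations, adjoint action and bracket\<close>

context exponential_group begin

definition mult_deriv :: "'a \<Rightarrow> 'a \<Rightarrow> 'a \<times> 'a \<Rightarrow> 'a" where
  "mult_deriv x y = frechet_derivative (\<lambda>p. fst p \<otimes> snd p) (at (x, y))"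

lemma mult_deriv: "((\<lambda>p. fst p \<otimes> snd p) has_derivative mult_deriv x y) (at (x, y))"
  unfolding mult_deriv_def by (rule smooth_has_derivative[OF smooth_multiplication])

lemma linear_mult_deriv: "linear (mult_deriv x y)"
  using mult_deriv has_derivative_linear by blast

lemma has_derivative_mult:
  assumes "(f has_derivative f') (at t within S)" "(g has_derivative g') (at t within S)"
  shows "((\<lambda>t. f t \<otimes> g t) has_derivative (\<lambda>h. mult_deriv (f t) (g t) (f' h, g' h))) (at t within S)"
  using has_derivative_compose[OF has_derivative_Pair[OF assms] mult_deriv[of "f t" "g t"]] by simp

lemma has_vector_derivative_mult:
  assumes "(f has_vector_derivative f') (at t within S)" "(g has_vector_derivative g') (at t within S)"
  shows "((\<lambda>t. f t \<otimes> g t) has_vector_derivative mult_deriv (f t) (g t) (f', g')) (at t within S)"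
proof -
  have "mult_deriv (f t) (g t) (h *\<^sub>R f', h *\<^sub>R g') = h *\<^sub>R mult_deriv (f t) (g t) (f', g')" for h
    using linear_cmul[OF linear_mult_deriv, of "f t" "g t" h "(f', g')"] by (simp add: scaleR_Pair)
  with has_derivative_mult[OF assms[unfolded has_vector_derivative_def]] show ?thesis
    by (simp add: has_vector_derivative_def)
qed

lemma continuous_on_mult:
  assumes "continuous_on S f" "continuous_on S g"
  shows "continuous_on S (\<lambda>t. f t \<otimes> g t)"
  using continuous_on_compose2[OF smooth_continuous[OF smooth_multiplication, of UNIV] continuous_on_Pair[OF assms]] by simp

lemma left_diff_eq: "left_diff G x Y = mult_deriv x 0 (0, Y)"
proof -
  have "((\<lambda>y. x \<otimes> y) has_derivative (\<lambda>h. mult_deriv x 0 (0, h))) (at 0)"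
    using has_derivative_mult[OF has_derivative_const[of x] has_derivative_ident, of 0 UNIV] by simp
  then show ?thesis unfolding left_diff_def one_eq_0 by (metis frechet_derivative_at)
qed

lemma has_derivative_left_mult: "((\<lambda>y. x \<otimes> y) has_derivative left_diff G x) (at 0)"
  using has_derivative_mult[OF has_derivative_const[of x] has_derivative_ident, of 0 UNIV]
  by (simp add: left_diff_eq[abs_def])

lemma linear_left_diff: "linear (left_diff G x)"
  using has_derivative_left_mult has_derivative_linear by blast

definition right_diff :: "'a \<Rightarrow> 'a \<Rightarrow> 'a" where
  "right_diff x Y = mult_deriv 0 x (Y, 0)"

lemma has_derivative_right_mult: "((\<lambda>y. y \<otimes> x) has_derivative right_diff x) (at 0)"
  using has_derivative_mult[OF has_derivative_ident has_derivative_const[of x], of 0 UNIV]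
  by (simp add: right_diff_def[abs_def])

lemma linear_right_diff: "linear (right_diff x)"
  using has_derivative_right_mult has_derivative_linear by blast

lemma left_diff_0: "left_diff G 0 Y = Y"
proof -
  have "((\<lambda>y. y) has_derivative left_diff G 0) (at 0)" using has_derivative_left_mult[of 0] by simp
  from has_derivative_unique[OF this has_derivative_ident] show ?thesis by simp
qed

lemma right_diff_0: "right_diff 0 Y = Y"
proof -
  have "((\<lambda>y. y) has_derivative right_diff 0) (at 0)" using has_derivative_right_mult[of 0] by simp
  from has_derivative_unique[OF this has_derivative_ident] show ?thesis by simp
qed

lemma mult_deriv_0: "mult_deriv 0 0 (X, Y) = X + Y"
  using linear_add[OF linear_mult_deriv, of 0 0 "(X, 0)" "(0, Y)"] left_diff_eq[of 0 Y] right_diff_def[of 0 X]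
  by (simp add: left_diff_0 right_diff_0)

lemma ray_has_vector_derivative: "((\<lambda>t. t *\<^sub>R Y) has_vector_derivative Y) (at t within S)"
  unfolding has_vector_derivative_def by (intro bounded_linear_imp_has_derivative bounded_linear_scaleR_left)

lemma left_translate_ray: "((\<lambda>t. x \<otimes> (t *\<^sub>R Y)) has_vector_derivative left_diff G x Y) (at 0)"
  using has_vector_derivative_mult[OF has_vector_derivative_const[of x] ray_has_vector_derivative[of Y], of 0 UNIV]
  by (simp add: left_diff_eq)

lemma right_translate_ray: "((\<lambda>t. (t *\<^sub>R Y) \<otimes> x) has_vector_derivative right_diff x Y) (at 0)"
  using has_vector_derivative_mult[OF ray_has_vector_derivative[of Y] has_vector_derivative_const[of x], of 0 UNIV]
  by (simp add: right_diff_def)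

definition Ad :: "'a \<Rightarrow> 'a \<Rightarrow> 'a" where "Ad x Y = x \<otimes> Y \<otimes> - x"

lemma has_derivative_Ad_point:
  "\<exists>D. ((\<lambda>x. Ad x Y) has_derivative D) (at x)"
  unfolding Ad_def
  by (rule exI, rule has_derivative_mult[OF has_derivative_mult[OF has_derivative_ident has_derivative_const]
        has_derivative_minus[OF has_derivative_ident]])

lemma continuous_on_Ad:
  assumes "continuous_on S f" "continuous_on S g"
  shows "continuous_on S (\<lambda>t. Ad (f t) (g t))"
  unfolding Ad_def by (intro continuous_on_mult assms continuous_on_minus)

lemma Ad_mult: "Ad (x \<otimes> y) Y = Ad x (Ad y Y)"
  by (simp add: Ad_def minus_mult mult_assoc)

lemma Ad_hom: "Ad x (Y \<otimes> Z) = Ad x Y \<otimes> Ad x Z"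
  by (simp add: Ad_def mult_assoc)

lemma Ad_0 [simp]: "Ad 0 Y = Y" by (simp add: Ad_def)

lemma Ad_minus_cancel [simp]: "Ad (- x) (Ad x Y) = Y" "Ad x (Ad (- x) Y) = Y"
  by (simp_all add: Ad_mult[symmetric])

lemma Ad_mult_right: "Ad x Y \<otimes> x = x \<otimes> Y" by (simp add: Ad_def mult_assoc)

lemma mult_Ad_minus: "x \<otimes> Ad (- x) Y = Y \<otimes> x" by (simp add: Ad_def mult_assoc)

text \<open>The curve \<open>\<lambda>t. Ad x (t *\<^sub>R Y)\<close> is a continuous one-parameter subgroup, hence linear in
  \<open>t\<close>.\<close>

lemma Ad_scaleR: "Ad x (t *\<^sub>R Y) = t *\<^sub>R Ad x Y"
proof -
  have "continuous_on UNIV (\<lambda>t. Ad x (t *\<^sub>R Y))"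
    by (intro continuous_on_Ad continuous_intros)
  from continuous_hom_linear[OF _ this, of t] show ?thesis
    by (simp add: Ad_hom[symmetric] scaleR_mult_scaleR)
qed

lemma linear_Ad: "linear (Ad x)"
proof -
  have "\<exists>D. (Ad x has_derivative D) (at 0)"
    unfolding Ad_def[abs_def]
    by (rule exI, rule has_derivative_mult[OF has_derivative_mult[OF has_derivative_const has_derivative_ident]
          has_derivative_const])
  then obtain D where D: "(Ad x has_derivative D) (at 0)" by blast
  with homogeneous_differentiable_eq_derivative[of "Ad x"] have "Ad x = D" by (simp add: Ad_scaleR)
  with D show ?thesis using has_derivative_linear by blast
qed

text \<open>A perturbation of the left factor \<open>x\<close> by \<open>t *\<^sub>R a\<close> can be moved past \<open>y\<close> at the price of
  applying \<open>Ad (- y)\<close>.\<close>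

lemma mult_deriv_left_diff:
  "mult_deriv x y (left_diff G x a, left_diff G y b) = left_diff G (x \<otimes> y) (Ad (- y) a + b)"
proof -
  have "((\<lambda>t. (x \<otimes> (t *\<^sub>R a)) \<otimes> y) has_vector_derivative mult_deriv x y (left_diff G x a, 0)) (at 0)"
    using has_vector_derivative_mult[OF left_translate_ray has_vector_derivative_const] by simp
  moreover have "(x \<otimes> (t *\<^sub>R a)) \<otimes> y = (x \<otimes> y) \<otimes> (t *\<^sub>R Ad (- y) a)" for t
    by (simp add: Ad_scaleR[symmetric] mult_assoc mult_Ad_minus)
  ultimately have "((\<lambda>t. (x \<otimes> y) \<otimes> (t *\<^sub>R Ad (- y) a)) has_vector_derivative mult_deriv x y (left_diff G x a, 0)) (at 0)"
    by simp
  then have "mult_deriv x y (left_diff G x a, 0) = left_diff G (x \<otimes> y) (Ad (- y) a)"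
    using left_translate_ray by (rule vector_derivative_unique_at)
  moreover have "mult_deriv x y (0, left_diff G y b) = left_diff G (x \<otimes> y) b"
  proof -
    have "((\<lambda>t. x \<otimes> (y \<otimes> (t *\<^sub>R b))) has_vector_derivative mult_deriv x y (0, left_diff G y b)) (at 0)"
      using has_vector_derivative_mult[OF has_vector_derivative_const left_translate_ray] by simp
    then have "((\<lambda>t. (x \<otimes> y) \<otimes> (t *\<^sub>R b)) has_vector_derivative mult_deriv x y (0, left_diff G y b)) (at 0)"
      by (simp only: mult_assoc)
    then show ?thesis using left_translate_ray by (rule vector_derivative_unique_at)
  qed
  moreover have "mult_deriv x y (left_diff G x a, left_diff G y b)
      = mult_deriv x y (left_diff G x a, 0) + mult_deriv x y (0, left_diff G y b)"
    using linear_add[OF linear_mult_deriv, of x y "(left_diff G x a, 0)" "(0, left_diff G y b)"] by simp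
  ultimately show ?thesis using linear_add[OF linear_left_diff] by simp
qed

lemma left_invariant_derivative_mult:
  assumes "(f has_vector_derivative left_diff G (f t) a) (at t within S)"
    and "(g has_vector_derivative left_diff G (g t) b) (at t within S)"
  shows "((\<lambda>t. f t \<otimes> g t) has_vector_derivative left_diff G (f t \<otimes> g t) (Ad (- g t) a + b)) (at t within S)"
  using has_vector_derivative_mult[OF assms] by (simp add: mult_deriv_left_diff)

lemma minus_left_diff: "- left_diff G x b = left_diff G (- x) (- Ad x b)"
proof -
  have "((\<lambda>t. - (x \<otimes> (t *\<^sub>R b))) has_vector_derivative - left_diff G x b) (at 0)"
    by (intro has_vector_derivative_minus left_translate_ray)
  moreover have "- (x \<otimes> (t *\<^sub>R b)) = - x \<otimes> (t *\<^sub>R (- Ad x b))" for t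
  proof -
    have "- (x \<otimes> (t *\<^sub>R b)) = - (Ad x (t *\<^sub>R b) \<otimes> x)" by (simp only: Ad_mult_right)
    then show ?thesis by (simp add: minus_mult Ad_scaleR)
  qed
  ultimately have "((\<lambda>t. - x \<otimes> (t *\<^sub>R (- Ad x b))) has_vector_derivative - left_diff G x b) (at 0)" by simp
  then show ?thesis using left_translate_ray by (rule vector_derivative_unique_at)
qed

lemma left_invariant_derivative_minus:
  assumes "(f has_vector_derivative left_diff G (f t) a) (at t within S)"
  shows "((\<lambda>t. - f t) has_vector_derivative left_diff G (- f t) (- Ad (f t) a)) (at t within S)"
  using has_vector_derivative_minus[OF assms] by (simp add: minus_left_diff)

lemma right_diff_Ad: "right_diff x (Ad x Y) = left_diff G x Y"
proof -
  have "((\<lambda>t. (t *\<^sub>R Ad x Y) \<otimes> x) has_vector_derivative right_diff x (Ad x Y)) (at 0)"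
    by (rule right_translate_ray)
  moreover have "(t *\<^sub>R Ad x Y) \<otimes> x = x \<otimes> (t *\<^sub>R Y)" for t
    by (simp add: Ad_scaleR[symmetric] Ad_mult_right)
  ultimately have "((\<lambda>t. x \<otimes> (t *\<^sub>R Y)) has_vector_derivative right_diff x (Ad x Y)) (at 0)" by simp
  then show ?thesis using left_translate_ray by (rule vector_derivative_unique_at)
qed

lemma right_diff_eq_0_iff: "right_diff x Y = 0 \<longleftrightarrow> Y = 0"
proof
  assume "right_diff x Y = 0"
  with right_translate_ray[of Y x] have "((\<lambda>t. (t *\<^sub>R Y) \<otimes> x) has_vector_derivative 0) (at 0)" by simp
  from has_vector_derivative_mult[OF this has_vector_derivative_const[of "- x"]]
  have "((\<lambda>t. t *\<^sub>R Y) has_vector_derivative 0) (at 0)"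
    using linear_0[OF linear_mult_deriv, of x "- x"] by (simp add: mult_assoc zero_prod_def)
  moreover have "((\<lambda>t. t *\<^sub>R Y) has_vector_derivative Y) (at 0)" by (rule ray_has_vector_derivative)
  ultimately show "Y = 0" using vector_derivative_unique_at by blast
qed (simp add: linear_0[OF linear_right_diff])

lemma bij_right_diff: "bij (right_diff x)"
proof -
  have "inj (right_diff x)"
    using linear_injective_0[OF linear_right_diff, of x] right_diff_eq_0_iff by auto
  then show ?thesis
    using linear_injective_imp_surjective[OF linear_right_diff] by (simp add: bij_def)
qed


lemma lie_bracket_eq:
  "lie_bracket G X Y = frechet_derivative (\<lambda>x. left_diff G x Y) (at 0) X - frechet_derivative (\<lambda>x. left_diff G x X) (at 0) Y"
  by (simp add: lie_bracket_def one_eq_0)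

lemma lie_bracket_skew: "lie_bracket G X Y = - lie_bracket G Y X"
  by (simp add: lie_bracket_def)

text \<open>The bracket is defined through the derivatives of left translations. Comparing them with
  right translations by means of \<open>right_diff x (Ad x Y) = left_diff G x Y\<close>, and using that the
  mixed second derivatives of the multiplication commute, identifies it with the derivative of
  the adjoint action at the identity.\<close>

lemma Ad_has_derivative_bracket_0:
  assumes D: "((\<lambda>x. Ad x Y) has_derivative D) (at 0)"
  shows "D X = lie_bracket G X Y"
proof -
  define m where "m = (\<lambda>p. fst p \<otimes> snd p :: 'a)"
  have m: "smooth m" unfolding m_def by (rule smooth_multiplication)
  define H where "H = (\<lambda>v w. frechet_derivative (\<lambda>p. frechet_derivative m (at p) v) (at (0, 0)) w)"
  have md: "mult_deriv x y v = frechet_derivative m (at (x, y)) v" for x y v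
    by (simp add: mult_deriv_def m_def)
  have H: "((\<lambda>p. frechet_derivative m (at p) v) has_derivative H v) (at (0, 0))" for v
    unfolding H_def by (rule smooth_has_derivative[OF smooth_frechet_derivative[OF m]])
  have left: "((\<lambda>x. left_diff G x Z) has_derivative (\<lambda>h. H (0, Z) (h, 0))) (at 0)" for Z
  proof -
    have "((\<lambda>x. (x, 0)) has_derivative (\<lambda>h. (h, 0))) (at (0::'a))"
      by (intro has_derivative_Pair has_derivative_const has_derivative_ident)
    from has_derivative_compose[OF this H[of "(0, Z)"]] show ?thesis by (simp add: left_diff_eq md)
  qed
  have right: "((\<lambda>x. right_diff x Z) has_derivative (\<lambda>h. H (Z, 0) (0, h))) (at 0)" for Z
  proof -
    have "((\<lambda>x. (0, x)) has_derivative (\<lambda>h. (0, h))) (at (0::'a))"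
      by (intro has_derivative_Pair has_derivative_const has_derivative_ident)
    from has_derivative_compose[OF this H[of "(Z, 0)"]] show ?thesis by (simp add: right_diff_def md)
  qed
  have br: "lie_bracket G X Y = H (0, Y) (X, 0) - H (0, X) (Y, 0)"
    unfolding lie_bracket_eq frechet_derivative_at[OF left[of Y], symmetric] frechet_derivative_at[OF left[of X], symmetric] by (rule refl)
  \<comment> \<open>Differentiate \<open>right_diff x (Ad x Y) = left_diff x Y\<close> along the ray \<open>t X\<close> at \<open>t = 0\<close>.\<close>
  have ray: "((\<lambda>t. t *\<^sub>R X) has_derivative (\<lambda>h. h *\<^sub>R X)) (at (0::real))"
    using ray_has_vector_derivative[of X 0 UNIV] by (simp add: has_vector_derivative_def)
  define A where "A = (\<lambda>t. Ad (t *\<^sub>R X) Y)"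
  have "((\<lambda>x. Ad x Y) has_derivative D) (at (0 *\<^sub>R X))" using D by simp
  from has_derivative_compose[OF ray this] have A: "(A has_derivative (\<lambda>h. D (h *\<^sub>R X))) (at 0)" unfolding A_def .
  have lin: "frechet_derivative m (at (0, x)) (v, 0) = (\<Sum>b\<in>Basis. (v \<bullet> b) *\<^sub>R right_diff x b)" for x v
  proof -
    have "right_diff x v = right_diff x (\<Sum>b\<in>Basis. (v \<bullet> b) *\<^sub>R b)" by (simp add: euclidean_representation)
    also have "\<dots> = (\<Sum>b\<in>Basis. (v \<bullet> b) *\<^sub>R right_diff x b)"
      by (simp add: linear_sum[OF linear_right_diff] linear_cmul[OF linear_right_diff])
    finally show ?thesis by (simp add: right_diff_def md)
  qed
  have rd: "((\<lambda>t. right_diff (t *\<^sub>R X) b) has_vector_derivative H (b, 0) (0, X)) (at 0)" for b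
  proof -
    have "((\<lambda>x. right_diff x b) has_derivative (\<lambda>h. H (b, 0) (0, h))) (at (0 *\<^sub>R X))" using right[of b] by simp
    from has_derivative_compose[OF ray this]
    have "((\<lambda>t. right_diff (t *\<^sub>R X) b) has_derivative (\<lambda>h. H (b, 0) (0, h *\<^sub>R X))) (at 0)" .
    moreover have "H (b, 0) (0, h *\<^sub>R X) = h *\<^sub>R H (b, 0) (0, X)" for h
      using linear_cmul[OF has_derivative_linear[OF H], of "(b, 0)" h "(0, X)"] by (simp add: scaleR_Pair)
    ultimately show ?thesis by (simp add: has_vector_derivative_def)
  qed
  have linD: "linear D" using D by (rule has_derivative_linear)
  have A': "(A has_vector_derivative D X) (at 0)"
    using A linear_cmul[OF linD] by (simp add: has_vector_derivative_def)
  have "((\<lambda>t. \<Sum>b\<in>Basis. (A t \<bullet> b) *\<^sub>R right_diff (t *\<^sub>R X) b) has_vector_derivative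
      (\<Sum>b\<in>Basis. (A 0 \<bullet> b) *\<^sub>R H (b, 0) (0, X) + (D X \<bullet> b) *\<^sub>R right_diff (0 *\<^sub>R X) b)) (at 0)"
  proof (rule has_vector_derivative_sum)
    fix b :: 'a
    have "((\<lambda>t. A t \<bullet> b) has_real_derivative D X \<bullet> b) (at 0)"
      unfolding has_real_derivative_iff_has_vector_derivative
      by (rule bounded_linear.has_vector_derivative[OF bounded_linear_inner_left A'])
    from has_vector_derivative_scaleR[OF this rd[of b]]
    show "((\<lambda>t. (A t \<bullet> b) *\<^sub>R right_diff (t *\<^sub>R X) b) has_vector_derivative
        (A 0 \<bullet> b) *\<^sub>R H (b, 0) (0, X) + (D X \<bullet> b) *\<^sub>R right_diff (0 *\<^sub>R X) b) (at 0)" .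
  qed
  moreover have "(\<Sum>b\<in>Basis. (A t \<bullet> b) *\<^sub>R right_diff (t *\<^sub>R X) b) = left_diff G (t *\<^sub>R X) Y" for t
    using lin[of "t *\<^sub>R X" "A t"] right_diff_Ad[of "t *\<^sub>R X" Y] by (simp add: A_def right_diff_def md)
  moreover have "(\<Sum>b\<in>Basis. (A 0 \<bullet> b) *\<^sub>R H (b, 0) (0, X) + (D X \<bullet> b) *\<^sub>R right_diff (0 *\<^sub>R X) b)
      = H (Y, 0) (0, X) + D X"
  proof -
    have linH: "linear (\<lambda>b. H (b, 0) (0, X))"
    proof (rule linearI)
      have lm: "linear (frechet_derivative m (at p))" for p
        by (rule linear_frechet_derivative[OF smooth_differentiable[OF m]])
      show "H (b1 + b2, 0) (0, X) = H (b1, 0) (0, X) + H (b2, 0) (0, X)" for b1 b2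
      proof -
        have eq: "frechet_derivative m (at p) (b1 + b2, 0) = frechet_derivative m (at p) (b1, 0) + frechet_derivative m (at p) (b2, 0)" for p
          using linear_add[OF lm[of p], of "(b1, 0)" "(b2, 0)"] by simp
        show ?thesis
          using has_derivative_unique[OF H[of "(b1 + b2, 0)", unfolded eq] has_derivative_add[OF H H]] by (rule fun_cong)
      qed
      show "H (r *\<^sub>R b, 0) (0, X) = r *\<^sub>R H (b, 0) (0, X)" for r b
      proof -
        have eq: "frechet_derivative m (at p) (r *\<^sub>R b, 0) = r *\<^sub>R frechet_derivative m (at p) (b, 0)" for p
          using linear_cmul[OF lm[of p], of r "(b, 0)"] by (simp add: scaleR_Pair)
        show ?thesis
          using has_derivative_unique[OF H[of "(r *\<^sub>R b, 0)", unfolded eq] has_derivative_scaleR_right[OF H]] by (rule fun_cong)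
      qed
    qed
    have "H (Y, 0) (0, X) = H (\<Sum>b\<in>Basis. (Y \<bullet> b) *\<^sub>R b, 0) (0, X)" by (simp add: euclidean_representation)
    also have "\<dots> = (\<Sum>b\<in>Basis. (Y \<bullet> b) *\<^sub>R H (b, 0) (0, X))"
      using linear_sum[OF linH, of "\<lambda>b. (Y \<bullet> b) *\<^sub>R b" Basis] linear_cmul[OF linH] by simp
    finally show ?thesis by (simp add: A_def sum.distrib right_diff_0 euclidean_representation)
  qed
  ultimately have "((\<lambda>t. left_diff G (t *\<^sub>R X) Y) has_vector_derivative H (Y, 0) (0, X) + D X) (at 0)" by simp
  moreover have "((\<lambda>t. left_diff G (t *\<^sub>R X) Y) has_vector_derivative H (0, Y) (X, 0)) (at 0)"
  proof -
    have "((\<lambda>x. left_diff G x Y) has_derivative (\<lambda>h. H (0, Y) (h, 0))) (at (0 *\<^sub>R X))" using left[of Y] by simp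
    from has_derivative_compose[OF ray this]
    have "((\<lambda>t. left_diff G (t *\<^sub>R X) Y) has_derivative (\<lambda>h. H (0, Y) (h *\<^sub>R X, 0))) (at 0)" .
    moreover have "H (0, Y) (h *\<^sub>R X, 0) = h *\<^sub>R H (0, Y) (X, 0)" for h
      using linear_cmul[OF has_derivative_linear[OF H], of "(0, Y)" h "(X, 0)"] by (simp add: scaleR_Pair)
    ultimately show ?thesis by (simp add: has_vector_derivative_def)
  qed
  ultimately have "H (Y, 0) (0, X) + D X = H (0, Y) (X, 0)" by (rule vector_derivative_unique_at)
  moreover have "H (Y, 0) (0, X) = H (0, X) (Y, 0)"
    unfolding H_def by (rule smooth_mixed_derivatives_commute[OF m])
  ultimately have "D X + H (0, X) (Y, 0) = lie_bracket G X Y + H (0, X) (Y, 0)"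
    using br by (simp add: add.commute)
  then show ?thesis by (rule add_right_imp_eq)
qed

lemma Ad_has_derivative_0: "((\<lambda>x. Ad x Y) has_derivative (\<lambda>X. lie_bracket G X Y)) (at 0)"
proof -
  obtain D where D: "((\<lambda>x. Ad x Y) has_derivative D) (at 0)" using has_derivative_Ad_point by blast
  have "D = (\<lambda>X. lie_bracket G X Y)" using Ad_has_derivative_bracket_0[OF D] by blast
  with D show ?thesis by simp
qed

lemma linear_bracket_left: "linear (\<lambda>X. lie_bracket G X Y)"
  using Ad_has_derivative_0 by (rule has_derivative_linear)

lemma linear_bracket_right: "linear (lie_bracket G X)"
proof -
  have "linear (\<lambda>Y. - lie_bracket G Y X)"
    using linear_compose_neg[OF linear_bracket_left] .
  then show ?thesis by (subst lie_bracket_skew[abs_def])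
qed

lemma linear_bracket_funpow: "linear (lie_bracket G x ^^ n)"
proof (induction n)
  case 0 show ?case by (simp add: linear_iff)
next
  case (Suc n) show ?case unfolding funpow.simps by (rule linear_compose[OF Suc linear_bracket_right])
qed

lemma bounded_bilinear_bracket: "bounded_bilinear (lie_bracket G)"
  by (rule bilinear_conv_bounded_bilinear[THEN iffD1])
    (simp add: bilinear_def linear_bracket_left linear_bracket_right)

lemma bracket_self: "lie_bracket G X X = 0" by (simp add: lie_bracket_def)

text \<open>Since \<open>Ad (x \<otimes> z) = Ad x \<circ> Ad z\<close>, the derivative at any point reduces to the one at the
  identity.\<close>

lemma left_invariant_derivative_Ad:
  assumes "(f has_vector_derivative left_diff G (f t) X) (at t within S)"
  shows "((\<lambda>t. Ad (f t) Y) has_vector_derivative Ad (f t) (lie_bracket G X Y)) (at t within S)"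
proof -
  obtain D where D: "((\<lambda>x. Ad x Y) has_derivative D) (at (f t))" using has_derivative_Ad_point by blast
  have "D (left_diff G (f t) X) = Ad (f t) (lie_bracket G X Y)"
  proof -
    have "((\<lambda>s. f t \<otimes> (s *\<^sub>R X)) has_derivative (\<lambda>h. h *\<^sub>R left_diff G (f t) X)) (at 0)"
      using left_translate_ray by (simp add: has_vector_derivative_def)
    from has_derivative_compose[OF this, of "\<lambda>x. Ad x Y" D] D
    have "((\<lambda>s. Ad (f t \<otimes> (s *\<^sub>R X)) Y) has_derivative (\<lambda>h. D (h *\<^sub>R left_diff G (f t) X))) (at 0)" by simp
    then have 1: "((\<lambda>s. Ad (f t \<otimes> (s *\<^sub>R X)) Y) has_vector_derivative D (left_diff G (f t) X)) (at 0)"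
      using linear_cmul[OF has_derivative_linear[OF D]] by (simp add: has_vector_derivative_def)
    have ray: "((\<lambda>s. s *\<^sub>R X) has_derivative (\<lambda>h. h *\<^sub>R X)) (at (0::real))"
      using ray_has_vector_derivative[of X 0 UNIV] by (simp add: has_vector_derivative_def)
    have "((\<lambda>s. Ad (s *\<^sub>R X) Y) has_derivative (\<lambda>h. lie_bracket G (h *\<^sub>R X) Y)) (at 0)"
      using has_derivative_compose[OF ray, of "\<lambda>x. Ad x Y" "\<lambda>X. lie_bracket G X Y"] Ad_has_derivative_0 by simp
    then have "((\<lambda>s. Ad (s *\<^sub>R X) Y) has_vector_derivative lie_bracket G X Y) (at 0)"
      using linear_cmul[OF linear_bracket_left] by (simp add: has_vector_derivative_def)
    then have "((\<lambda>s. Ad (f t) (Ad (s *\<^sub>R X) Y)) has_vector_derivative Ad (f t) (lie_bracket G X Y)) (at 0)"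
      by (rule bounded_linear.has_vector_derivative[OF linear_conv_bounded_linear[THEN iffD1, OF linear_Ad]])
    then have 2: "((\<lambda>s. Ad (f t \<otimes> (s *\<^sub>R X)) Y) has_vector_derivative Ad (f t) (lie_bracket G X Y)) (at 0)"
      by (simp only: Ad_mult)
    show ?thesis using 1 2 by (rule vector_derivative_unique_at)
  qed
  moreover have "D (h *\<^sub>R left_diff G (f t) X) = h *\<^sub>R D (left_diff G (f t) X)" for h
    by (rule linear_cmul[OF has_derivative_linear[OF D]])
  ultimately show ?thesis
    using has_derivative_compose[OF assms[unfolded has_vector_derivative_def] D] by (simp add: has_vector_derivative_def)
qed

lemma left_diff_ray: "left_diff G (t *\<^sub>R X) X = X"
proof -
  have "((\<lambda>s. (t *\<^sub>R X) \<otimes> (s *\<^sub>R X)) has_vector_derivative left_diff G (t *\<^sub>R X) X) (at 0)"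
    by (rule left_translate_ray)
  moreover have "((\<lambda>s. (t *\<^sub>R X) \<otimes> (s *\<^sub>R X)) has_vector_derivative X) (at 0)"
    unfolding scaleR_mult_scaleR scaleR_left.add
    using has_vector_derivative_add[OF has_vector_derivative_const ray_has_vector_derivative] by fastforce
  ultimately show ?thesis by (rule vector_derivative_unique_at)
qed

lemma scaled_ray_left_invariant:
  fixes y :: "real \<Rightarrow> real"
  assumes "(y has_vector_derivative y') (at t within S)"
  shows "((\<lambda>t. y t *\<^sub>R X) has_vector_derivative left_diff G (y t *\<^sub>R X) (y' *\<^sub>R X)) (at t within S)"
proof -
  have "left_diff G (y t *\<^sub>R X) (y' *\<^sub>R X) = y' *\<^sub>R X"
    using linear_cmul[OF linear_left_diff] left_diff_ray by simp
  then show ?thesis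
    using bounded_linear.has_vector_derivative[OF bounded_linear_scaleR_left assms] by simp
qed

lemma ray_left_invariant: "((\<lambda>t. t *\<^sub>R X) has_vector_derivative left_diff G (t *\<^sub>R X) X) (at t within S)"
  using ray_has_vector_derivative by (simp add: left_diff_ray)

lemma has_vector_derivative_Ad_ray:
  "((\<lambda>t. Ad (t *\<^sub>R X) Y) has_vector_derivative Ad (t *\<^sub>R X) (lie_bracket G X Y)) (at t within S)"
  by (rule left_invariant_derivative_Ad[OF ray_left_invariant])

end

section \<open>Curves with prescribed velocity\<close>

lemma absolutely_integrable_continuous_bilinear:
  fixes f :: "real \<Rightarrow> 'a::euclidean_space" and g :: "real \<Rightarrow> 'b::euclidean_space"
  assumes h: "bounded_bilinear h" and f: "continuous_on {a..b} f" and g: "g absolutely_integrable_on {a..b}"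
  shows "(\<lambda>t. h (f t) (g t) :: 'c::euclidean_space) absolutely_integrable_on {a..b}"
proof (rule absolutely_integrable_bounded_measurable_product[of h f "{a..b}" g])
  show "bilinear h" using h by (simp add: bilinear_conv_bounded_bilinear)
  show "f \<in> borel_measurable (lebesgue_on {a..b})"
    by (intro continuous_imp_measurable_on_sets_lebesgue f) simp
  show "bounded (f ` {a..b})" by (intro compact_imp_bounded compact_continuous_image f compact_Icc)
qed (use g in simp_all)

lemma has_vector_derivative_0_imp_const:
  fixes f :: "real \<Rightarrow> 'b::real_normed_vector"
  assumes "\<And>t. (f has_vector_derivative 0) (at t)"
  shows "f s = f t"
proof (rule has_derivative_zero_unique[of UNIV f s t])
  show "(f has_derivative (\<lambda>h. 0)) (at x within UNIV)" for x
    using assms[of x] by (simp add: has_vector_derivative_def)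
qed auto

context exponential_group begin

text \<open>The multiplication is Lipschitz on bounded sets, and absolutely continuous curves are
  bounded.\<close>

lemma AC_mult:
  assumes f: "AC a b f" and g: "AC a b g"
  shows "AC a b (\<lambda>t. f t \<otimes> g t)"
proof -
  obtain B where B: "\<And>t. t \<in> {a..b} \<Longrightarrow> norm (f t) \<le> B"
    using continuous_on_compact_bound[OF compact_Icc AC_imp_continuous_on[OF f]] by metis
  obtain C where C: "\<And>t. t \<in> {a..b} \<Longrightarrow> norm (g t) \<le> C"
    using continuous_on_compact_bound[OF compact_Icc AC_imp_continuous_on[OF g]] by metis
  obtain L where L: "L \<ge> 0" "\<And>p q. p \<in> cball 0 B \<times> cball 0 C \<Longrightarrow> q \<in> cball 0 B \<times> cball 0 C \<Longrightarrow>
      norm ((fst p \<otimes> snd p) - (fst q \<otimes> snd q)) \<le> L * norm (p - q)"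
    by (rule smooth_Lipschitz_on_compact_convex[OF smooth_multiplication, of "cball 0 B \<times> cball 0 C"])
      (auto intro: compact_Times convex_Times)
  show ?thesis
  proof (rule AC_Lipschitz_combination[OF f g, of _ L])
    fix s t assume st: "s \<in> {a..b}" "t \<in> {a..b}"
    have "norm ((f t \<otimes> g t) - (f s \<otimes> g s)) \<le> L * norm ((f t, g t) - (f s, g s))"
      using L(2)[of "(f t, g t)" "(f s, g s)"] B C st by simp
    also have "\<dots> \<le> L * (norm (f t - f s) + norm (g t - g s))"
      using L(1) norm_Pair_le[of "f t - f s" "g t - g s"] by (intro mult_left_mono) simp_all
    finally show "norm ((f t \<otimes> g t) - (f s \<otimes> g s)) \<le> L * (norm (f t - f s) + norm (g t - g s))" .
  qed
qed

text \<open>The velocity is read in the Lie algebra by left translation. A horizontal curve is a curve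
  with this property that starts at the identity.\<close>

definition velocity :: "(real \<Rightarrow> 'a) \<Rightarrow> (real \<Rightarrow> 'a) \<Rightarrow> bool" where
  "velocity \<gamma> u \<longleftrightarrow> AC 0 1 \<gamma> \<and>
    (AE t in lebesgue. t \<in> {0..1} \<longrightarrow> (\<gamma> has_vector_derivative left_diff G (\<gamma> t) (u t)) (at t within {0..1}))"

lemma horizontal_curve_iff: "horizontal_curve G u \<gamma> \<longleftrightarrow> velocity \<gamma> u \<and> \<gamma> 0 = 0"
  by (auto simp: horizontal_curve_def velocity_def one_eq_0)

lemma velocity_imp_continuous: "velocity \<gamma> u \<Longrightarrow> continuous_on {0..1} \<gamma>"
  by (simp add: velocity_def AC_imp_continuous_on)

lemma velocity_mult:
  assumes "velocity \<alpha> u" "velocity \<beta> v"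
  shows "velocity (\<lambda>t. \<alpha> t \<otimes> \<beta> t) (\<lambda>t. Ad (- \<beta> t) (u t) + v t)"
  unfolding velocity_def
proof
  show "AC 0 1 (\<lambda>t. \<alpha> t \<otimes> \<beta> t)" using assms by (simp add: velocity_def AC_mult)
  have 1: "AE t in lebesgue. t \<in> {0..1} \<longrightarrow> (\<alpha> has_vector_derivative left_diff G (\<alpha> t) (u t)) (at t within {0..1})"
   and 2: "AE t in lebesgue. t \<in> {0..1} \<longrightarrow> (\<beta> has_vector_derivative left_diff G (\<beta> t) (v t)) (at t within {0..1})"
    using assms by (simp_all add: velocity_def)
  show "AE t in lebesgue. t \<in> {0..1} \<longrightarrow> ((\<lambda>t. \<alpha> t \<otimes> \<beta> t) has_vector_derivative
      left_diff G (\<alpha> t \<otimes> \<beta> t) (Ad (- \<beta> t) (u t) + v t)) (at t within {0..1})"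
    using 1 2
  proof eventually_elim
    case (elim t)
    then show ?case using left_invariant_derivative_mult[of \<alpha> t "u t" "{0..1}" \<beta> "v t"] by blast
  qed
qed

lemma velocity_minus:
  assumes "velocity \<alpha> u"
  shows "velocity (\<lambda>t. - \<alpha> t) (\<lambda>t. - Ad (\<alpha> t) (u t))"
  unfolding velocity_def
proof
  have "AC 0 1 \<alpha>" using assms by (simp add: velocity_def)
  then show "AC 0 1 (\<lambda>t. - \<alpha> t)"
    by (rule AC_bounded_linear) (rule bounded_linear_minus[OF bounded_linear_ident])
  have 1: "AE t in lebesgue. t \<in> {0..1} \<longrightarrow> (\<alpha> has_vector_derivative left_diff G (\<alpha> t) (u t)) (at t within {0..1})"
    using assms by (simp add: velocity_def)
  show "AE t in lebesgue. t \<in> {0..1} \<longrightarrow> ((\<lambda>t. - \<alpha> t) has_vector_derivative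
      left_diff G (- \<alpha> t) (- Ad (\<alpha> t) (u t))) (at t within {0..1})"
    using 1
  proof eventually_elim
    case (elim t)
    then show ?case using left_invariant_derivative_minus[of \<alpha> t "u t" "{0..1}"] by blast
  qed
qed

lemma velocity_cong_AE:
  assumes "velocity \<gamma> u" "AE t in lebesgue. t \<in> {0..1} \<longrightarrow> u t = v t"
  shows "velocity \<gamma> v"
proof -
  have 1: "AE t in lebesgue. t \<in> {0..1} \<longrightarrow> (\<gamma> has_vector_derivative left_diff G (\<gamma> t) (u t)) (at t within {0..1})"
    using assms(1) by (simp add: velocity_def)
  have "AE t in lebesgue. t \<in> {0..1} \<longrightarrow> (\<gamma> has_vector_derivative left_diff G (\<gamma> t) (v t)) (at t within {0..1})"
    using 1 assms(2)
  proof eventually_elim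
    case (elim t) then show ?case by auto
  qed
  with assms(1) show ?thesis by (simp add: velocity_def)
qed

lemma velocity_const: "velocity (\<lambda>t. x) (\<lambda>t. 0)"
  by (simp add: velocity_def AC_const linear_0[OF linear_left_diff])

lemma velocity_0_imp_const:
  assumes "velocity \<gamma> (\<lambda>t. 0)" "t \<in> {0..1}"
  shows "\<gamma> t = \<gamma> 0"
  using assms by (intro AC_zero_derivative_const[of 0 1]) (auto simp: velocity_def linear_0[OF linear_left_diff])

text \<open>The curve \<open>\<gamma> t \<otimes> - \<gamma>' t\<close> has velocity \<open>0\<close>. This makes the definite description in the
  definition of the endpoint map meaningful.\<close>

lemma velocity_unique:
  assumes "velocity \<gamma> u" "velocity \<gamma>' u" "\<gamma> 0 = \<gamma>' 0" "t \<in> {0..1}"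
  shows "\<gamma> t = \<gamma>' t"
proof -
  have "velocity (\<lambda>t. \<gamma> t \<otimes> - \<gamma>' t) (\<lambda>t. 0)"
    using velocity_mult[OF assms(1) velocity_minus[OF assms(2)]] by simp
  from velocity_0_imp_const[OF this assms(4)] have "\<gamma> t \<otimes> - \<gamma>' t = 0" using assms(3) by simp
  then have "(\<gamma> t \<otimes> - \<gamma>' t) \<otimes> \<gamma>' t = \<gamma>' t" by simp
  then show ?thesis by (simp add: mult_assoc)
qed

lemma endpoint_eq:
  assumes "velocity \<gamma> u" "\<gamma> 0 = 0"
  shows "endpoint G u = \<gamma> 1"
  unfolding endpoint_def
proof (rule the_equality)
  show "\<exists>\<gamma>'. horizontal_curve G u \<gamma>' \<and> \<gamma> 1 = \<gamma>' 1" using assms by (auto simp: horizontal_curve_iff)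
  fix x assume "\<exists>\<gamma>'. horizontal_curve G u \<gamma>' \<and> x = \<gamma>' 1"
  then obtain \<gamma>' where "velocity \<gamma>' u" "\<gamma>' 0 = 0" "x = \<gamma>' 1" by (auto simp: horizontal_curve_iff)
  then show "x = \<gamma> 1" using velocity_unique[of \<gamma>' u \<gamma> 1] assms by simp
qed

text \<open>The key identity of the whole argument: to perturb the control \<open>u\<close> by \<open>v\<close>, multiply its
  curve from the left by a curve driven by \<open>Ad (\<gamma> t) (v t)\<close>. It reduces the differential of the
  endpoint map at \<open>u\<close> to the differential at the zero control.\<close>

lemma velocity_perturbation:
  assumes "velocity \<gamma> u" "velocity \<delta> (\<lambda>t. Ad (\<gamma> t) (v t))"
  shows "velocity (\<lambda>t. \<delta> t \<otimes> \<gamma> t) (\<lambda>t. u t + v t)"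
  using velocity_mult[OF assms(2,1)] by (simp add: add.commute)

lemma velocity_ray:
  fixes y :: "real \<Rightarrow> real"
  assumes y: "AC 0 1 y" "AE t in lebesgue. t \<in> {0..1} \<longrightarrow> (y has_vector_derivative y' t) (at t within {0..1})"
  shows "velocity (\<lambda>t. y t *\<^sub>R X) (\<lambda>t. y' t *\<^sub>R X)"
  unfolding velocity_def
proof
  show "AC 0 1 (\<lambda>t. y t *\<^sub>R X)" by (rule AC_bounded_linear[OF y(1) bounded_linear_scaleR_left])
  show "AE t in lebesgue. t \<in> {0..1} \<longrightarrow>
      ((\<lambda>t. y t *\<^sub>R X) has_vector_derivative left_diff G (y t *\<^sub>R X) (y' t *\<^sub>R X)) (at t within {0..1})"
    using y(2)
  proof eventually_elim
    case (elim t) then show ?case using scaled_ray_left_invariant[of y "y' t" t "{0..1}" X] by blast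
  qed
qed

lemma velocity_ray_integral:
  fixes a :: "real \<Rightarrow> real"
  assumes "a absolutely_integrable_on {0..1}"
  shows "velocity (\<lambda>t. (c + integral {0..t} a) *\<^sub>R X) (\<lambda>t. a t *\<^sub>R X)"
proof (rule velocity_ray)
  show "AC 0 1 (\<lambda>t. c + integral {0..t} a)"
    by (rule AC_add[OF AC_const AC_indefinite_integral[OF assms]])
  have "a integrable_on {0..1}" using assms by (simp add: absolutely_integrable_on_def)
  from AE_indefinite_integral_has_vector_derivative[OF this]
  show "AE t in lebesgue. t \<in> {0..1} \<longrightarrow> ((\<lambda>t. c + integral {0..t} a) has_vector_derivative a t) (at t within {0..1})"
  proof eventually_elim
    case (elim t)
    then show ?case using has_vector_derivative_add[OF has_vector_derivative_const, of "\<lambda>t. integral {0..t} a" "a t" "at t within {0..1}" c] by simp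
  qed
qed

lemma Ad_expand: "Ad x v = (\<Sum>b\<in>Basis. (v \<bullet> b) *\<^sub>R Ad x b)"
proof -
  have "Ad x v = Ad x (\<Sum>b\<in>Basis. (v \<bullet> b) *\<^sub>R b)" by (simp add: euclidean_representation)
  also have "\<dots> = (\<Sum>b\<in>Basis. (v \<bullet> b) *\<^sub>R Ad x b)"
    by (simp add: linear_sum[OF linear_Ad] linear_cmul[OF linear_Ad])
  finally show ?thesis .
qed

lemma absolutely_integrable_Ad:
  fixes \<gamma> v :: "real \<Rightarrow> 'a"
  assumes \<gamma>: "continuous_on {0..1} \<gamma>" and v: "v absolutely_integrable_on {0..1}"
  shows "(\<lambda>t. Ad (\<gamma> t) (v t)) absolutely_integrable_on {0..1}"
proof -
  have "(\<lambda>t. (v t \<bullet> b) *\<^sub>R Ad (\<gamma> t) b) absolutely_integrable_on {0..1}" for b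
  proof (rule absolutely_integrable_continuous_bilinear[of "\<lambda>x r. r *\<^sub>R x" 0 1 "\<lambda>t. Ad (\<gamma> t) b" "\<lambda>t. v t \<bullet> b"])
    show "bounded_bilinear (\<lambda>x (r::real). r *\<^sub>R x :: 'a)"
      by (rule bounded_bilinear.flip[OF bounded_bilinear_scaleR])
    show "continuous_on {0..1} (\<lambda>t. Ad (\<gamma> t) b)"
      by (intro continuous_on_Ad \<gamma> continuous_on_const)
    show "(\<lambda>t. v t \<bullet> b) absolutely_integrable_on {0..1}"
      using absolutely_integrable_linear[OF v bounded_linear_inner_left] by (simp add: o_def)
  qed
  then show ?thesis by (subst Ad_expand) (rule absolutely_integrable_sum, auto)
qed

lemma Ad_ray_fixed:
  assumes "lie_bracket G X Y = 0"
  shows "Ad (t *\<^sub>R X) Y = Y"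
proof -
  have "((\<lambda>t. Ad (t *\<^sub>R X) Y) has_vector_derivative 0) (at t within UNIV)" for t
    using has_vector_derivative_Ad_ray[of X Y t UNIV] assms linear_0[OF linear_Ad] by simp
  note c = has_vector_derivative_0_imp_const[OF this, of _ 0]
  from c[of t] show ?thesis by simp
qed

text \<open>The curve \<open>\<phi>\<close> is a one-parameter subgroup with initial velocity \<open>X + Y\<close>.\<close>

lemma mult_commuting:
  assumes "lie_bracket G X Y = 0"
  shows "X \<otimes> Y = X + Y" "Y \<otimes> X = X + Y"
proof -
  define \<phi> where "\<phi> = (\<lambda>t. (t *\<^sub>R X) \<otimes> (t *\<^sub>R Y))"
  have comm: "(b *\<^sub>R X) \<otimes> (a *\<^sub>R Y) = (a *\<^sub>R Y) \<otimes> (b *\<^sub>R X)" for a b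
    using Ad_mult_right[of "b *\<^sub>R X" "a *\<^sub>R Y"] by (simp add: Ad_scaleR Ad_ray_fixed[OF assms])
  have "\<phi> (a + b) = \<phi> a \<otimes> \<phi> b" for a b
  proof -
    have "\<phi> (a + b) = (a *\<^sub>R X) \<otimes> ((b *\<^sub>R X) \<otimes> (a *\<^sub>R Y)) \<otimes> (b *\<^sub>R Y)"
      by (simp add: \<phi>_def scaleR_mult_scaleR[symmetric] mult_assoc)
    also have "\<dots> = \<phi> a \<otimes> \<phi> b" by (simp only: comm) (simp add: \<phi>_def mult_assoc)
    finally show ?thesis .
  qed
  moreover have "continuous_on UNIV \<phi>" unfolding \<phi>_def by (intro continuous_on_mult continuous_intros)
  ultimately have lin: "\<phi> t = t *\<^sub>R \<phi> 1" for t by (rule continuous_hom_linear)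
  have "(\<phi> has_vector_derivative mult_deriv (0 *\<^sub>R X) (0 *\<^sub>R Y) (X, Y)) (at 0)"
    unfolding \<phi>_def by (intro has_vector_derivative_mult ray_has_vector_derivative)
  then have "(\<phi> has_vector_derivative X + Y) (at 0)" by (simp add: mult_deriv_0)
  moreover have "(\<phi> has_vector_derivative \<phi> 1) (at 0)"
    by (subst lin[abs_def]) (rule ray_has_vector_derivative)
  ultimately have "\<phi> 1 = X + Y" by (rule vector_derivative_unique_at[rotated])
  then show "X \<otimes> Y = X + Y" by (simp add: \<phi>_def)
  then show "Y \<otimes> X = X + Y" using comm[of 1 1] by simp
qed

text \<open>The product formula of the Heisenberg group. The quadratic third factor of \<open>\<phi>\<close> compensates
  the commutator of the first two, so that \<open>\<phi>\<close> is a one-parameter subgroup; its initial velocity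
  is \<open>w + v\<close>.\<close>

lemma mult_central_bracket:
  assumes z: "lie_bracket G w v = z" and wz: "lie_bracket G w z = 0" and vz: "lie_bracket G v z = 0"
  shows "w \<otimes> v = w + v + (1/2) *\<^sub>R z"
proof -
  have comm: "(r *\<^sub>R z) \<otimes> (b *\<^sub>R x) = (b *\<^sub>R x) \<otimes> (r *\<^sub>R z)" if "lie_bracket G x z = 0" for r b x
    using Ad_mult_right[of "b *\<^sub>R x" "r *\<^sub>R z"] by (simp add: Ad_scaleR Ad_ray_fixed[OF that])
  have Adv: "Ad (s *\<^sub>R w) v = v + s *\<^sub>R z" for s
  proof -
    have "((\<lambda>s. Ad (s *\<^sub>R w) v - s *\<^sub>R z) has_vector_derivative Ad (s *\<^sub>R w) (lie_bracket G w v) - z) (at s within UNIV)" for s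
      by (intro has_vector_derivative_diff has_vector_derivative_Ad_ray ray_has_vector_derivative)
    then have "((\<lambda>s. Ad (s *\<^sub>R w) v - s *\<^sub>R z) has_vector_derivative 0) (at s within UNIV)" for s
      unfolding z Ad_ray_fixed[OF wz] by simp
    note c = has_vector_derivative_0_imp_const[OF this, of _ 0]
    from c[of s] show ?thesis by (simp add: algebra_simps)
  qed
  \<comment> \<open>Commuting \<open>b w\<close> past \<open>a v\<close> produces the central factor \<open>a b z\<close>.\<close>
  have swap: "(b *\<^sub>R w) \<otimes> (a *\<^sub>R v) = (a *\<^sub>R v) \<otimes> (b *\<^sub>R w) \<otimes> ((a * b) *\<^sub>R z)" for a b
  proof -
    have "lie_bracket G (a *\<^sub>R v) ((a * b) *\<^sub>R z) = 0"
      using vz by (simp add: linear_cmul[OF linear_bracket_left] linear_cmul[OF linear_bracket_right])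
    note m = mult_commuting(1)[OF this]
    have "(b *\<^sub>R w) \<otimes> (a *\<^sub>R v) = Ad (b *\<^sub>R w) (a *\<^sub>R v) \<otimes> (b *\<^sub>R w)" by (simp add: Ad_mult_right)
    also have "Ad (b *\<^sub>R w) (a *\<^sub>R v) = (a *\<^sub>R v) \<otimes> ((a * b) *\<^sub>R z)"
      by (simp add: Ad_scaleR Adv m scaleR_add_right)
    finally show ?thesis by (simp add: mult_assoc comm[OF wz])
  qed
  define \<phi> where "\<phi> = (\<lambda>t::real. (t *\<^sub>R w) \<otimes> (t *\<^sub>R v) \<otimes> ((- (t\<^sup>2 / 2)) *\<^sub>R z))"
  have "\<phi> (a + b) = \<phi> a \<otimes> \<phi> b" for a b
  proof -
    have "\<phi> (a + b) = (a *\<^sub>R w) \<otimes> ((b *\<^sub>R w) \<otimes> (a *\<^sub>R v)) \<otimes> (b *\<^sub>R v) \<otimes> ((- ((a + b)\<^sup>2 / 2)) *\<^sub>R z)"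
      by (simp add: \<phi>_def scaleR_mult_scaleR[symmetric, where x = w] scaleR_mult_scaleR[symmetric, where x = v] mult_assoc)
    also have "\<dots> = (a *\<^sub>R w) \<otimes> (a *\<^sub>R v) \<otimes> (b *\<^sub>R w) \<otimes> (((a * b) *\<^sub>R z) \<otimes> (b *\<^sub>R v)) \<otimes> ((- ((a + b)\<^sup>2 / 2)) *\<^sub>R z)"
      unfolding swap[of b a] by (simp only: mult_assoc)
    also have "\<dots> = (a *\<^sub>R w) \<otimes> (a *\<^sub>R v) \<otimes> (b *\<^sub>R w) \<otimes> (b *\<^sub>R v) \<otimes> (((a * b) *\<^sub>R z) \<otimes> ((- ((a + b)\<^sup>2 / 2)) *\<^sub>R z))"
      unfolding comm[OF vz, of "a * b" b] by (simp only: mult_assoc)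
    also have "((a * b) *\<^sub>R z) \<otimes> ((- ((a + b)\<^sup>2 / 2)) *\<^sub>R z) = ((- (a\<^sup>2 / 2)) *\<^sub>R z) \<otimes> ((- (b\<^sup>2 / 2)) *\<^sub>R z)"
      unfolding scaleR_mult_scaleR by (simp add: power2_eq_square field_simps)
    also have "(a *\<^sub>R w) \<otimes> (a *\<^sub>R v) \<otimes> (b *\<^sub>R w) \<otimes> (b *\<^sub>R v) \<otimes> (((- (a\<^sup>2 / 2)) *\<^sub>R z) \<otimes> ((- (b\<^sup>2 / 2)) *\<^sub>R z))
        = (a *\<^sub>R w) \<otimes> (a *\<^sub>R v) \<otimes> ((b *\<^sub>R w) \<otimes> (((b *\<^sub>R v) \<otimes> ((- (a\<^sup>2 / 2)) *\<^sub>R z)) \<otimes> ((- (b\<^sup>2 / 2)) *\<^sub>R z)))"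
      by (simp only: mult_assoc)
    also have "\<dots> = (a *\<^sub>R w) \<otimes> (a *\<^sub>R v) \<otimes> (((b *\<^sub>R w) \<otimes> ((- (a\<^sup>2 / 2)) *\<^sub>R z)) \<otimes> (b *\<^sub>R v) \<otimes> ((- (b\<^sup>2 / 2)) *\<^sub>R z))"
      unfolding comm[OF vz, of "- (a\<^sup>2 / 2)" b, symmetric] by (simp only: mult_assoc)
    also have "\<dots> = \<phi> a \<otimes> \<phi> b"
      unfolding comm[OF wz, of "- (a\<^sup>2 / 2)" b, symmetric] by (simp only: \<phi>_def mult_assoc)
    finally show ?thesis .
  qed
  moreover have "continuous_on UNIV \<phi>" unfolding \<phi>_def by (intro continuous_on_mult continuous_intros) auto
  ultimately have lin: "\<phi> t = t *\<^sub>R \<phi> 1" for t by (rule continuous_hom_linear)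
  have sq: "((\<lambda>t. (- (t\<^sup>2 / 2)) *\<^sub>R z) has_vector_derivative 0) (at (0::real))"
  proof -
    have "((\<lambda>t. - (t\<^sup>2 / 2)) has_real_derivative 0) (at (0::real))" by (auto intro!: derivative_eq_intros)
    then show ?thesis
      using bounded_linear.has_vector_derivative[OF bounded_linear_scaleR_left, of "\<lambda>t. - (t\<^sup>2 / 2)" 0 "at 0" z]
      by (simp add: has_real_derivative_iff_has_vector_derivative)
  qed
  have "(\<phi> has_vector_derivative mult_deriv ((0 *\<^sub>R w) \<otimes> (0 *\<^sub>R v)) ((- (0\<^sup>2 / 2)) *\<^sub>R z) (mult_deriv (0 *\<^sub>R w) (0 *\<^sub>R v) (w, v), 0)) (at 0)"
    unfolding \<phi>_def by (intro has_vector_derivative_mult ray_has_vector_derivative sq)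
  then have "(\<phi> has_vector_derivative w + v) (at 0)" by (simp add: mult_deriv_0)
  moreover have "(\<phi> has_vector_derivative \<phi> 1) (at 0)"
    by (subst lin[abs_def]) (rule ray_has_vector_derivative)
  ultimately have "\<phi> 1 = w + v" by (rule vector_derivative_unique_at[rotated])
  then have "w \<otimes> v \<otimes> ((- (1/2)) *\<^sub>R z) = w + v" by (simp add: \<phi>_def)
  then have "(w \<otimes> v \<otimes> ((- (1/2)) *\<^sub>R z)) \<otimes> ((1/2) *\<^sub>R z) = (w + v) \<otimes> ((1/2) *\<^sub>R z)" by simp
  then have "w \<otimes> v = (w + v) \<otimes> ((1/2) *\<^sub>R z)"
    unfolding mult_assoc scaleR_mult_scaleR by simp
  also have "\<dots> = w + v + (1/2) *\<^sub>R z"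
    by (rule mult_commuting)
      (simp add: linear_add[OF linear_bracket_left] linear_cmul[OF linear_bracket_right] wz vz)
  finally show ?thesis .
qed

text \<open>The exponential series of the bracket with \<open>t *\<^sub>R X\<close>; it satisfies the same linear
  differential equation in \<open>t\<close> as the left-hand side.\<close>

lemma Ad_ray_nilpotent:
  "(lie_bracket G X ^^ N) Y = 0 \<Longrightarrow> Ad (t *\<^sub>R X) Y = (\<Sum>k<N. (t ^ k / fact k) *\<^sub>R (lie_bracket G X ^^ k) Y)"
proof (induction N arbitrary: Y t)
  case 0 then show ?case by (simp add: linear_0[OF linear_Ad])
next
  case (Suc N)
  define S where "S = (\<lambda>t. \<Sum>k<Suc N. (t ^ k / fact k) *\<^sub>R (lie_bracket G X ^^ k) Y)"
  have ad: "(lie_bracket G X ^^ N) (lie_bracket G X Y) = 0" using Suc.prems by (simp add: funpow_swap1)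
  have Ad': "Ad (t *\<^sub>R X) (lie_bracket G X Y) = (\<Sum>k<N. (t ^ k / fact k) *\<^sub>R (lie_bracket G X ^^ Suc k) Y)" for t
    using Suc.IH[OF ad] by (simp add: funpow_swap1)
  have S: "(S has_vector_derivative (\<Sum>k<N. (t ^ k / fact k) *\<^sub>R (lie_bracket G X ^^ Suc k) Y)) (at t within UNIV)" for t
  proof -
    have step: "((\<lambda>t. (t ^ Suc k / fact (Suc k)) *\<^sub>R (lie_bracket G X ^^ Suc k) Y) has_vector_derivative
        (t ^ k / fact k) *\<^sub>R (lie_bracket G X ^^ Suc k) Y) (at t within UNIV)" for k
    proof -
      have "((\<lambda>t. t ^ Suc k / fact (Suc k)) has_real_derivative (real (Suc k) * t ^ k / fact (Suc k))) (at t)"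
        by (rule derivative_eq_intros refl | simp)+
      moreover have "real (Suc k) * t ^ k / fact (Suc k) = t ^ k / fact k"
        by (simp del: of_nat_Suc)
      ultimately have "((\<lambda>t. t ^ Suc k / fact (Suc k)) has_vector_derivative t ^ k / fact k) (at t within UNIV)"
        by (simp only: has_real_derivative_iff_has_vector_derivative)
      then show ?thesis by (rule bounded_linear.has_vector_derivative[OF bounded_linear_scaleR_left])
    qed
    have "S = (\<lambda>t. Y + (\<Sum>k<N. (t ^ Suc k / fact (Suc k)) *\<^sub>R (lie_bracket G X ^^ Suc k) Y))"
      unfolding S_def by (subst sum.lessThan_Suc_shift) simp
    moreover have "((\<lambda>t. Y + (\<Sum>k<N. (t ^ Suc k / fact (Suc k)) *\<^sub>R (lie_bracket G X ^^ Suc k) Y)) has_vector_derivative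
        0 + (\<Sum>k<N. (t ^ k / fact k) *\<^sub>R (lie_bracket G X ^^ Suc k) Y)) (at t within UNIV)"
      by (intro has_vector_derivative_add has_vector_derivative_const has_vector_derivative_sum step)
    ultimately show ?thesis by simp
  qed
  have "((\<lambda>t. Ad (t *\<^sub>R X) Y - S t) has_vector_derivative 0) (at t within UNIV)" for t
    using has_vector_derivative_diff[OF has_vector_derivative_Ad_ray[of X Y t UNIV] S[of t]] unfolding Ad' by simp
  note c = has_vector_derivative_0_imp_const[OF this, of _ 0]
  have "S 0 = Y" unfolding S_def by (subst sum.lessThan_Suc_shift) simp
  with c[of t] have "Ad (t *\<^sub>R X) Y = S t" by simp
  then show ?case by (simp add: S_def)
qed

end

section \<open>Integrating velocities in an extension of a line\<close>

lemma integrable_on_Icc_subset: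
  fixes f :: "real \<Rightarrow> 'a::euclidean_space"
  assumes "f integrable_on {a..b}" "t \<in> {a..b}"
  shows "f integrable_on {a..t}"
  using integrable_subinterval_real[OF assms(1)] assms(2) by auto

lemma norm_integral_le_integral:
  fixes f :: "real \<Rightarrow> 'a::euclidean_space" and g :: "real \<Rightarrow> real"
  assumes f: "f integrable_on {a..b}" and g: "g integrable_on {a..b}"
    and le: "\<And>r. r \<in> {a..b} \<Longrightarrow> norm (f r) \<le> g r" and t: "t \<in> {a..b}"
  shows "norm (integral {a..t} f) \<le> integral {a..b} g"
proof -
  have sub: "{a..t} \<subseteq> {a..b}" using t by auto
  have "norm (integral {a..t} f) \<le> integral {a..t} g"
    by (rule integral_norm_bound_integral[OF integrable_on_Icc_subset[OF f t] integrable_on_Icc_subset[OF g t]])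
      (use le sub in blast)
  also have "\<dots> \<le> integral {a..b} g"
  proof -
    have "0 \<le> g r" if "r \<in> {a..b}" for r using le[OF that] norm_ge_zero[of "f r"] by linarith
    then show ?thesis by (intro integral_subset_le[OF sub integrable_on_Icc_subset[OF g t] g]) auto
  qed
  finally show ?thesis .
qed

lemma absolutely_integrable_bounded_linear:
  fixes f :: "real \<Rightarrow> 'a::euclidean_space" and h :: "'a \<Rightarrow> 'b::euclidean_space"
  assumes "f absolutely_integrable_on S" "bounded_linear h"
  shows "(\<lambda>t. h (f t)) absolutely_integrable_on S"
  using absolutely_integrable_linear[OF assms] by (simp add: o_def)

lemma integral_bounded_linear:
  fixes f :: "real \<Rightarrow> 'a::euclidean_space" and h :: "'a \<Rightarrow> 'b::euclidean_space"
  assumes "f integrable_on S" "bounded_linear h"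
  shows "integral S (\<lambda>t. h (f t)) = h (integral S f)"
  using integral_linear[OF assms] by (simp add: o_def)

lemma L1_norm_nonneg: "L1_norm v \<ge> 0"
  unfolding L1_norm_def
  by (cases "(\<lambda>t. norm (v t)) integrable_on {0..1}") (auto intro: integral_nonneg simp: not_integrable_integral)

lemma controls_combination:
  assumes "subspace V" "v \<in> controls V" "w \<in> controls V"
  shows "(\<lambda>t. a *\<^sub>R v t + b *\<^sub>R w t) \<in> controls V"
proof -
  have "(\<lambda>t. a *\<^sub>R v t + b *\<^sub>R w t) absolutely_integrable_on {0..1}"
    using assms(2,3) unfolding controls_def
    by (intro set_integral_add absolutely_integrable_bounded_linear[OF _ bounded_linear_scaleR_right]) auto
  then show ?thesis using assms by (auto simp: controls_def intro!: subspace_add subspace_mul)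
qed

lemma L1_norm_scaleR: "L1_norm (\<lambda>t. a *\<^sub>R v t) = \<bar>a\<bar> * L1_norm v"
  by (simp add: L1_norm_def)

text \<open>Both differentials are homogeneous, so the bound on their difference for small controls
  forces them to agree.\<close>

lemma L1_differential_unique:
  assumes D: "has_L1_differential V F D u" and D': "has_L1_differential V F D' u"
    and V: "subspace V" and v: "v \<in> controls V"
  shows "D v = D' v"
proof (rule ccontr)
  assume "D v \<noteq> D' v"
  define n where "n = L1_norm v"
  have n: "n \<ge> 0" by (simp add: n_def L1_norm_nonneg)
  define \<epsilon> where "\<epsilon> = norm (D v - D' v) / (4 * (n + 1))"
  have "\<epsilon> > 0" using \<open>D v \<noteq> D' v\<close> n by (simp add: \<epsilon>_def)
  obtain d where d: "d > 0" "\<And>v. v \<in> controls V \<Longrightarrow> L1_norm v < d \<Longrightarrow> norm (F (\<lambda>t. u t + v t) - F u - D v) \<le> \<epsilon> * L1_norm v"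
    using D \<open>\<epsilon> > 0\<close> unfolding has_L1_differential_def by meson
  obtain d' where d': "d' > 0" "\<And>v. v \<in> controls V \<Longrightarrow> L1_norm v < d' \<Longrightarrow> norm (F (\<lambda>t. u t + v t) - F u - D' v) \<le> \<epsilon> * L1_norm v"
    using D' \<open>\<epsilon> > 0\<close> unfolding has_L1_differential_def by meson
  have n1: "n + 1 \<noteq> 0" using n by simp
  have cancel: "m / (2 * k) * k = m / 2" "2 * (m / (4 * k)) * k = m / 2" if "k \<noteq> 0" for m k :: real
    using that by simp_all
  define r where "r = min d d' / (2 * (n + 1))"
  have r: "r > 0" using d(1) d'(1) n by (simp add: r_def)
  define rv where "rv = (\<lambda>t. r *\<^sub>R v t)"
  have rv: "rv \<in> controls V" using controls_combination[OF V v v, of r 0] by (simp add: rv_def)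
  have "r * n \<le> r * (n + 1)" using r by simp
  also have "\<dots> = min d d' / 2" unfolding r_def by (rule cancel(1)[OF n1])
  also have "\<dots> < min d d'" using d(1) d'(1) by (simp add: min_def)
  finally have small: "L1_norm rv < d" "L1_norm rv < d'" using r by (simp_all add: rv_def L1_norm_scaleR n_def)
  have lin: "D rv = r *\<^sub>R D v" "D' rv = r *\<^sub>R D' v"
  proof -
    have "D (\<lambda>t. r *\<^sub>R v t + 0 *\<^sub>R v t) = r *\<^sub>R D v + 0 *\<^sub>R D v" "D' (\<lambda>t. r *\<^sub>R v t + 0 *\<^sub>R v t) = r *\<^sub>R D' v + 0 *\<^sub>R D' v"
      using D D' v unfolding has_L1_differential_def by blast+
    then show "D rv = r *\<^sub>R D v" "D' rv = r *\<^sub>R D' v" by (simp_all add: rv_def)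
  qed
  have "r * norm (D v - D' v) = norm (D rv - D' rv)" using r by (simp add: lin scaleR_diff_right[symmetric])
  also have "\<dots> \<le> norm (F (\<lambda>t. u t + rv t) - F u - D' rv) + norm (F (\<lambda>t. u t + rv t) - F u - D rv)"
    using norm_triangle_ineq4[of "F (\<lambda>t. u t + rv t) - F u - D' rv" "F (\<lambda>t. u t + rv t) - F u - D rv"] by simp
  also have "\<dots> \<le> \<epsilon> * (r * n) + \<epsilon> * (r * n)"
    using d(2)[OF rv small(1)] d'(2)[OF rv small(2)] r by (simp add: rv_def L1_norm_scaleR n_def)
  also have "\<dots> = r * (2 * \<epsilon> * n)" by simp
  finally have "norm (D v - D' v) \<le> 2 * \<epsilon> * n" using r by simp
  also have "\<dots> \<le> 2 * \<epsilon> * (n + 1)" using \<open>\<epsilon> > 0\<close> by simp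
  also have "\<dots> = norm (D v - D' v) / 2" unfolding \<epsilon>_def by (rule cancel(2)[OF n1])
  finally show False using \<open>D v \<noteq> D' v\<close> by simp
qed

context exponential_group begin

lemma mult_near_0:
  assumes "\<epsilon> > 0"
  shows "\<exists>d>0. \<forall>a b. norm a < d \<longrightarrow> norm b < d \<longrightarrow> norm (a \<otimes> b - a - b) \<le> \<epsilon> * (norm a + norm b)"
proof -
  have "((\<lambda>p. fst p \<otimes> snd p) has_derivative mult_deriv 0 0) (at (0, 0) within UNIV)" using mult_deriv by simp
  then obtain d where d: "d > 0" "\<And>p. norm (p - (0, 0)) < d \<Longrightarrow>
      norm (fst p \<otimes> snd p - fst (0::'a, 0::'a) \<otimes> snd (0::'a, 0::'a) - mult_deriv 0 0 (p - (0, 0))) \<le> \<epsilon> * norm (p - (0, 0))"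
    using assms unfolding has_derivative_within_alt by blast
  have "norm (a \<otimes> b - a - b) \<le> \<epsilon> * (norm a + norm b)" if "norm a < d / 2" "norm b < d / 2" for a b
  proof -
    have n: "norm (a, b) \<le> norm a + norm b" by (rule norm_Pair_le)
    have "norm (a \<otimes> b - a - b) \<le> \<epsilon> * norm (a, b)"
      using d(2)[of "(a, b)"] n that by (simp add: mult_deriv_0 diff_diff_eq zero_prod_def[symmetric])
    also have "\<dots> \<le> \<epsilon> * (norm a + norm b)" using n assms by simp
    finally show ?thesis .
  qed
  then show ?thesis using d(1) by (intro exI[of _ "d / 2"]) simp
qed

lemma Ad_ray_near_identity:
  assumes "\<epsilon> > 0"
  shows "\<exists>d>0. \<forall>s. \<bar>s\<bar> < d \<longrightarrow> (\<forall>v. norm (Ad (s *\<^sub>R X) v - v) \<le> \<epsilon> * norm v)"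
proof -
  define f where "f = (\<lambda>s. \<Sum>b\<in>Basis. norm (Ad (s *\<^sub>R X) b - b))"
  have "continuous_on UNIV f" unfolding f_def
    by (intro continuous_intros continuous_on_Ad)
  then have "isCont f 0" by (simp add: continuous_on_eq_continuous_at)
  then obtain d where d: "d > 0" "\<And>s. dist s 0 < d \<Longrightarrow> dist (f s) (f 0) < \<epsilon>"
    using assms unfolding continuous_at_eps_delta by blast
  have "norm (Ad (s *\<^sub>R X) v - v) \<le> \<epsilon> * norm v" if "\<bar>s\<bar> < d" for s v
  proof -
    have "f s < \<epsilon>" using d(2)[of s] that by (simp add: f_def dist_real_def)
    have "Ad (s *\<^sub>R X) v - v = (\<Sum>b\<in>Basis. (v \<bullet> b) *\<^sub>R Ad (s *\<^sub>R X) b) - (\<Sum>b\<in>Basis. (v \<bullet> b) *\<^sub>R b)"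
      by (simp add: Ad_expand[symmetric] euclidean_representation)
    also have "\<dots> = (\<Sum>b\<in>Basis. (v \<bullet> b) *\<^sub>R (Ad (s *\<^sub>R X) b - b))"
      by (simp add: sum_subtractf scaleR_diff_right)
    also have "norm \<dots> \<le> (\<Sum>b\<in>Basis. norm v * norm (Ad (s *\<^sub>R X) b - b))"
      by (intro sum_norm_le) (simp add: Basis_le_norm mult_right_mono)
    also have "\<dots> = f s * norm v" by (simp add: f_def sum_distrib_left mult.commute)
    also have "\<dots> \<le> \<epsilon> * norm v" using \<open>f s < \<epsilon>\<close> by (intro mult_right_mono) auto
    finally show ?thesis .
  qed
  with d(1) show ?thesis by blast
qed

lemma Ad_bounded_along_curve:
  fixes \<gamma> :: "real \<Rightarrow> 'a"
  assumes "continuous_on {a..b} \<gamma>"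
  obtains B where "B > 0" "\<And>t v. t \<in> {a..b} \<Longrightarrow> norm (Ad (\<gamma> t) v) \<le> B * norm v"
proof -
  define f where "f = (\<lambda>t. \<Sum>b\<in>Basis. norm (Ad (\<gamma> t) b))"
  have "continuous_on {a..b} f" unfolding f_def
    by (intro continuous_intros continuous_on_Ad assms)
  then obtain C where C: "C \<ge> 0" "\<And>t. t \<in> {a..b} \<Longrightarrow> norm (f t) \<le> C"
    using continuous_on_compact_bound[OF compact_Icc] by metis
  have "norm (Ad (\<gamma> t) v) \<le> (C + 1) * norm v" if "t \<in> {a..b}" for t v
  proof -
    have "norm (Ad (\<gamma> t) v) \<le> (\<Sum>b\<in>Basis. norm v * norm (Ad (\<gamma> t) b))"
      unfolding Ad_expand[of _ v] by (intro sum_norm_le) (simp add: Basis_le_norm mult_right_mono)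
    also have "\<dots> = f t * norm v" by (simp add: f_def sum_distrib_left mult.commute)
    also have "\<dots> \<le> (C + 1) * norm v" using C(2)[OF that] by (intro mult_right_mono) auto
    finally show ?thesis .
  qed
  with C(1) that[of "C + 1"] show ?thesis by simp
qed

end

text \<open>The structure shared by both types of filiform groups: the kernel of \<open>\<pi>\<close> is an ideal whose
  brackets are central, and \<open>e\<close>, which acts nilpotently, spans a complement. It is what makes
  the equation for a curve with prescribed velocity solvable by two successive integrations.\<close>

locale two_step_by_line = exponential_group +
  fixes e :: 'a and \<pi> :: "'a \<Rightarrow> real" and N :: nat
  assumes linear_\<pi>: "linear \<pi>" and \<pi>_e: "\<pi> e = 1"
    and \<pi>_bracket: "\<And>X Y. \<pi> (lie_bracket G X Y) = 0"
    and bracket_central: "\<And>v w X. \<pi> v = 0 \<Longrightarrow> \<pi> w = 0 \<Longrightarrow> lie_bracket G X (lie_bracket G v w) = 0"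
    and bracket_e_nilpotent: "\<And>X. (lie_bracket G e ^^ N) X = 0"
begin

lemma bounded_linear_\<pi>: "bounded_linear \<pi>"
  using linear_\<pi> linear_conv_bounded_linear by blast

lemma \<pi>_simps [simp]: "\<pi> (x + y) = \<pi> x + \<pi> y" "\<pi> (x - y) = \<pi> x - \<pi> y" "\<pi> (c *\<^sub>R x) = c * \<pi> x" "\<pi> 0 = 0" "\<pi> (- x) = - \<pi> x"
  using linear_\<pi> by (simp_all add: linear_add linear_diff linear_cmul linear_0 linear_neg)

lemma \<pi>_Ad_e: "\<pi> (Ad (t *\<^sub>R e) X) = \<pi> X"
proof (cases N)
  case 0
  then have "e = 0" using bracket_e_nilpotent[of e] by simp
  then show ?thesis using \<pi>_e by simp
next
  case (Suc M)
  have "\<pi> (Ad (t *\<^sub>R e) X) = (\<Sum>k<N. t ^ k / fact k * \<pi> ((lie_bracket G e ^^ k) X))"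
    using Ad_ray_nilpotent[OF bracket_e_nilpotent, of t X] by (simp add: linear_sum[OF linear_\<pi>])
  also have "\<dots> = \<pi> X" unfolding Suc by (subst sum.lessThan_Suc_shift) (simp add: \<pi>_bracket)
  finally show ?thesis .
qed

lemma mult_kernel:
  assumes "\<pi> v = 0" "\<pi> w = 0"
  shows "w \<otimes> v = w + v + (1/2) *\<^sub>R lie_bracket G w v"
  by (rule mult_central_bracket) (simp_all add: bracket_central assms)

lemma left_diff_kernel:
  assumes "\<pi> v = 0" "\<pi> w = 0"
  shows "left_diff G w v = v + (1/2) *\<^sub>R lie_bracket G w v"
proof -
  have "((\<lambda>t. w \<otimes> (t *\<^sub>R v)) has_vector_derivative left_diff G w v) (at 0)" by (rule left_translate_ray)
  moreover have "w \<otimes> (t *\<^sub>R v) = w + t *\<^sub>R (v + (1/2) *\<^sub>R lie_bracket G w v)" for t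
    using mult_kernel[of "t *\<^sub>R v" w] assms by (simp add: linear_cmul[OF linear_bracket_right] algebra_simps)
  ultimately have "((\<lambda>t. w + t *\<^sub>R (v + (1/2) *\<^sub>R lie_bracket G w v)) has_vector_derivative left_diff G w v) (at 0)" by simp
  moreover have "((\<lambda>t. w + t *\<^sub>R (v + (1/2) *\<^sub>R lie_bracket G w v)) has_vector_derivative 0 + (v + (1/2) *\<^sub>R lie_bracket G w v)) (at 0)"
    by (rule has_vector_derivative_add[OF has_vector_derivative_const ray_has_vector_derivative])
  ultimately show ?thesis using vector_derivative_unique_at by fastforce
qed

text \<open>The primitive of \<open>z\<close> in the subgroup given by the kernel of \<open>\<pi>\<close>: the second term is the
  signed area swept by the first one.\<close>

definition kernel_primitive :: "(real \<Rightarrow> 'a) \<Rightarrow> real \<Rightarrow> 'a" where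
  "kernel_primitive z t = integral {0..t} z
    + (1/2) *\<^sub>R integral {0..t} (\<lambda>r. lie_bracket G (integral {0..r} z) (z r))"

lemma absolutely_integrable_bracket_primitive:
  fixes z :: "real \<Rightarrow> 'a"
  assumes z: "z absolutely_integrable_on {0..1}"
  shows "(\<lambda>r. lie_bracket G (integral {0..r} z) (z r)) absolutely_integrable_on {0..1}"
  by (intro absolutely_integrable_continuous_bilinear[of "lie_bracket G" 0 1 "\<lambda>r. integral {0..r} z" z]
      bounded_bilinear_bracket AC_imp_continuous_on AC_indefinite_integral z)

lemma \<pi>_integral_eq_0:
  fixes z :: "real \<Rightarrow> 'a"
  assumes z: "z integrable_on {0..1}" and \<pi>z: "\<And>t. t \<in> {0..1} \<Longrightarrow> \<pi> (z t) = 0" and t: "t \<in> {0..1}"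
  shows "\<pi> (integral {0..t} z) = 0"
proof -
  have "\<pi> (integral {0..t} z) = integral {0..t} (\<lambda>r. \<pi> (z r))"
    by (rule integral_bounded_linear[OF integrable_on_Icc_subset[OF z t] bounded_linear_\<pi>, symmetric])
  also have "\<dots> = integral {0..t} (\<lambda>r. 0)" using t \<pi>z by (intro integral_cong) auto
  finally show ?thesis by simp
qed

text \<open>The second term of the primitive is central in the kernel, so replacing the first term by
  the whole primitive does not change its bracket with \<open>z t\<close>.\<close>

lemma velocity_kernel_primitive:
  assumes z: "z absolutely_integrable_on {0..1}" and \<pi>z: "\<And>t. t \<in> {0..1} \<Longrightarrow> \<pi> (z t) = 0"
  shows "velocity (kernel_primitive z) z"
  unfolding velocity_def
proof
  define w0 where "w0 = (\<lambda>t. integral {0..t} z)"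
  define c where "c = (\<lambda>r. lie_bracket G (w0 r) (z r))"
  have kp: "kernel_primitive z = (\<lambda>t. w0 t + (1/2) *\<^sub>R integral {0..t} c)"
    by (simp add: kernel_primitive_def w0_def c_def fun_eq_iff)
  have zi: "z integrable_on {0..1}" using z by (simp add: absolutely_integrable_on_def)
  have c: "c absolutely_integrable_on {0..1}"
    unfolding c_def w0_def by (rule absolutely_integrable_bracket_primitive[OF z])
  then have ci: "c integrable_on {0..1}" by (simp add: absolutely_integrable_on_def)
  show "AC 0 1 (kernel_primitive z)"
    unfolding kp w0_def
    by (intro AC_add AC_indefinite_integral z AC_bounded_linear[OF AC_indefinite_integral[OF c] bounded_linear_scaleR_right])
  have \<pi>w0: "\<pi> (w0 t) = 0" if "t \<in> {0..1}" for t
    unfolding w0_def by (rule \<pi>_integral_eq_0[OF zi \<pi>z that])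
  have \<pi>c: "\<pi> (integral {0..t} c) = 0" if "t \<in> {0..1}" for t
    by (rule \<pi>_integral_eq_0[OF ci _ that]) (simp add: c_def \<pi>_bracket)
  have cz: "lie_bracket G (integral {0..t} c) (z t) = 0" if t: "t \<in> {0..1}" for t
  proof -
    have bl: "bounded_linear (\<lambda>x. lie_bracket G x (z t))"
      using linear_bracket_left linear_conv_bounded_linear by blast
    have "lie_bracket G (integral {0..t} c) (z t) = integral {0..t} (\<lambda>r. lie_bracket G (c r) (z t))"
      by (rule integral_bounded_linear[OF integrable_on_Icc_subset[OF ci t] bl, symmetric])
    also have "\<dots> = integral {0..t} (\<lambda>r. 0)"
    proof (rule integral_cong)
      fix r assume "r \<in> {0..t}"
      then have "r \<in> {0..1}" using t by auto
      then have "lie_bracket G (z t) (c r) = 0" unfolding c_def by (intro bracket_central \<pi>w0 \<pi>z)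
      then show "lie_bracket G (c r) (z t) = 0" using lie_bracket_skew[of "c r" "z t"] by simp
    qed
    finally show ?thesis by simp
  qed
  have ld: "left_diff G (kernel_primitive z t) (z t) = z t + (1/2) *\<^sub>R c t" if t: "t \<in> {0..1}" for t
  proof -
    have "left_diff G (kernel_primitive z t) (z t) = z t + (1/2) *\<^sub>R lie_bracket G (kernel_primitive z t) (z t)"
      by (rule left_diff_kernel) (use t in \<open>simp_all add: kp \<pi>w0 \<pi>c \<pi>z\<close>)
    then show ?thesis
      by (simp add: kp linear_add[OF linear_bracket_left] linear_cmul[OF linear_bracket_left] cz[OF t]) (simp add: c_def)
  qed
  have 1: "AE t in lebesgue. t \<in> {0..1} \<longrightarrow> (w0 has_vector_derivative z t) (at t within {0..1})"
    unfolding w0_def by (rule AE_indefinite_integral_has_vector_derivative[OF zi])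
  have 2: "AE t in lebesgue. t \<in> {0..1} \<longrightarrow> ((\<lambda>t. integral {0..t} c) has_vector_derivative c t) (at t within {0..1})"
    by (rule AE_indefinite_integral_has_vector_derivative[OF ci])
  show "AE t in lebesgue. t \<in> {0..1} \<longrightarrow>
      (kernel_primitive z has_vector_derivative left_diff G (kernel_primitive z t) (z t)) (at t within {0..1})"
    using 1 2
  proof eventually_elim
    case (elim t)
    show ?case
    proof
      assume t: "t \<in> {0..1}"
      then have "((\<lambda>t. w0 t + (1/2) *\<^sub>R integral {0..t} c) has_vector_derivative z t + (1/2) *\<^sub>R c t) (at t within {0..1})"
        using elim by (intro has_vector_derivative_add bounded_linear.has_vector_derivative[OF bounded_linear_scaleR_right]) auto
      then show "(kernel_primitive z has_vector_derivative left_diff G (kernel_primitive z t) (z t)) (at t within {0..1})"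
        unfolding ld[OF t] unfolding kp .
    qed
  qed
qed

definition line_part :: "(real \<Rightarrow> 'a) \<Rightarrow> real \<Rightarrow> real" where
  "line_part \<eta> t = integral {0..t} (\<lambda>r. \<pi> (\<eta> r))"

definition kernel_part :: "(real \<Rightarrow> 'a) \<Rightarrow> real \<Rightarrow> 'a" where
  "kernel_part \<eta> t = Ad (line_part \<eta> t *\<^sub>R e) (\<eta> t - \<pi> (\<eta> t) *\<^sub>R e)"

text \<open>Every group element is the product of a kernel element and a multiple of \<open>e\<close>. In these
  coordinates the component along \<open>e\<close> is integrated first, and conjugation by it turns the
  remaining equation into one inside the kernel.\<close>

definition trajectory :: "(real \<Rightarrow> 'a) \<Rightarrow> real \<Rightarrow> 'a" where
  "trajectory \<eta> t = kernel_primitive (kernel_part \<eta>) t \<otimes> (line_part \<eta> t *\<^sub>R e)"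

lemma trajectory_0: "trajectory \<eta> 0 = 0"
  by (simp add: trajectory_def kernel_primitive_def line_part_def)

lemma \<pi>_kernel_part: "\<pi> (kernel_part \<eta> t) = 0"
  by (simp add: kernel_part_def \<pi>_Ad_e \<pi>_e)

context
  fixes \<eta> :: "real \<Rightarrow> 'a"
  assumes \<eta>: "\<eta> absolutely_integrable_on {0..1}"
begin

lemma absolutely_integrable_\<pi>: "(\<lambda>t. \<pi> (\<eta> t)) absolutely_integrable_on {0..1}"
  by (rule absolutely_integrable_bounded_linear[OF \<eta> bounded_linear_\<pi>])

lemma continuous_on_line_part: "continuous_on {0..1} (line_part \<eta>)"
  unfolding line_part_def[abs_def] by (intro AC_imp_continuous_on AC_indefinite_integral absolutely_integrable_\<pi>)

lemma absolutely_integrable_kernel_component: "(\<lambda>t. \<eta> t - \<pi> (\<eta> t) *\<^sub>R e) absolutely_integrable_on {0..1}"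
  by (intro set_integral_diff \<eta> absolutely_integrable_bounded_linear[OF absolutely_integrable_\<pi> bounded_linear_scaleR_left])

lemma absolutely_integrable_kernel_part: "kernel_part \<eta> absolutely_integrable_on {0..1}"
  unfolding kernel_part_def[abs_def]
  by (intro absolutely_integrable_Ad absolutely_integrable_kernel_component continuous_intros continuous_on_line_part)

lemma velocity_trajectory: "velocity (trajectory \<eta>) \<eta>"
proof -
  have 1: "velocity (kernel_primitive (kernel_part \<eta>)) (kernel_part \<eta>)"
    by (rule velocity_kernel_primitive[OF absolutely_integrable_kernel_part \<pi>_kernel_part])
  have 2: "velocity (\<lambda>t. line_part \<eta> t *\<^sub>R e) (\<lambda>t. \<pi> (\<eta> t) *\<^sub>R e)"
    using velocity_ray_integral[OF absolutely_integrable_\<pi>, of 0 e] by (simp add: line_part_def)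
  show ?thesis
    using velocity_mult[OF 1 2] by (simp add: trajectory_def[abs_def] kernel_part_def)
qed

lemma endpoint_trajectory: "endpoint G \<eta> = trajectory \<eta> 1"
  by (rule endpoint_eq[OF velocity_trajectory trajectory_0])

end

text \<open>The differential of the endpoint map at the zero control is integration. The error
  consists of the effect of conjugation by the small factor along \<open>e\<close>, of the quadratic area
  term, and of the remainder of the multiplication at \<open>(0, 0)\<close>; \<open>\<epsilon>1\<close>, \<open>d\<close> and \<open>\<epsilon> / (3 * T)\<close> make
  each of them at most a third of the bound.\<close>

lemma endpoint_first_order:
  assumes "\<epsilon> > 0"
  shows "\<exists>d>0. \<forall>\<eta>. \<eta> absolutely_integrable_on {0..1} \<longrightarrow> L1_norm \<eta> < d \<longrightarrow>
    norm (endpoint G \<eta> - integral {0..1} \<eta>) \<le> \<epsilon> * L1_norm \<eta>"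
proof -
  obtain P where P: "P > 0" "\<And>x. norm (\<pi> x) \<le> norm x * P"
    using bounded_linear.pos_bounded[OF bounded_linear_\<pi>] by blast
  obtain K where K: "K > 0" "\<And>x y. norm (lie_bracket G x y) \<le> norm x * norm y * K"
    using bounded_bilinear.pos_bounded[OF bounded_bilinear_bracket] by blast
  define C where "C = 1 + P * norm e"
  have C: "C > 0" "C \<ge> 1" using P(1) by (simp_all add: C_def add_pos_nonneg)
  have hor: "norm (x - \<pi> x *\<^sub>R e) \<le> C * norm x" for x
  proof -
    have "norm (x - \<pi> x *\<^sub>R e) \<le> norm x + norm (\<pi> x) * norm e" using norm_triangle_ineq4[of x "\<pi> x *\<^sub>R e"] by simp
    also have "\<dots> \<le> norm x + (norm x * P) * norm e" using P(2) by (intro add_left_mono mult_right_mono) auto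
    finally show ?thesis by (simp add: C_def algebra_simps)
  qed
  define A where "A = 2 * C + 2 * K * C\<^sup>2"
  define T where "T = A + P * norm e + 1"
  have A: "A > 0" using C K by (simp add: A_def add_pos_pos)
  have T: "T > 0" using A P(1) by (simp add: T_def add_pos_nonneg)
  define \<epsilon>1 where "\<epsilon>1 = min 1 (\<epsilon> / (3 * C))"
  have \<epsilon>1: "\<epsilon>1 > 0" "\<epsilon>1 \<le> 1" "\<epsilon>1 * C \<le> \<epsilon> / 3" using assms C by (auto simp: \<epsilon>1_def min_def field_simps)
  obtain d1 where d1: "d1 > 0" "\<And>s v. \<bar>s\<bar> < d1 \<Longrightarrow> norm (Ad (s *\<^sub>R e) v - v) \<le> \<epsilon>1 * norm v"
    using Ad_ray_near_identity[OF \<epsilon>1(1), of e] by blast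
  have "\<epsilon> / (3 * T) > 0" using assms T by simp
  then obtain d2 where d2: "d2 > 0" "\<And>a b. norm a < d2 \<Longrightarrow> norm b < d2 \<Longrightarrow> norm (a \<otimes> b - a - b) \<le> \<epsilon> / (3 * T) * (norm a + norm b)"
    using mult_near_0 by blast
  define d where "d = min (min (d1 / P) (d2 / T)) (min 1 (\<epsilon> / (6 * K * C\<^sup>2)))"
  have d: "d > 0" using d1 d2 P T K C assms by (simp add: d_def)
  have "norm (endpoint G \<eta> - integral {0..1} \<eta>) \<le> \<epsilon> * L1_norm \<eta>"
    if \<eta>: "\<eta> absolutely_integrable_on {0..1}" and small: "L1_norm \<eta> < d" for \<eta>
  proof -
    define n where "n = L1_norm \<eta>"
    have n: "n \<ge> 0" by (simp add: n_def L1_norm_nonneg)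
    have nd: "n < d1 / P" "n < d2 / T" "n < 1" "n < \<epsilon> / (6 * K * C\<^sup>2)" using small by (simp_all add: n_def d_def)
    then have nd: "n * P < d1" "T * n < d2" "n < 1" "2 * K * C\<^sup>2 * n \<le> \<epsilon> / 3"
      using P T K C by (simp_all add: field_simps)
    have \<eta>i: "\<eta> integrable_on {0..1}" and \<eta>n: "(\<lambda>t. norm (\<eta> t)) integrable_on {0..1}"
      using \<eta> by (simp_all add: absolutely_integrable_on_def)
    have scaled: "(\<lambda>t. c * norm (\<eta> t)) integrable_on {0..1}" "integral {0..1} (\<lambda>t. c * norm (\<eta> t)) = c * n" for c
      using integrable_cmul[OF \<eta>n, of c] by (simp_all add: n_def L1_norm_def)
    define h where "h = (\<lambda>t. \<eta> t - \<pi> (\<eta> t) *\<^sub>R e)"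
    define z where "z = kernel_part \<eta>"
    have za: "z absolutely_integrable_on {0..1}" unfolding z_def by (rule absolutely_integrable_kernel_part[OF \<eta>])
    have zi: "z integrable_on {0..1}" using za by (simp add: absolutely_integrable_on_def)
    have hi: "h integrable_on {0..1}"
      using absolutely_integrable_kernel_component[OF \<eta>] by (simp add: h_def absolutely_integrable_on_def)
    have \<pi>i: "(\<lambda>t. \<pi> (\<eta> t)) integrable_on {0..1}"
      using absolutely_integrable_\<pi>[OF \<eta>] by (simp add: absolutely_integrable_on_def)
    have y: "\<bar>line_part \<eta> t\<bar> \<le> P * n" if "t \<in> {0..1}" for t
    proof -
      have "norm (integral {0..t} (\<lambda>t. \<pi> (\<eta> t))) \<le> integral {0..1} (\<lambda>t. P * norm (\<eta> t))"
        by (rule norm_integral_le_integral[OF \<pi>i scaled(1) _ that]) (use P(2) in \<open>simp add: mult.commute\<close>)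
      then show ?thesis unfolding scaled(2) by (simp add: line_part_def)
    qed
    have zh: "norm (z t - h t) \<le> \<epsilon>1 * C * norm (\<eta> t)" if "t \<in> {0..1}" for t
    proof -
      have "\<bar>line_part \<eta> t\<bar> < d1" using y[OF that] nd(1) by (simp add: mult.commute)
      then have "norm (z t - h t) \<le> \<epsilon>1 * norm (h t)"
        unfolding z_def kernel_part_def h_def by (rule d1(2))
      also have "\<dots> \<le> \<epsilon>1 * (C * norm (\<eta> t))" unfolding h_def using \<epsilon>1(1) hor by (intro mult_left_mono) auto
      finally show ?thesis by (simp add: mult.assoc)
    qed
    have zb: "norm (z t) \<le> 2 * C * norm (\<eta> t)" if "t \<in> {0..1}" for t
    proof -
      have "norm (z t) \<le> norm (h t) + norm (z t - h t)" by (rule norm_triangle_sub)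
      also have "\<dots> \<le> C * norm (\<eta> t) + \<epsilon>1 * C * norm (\<eta> t)"
        using zh[OF that] hor[of "\<eta> t"] by (simp add: h_def)
      also have "\<dots> \<le> C * norm (\<eta> t) + 1 * C * norm (\<eta> t)"
        using \<epsilon>1(2) C(1) by (intro add_left_mono mult_right_mono) auto
      finally show ?thesis by simp
    qed
    have w0: "norm (integral {0..t} z) \<le> 2 * C * n" if "t \<in> {0..1}" for t
      using norm_integral_le_integral[OF zi scaled(1) zb that] unfolding scaled(2) .
    define c where "c = (\<lambda>r. lie_bracket G (integral {0..r} z) (z r))"
    have ci: "c integrable_on {0..1}"
      using absolutely_integrable_bracket_primitive[OF za] by (simp add: c_def absolutely_integrable_on_def)
    have "norm (integral {0..1} c) \<le> integral {0..1} (\<lambda>t. (4 * C\<^sup>2 * K * n) * norm (\<eta> t))"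
    proof (rule norm_integral_le_integral[OF ci scaled(1)])
      fix r :: real assume r: "r \<in> {0..1}"
      have "norm (c r) \<le> norm (integral {0..r} z) * norm (z r) * K" unfolding c_def by (rule K(2))
      also have "\<dots> \<le> (2 * C * n) * (2 * C * norm (\<eta> r)) * K"
        using w0[OF r] zb[OF r] K(1) C(1) n by (intro mult_right_mono mult_mono) auto
      finally show "norm (c r) \<le> (4 * C\<^sup>2 * K * n) * norm (\<eta> r)" by (simp add: power2_eq_square algebra_simps)
    qed simp
    then have cn: "norm (integral {0..1} c) \<le> 4 * C\<^sup>2 * K * n * n" unfolding scaled(2) .
    define w where "w = kernel_primitive z 1"
    have w: "w = integral {0..1} z + (1/2) *\<^sub>R integral {0..1} c" by (simp add: w_def kernel_primitive_def c_def)
    have "norm w \<le> 2 * C * n + (1/2) * (4 * C\<^sup>2 * K * n * n)"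
    proof -
      have "norm ((1/2) *\<^sub>R integral {0..1} c) = (1/2) * norm (integral {0..1} c)" by simp
      moreover have "norm (integral {0..1} z) \<le> 2 * C * n" by (rule w0) simp
      ultimately show ?thesis
        unfolding w using cn norm_triangle_ineq[of "integral {0..1} z" "(1/2) *\<^sub>R integral {0..1} c"] by linarith
    qed
    also have "\<dots> = 2 * C * n + 2 * K * C\<^sup>2 * n * n" by simp
    also have "\<dots> \<le> 2 * C * n + 2 * K * C\<^sup>2 * n * 1"
      using nd(3) n K(1) by (intro add_left_mono mult_left_mono) auto
    finally have wA: "norm w \<le> A * n" by (simp add: A_def algebra_simps)
    define b where "b = line_part \<eta> 1 *\<^sub>R e"
    have bn: "norm b \<le> P * norm e * n"
      using mult_right_mono[OF y[of 1], of "norm e"] by (simp add: b_def algebra_simps)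
    have An: "A * n \<le> T * n" "P * norm e * n \<le> T * n" using n A P(1) by (auto simp: T_def intro!: mult_right_mono)
    have "norm (w \<otimes> b - w - b) \<le> \<epsilon> / (3 * T) * (norm w + norm b)"
      by (rule d2(2)) (use wA bn An nd(2) in linarith)+
    also have "\<dots> \<le> \<epsilon> / (3 * T) * (A * n + P * norm e * n)"
      using wA bn assms T by (intro mult_left_mono add_mono) auto
    also have "\<dots> \<le> \<epsilon> / (3 * T) * (T * n)"
      using n assms T by (intro mult_left_mono) (auto simp: T_def algebra_simps)
    also have "\<dots> = \<epsilon> / 3 * n" using T by simp
    finally have 1: "norm (w \<otimes> b - w - b) \<le> \<epsilon> / 3 * n" .
    have "norm (integral {0..1} (\<lambda>t. z t - h t)) \<le> integral {0..1} (\<lambda>t. (\<epsilon>1 * C) * norm (\<eta> t))"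
      by (rule norm_integral_le_integral[OF integrable_diff[OF zi hi] scaled(1)]) (use zh in auto)
    also have "\<dots> = \<epsilon>1 * C * n" by (rule scaled(2))
    also have "\<dots> \<le> \<epsilon> / 3 * n" using \<epsilon>1(3) n by (intro mult_right_mono) auto
    finally have 2: "norm (integral {0..1} z - integral {0..1} h) \<le> \<epsilon> / 3 * n"
      by (simp add: integral_diff[OF zi hi])
    have "norm ((1/2) *\<^sub>R integral {0..1} c) \<le> (2 * K * C\<^sup>2 * n) * n" using cn by (simp add: algebra_simps)
    also have "\<dots> \<le> \<epsilon> / 3 * n" using nd(4) n by (intro mult_right_mono) auto
    finally have 3: "norm ((1/2) *\<^sub>R integral {0..1} c) \<le> \<epsilon> / 3 * n" .
    have "integral {0..1} h = integral {0..1} \<eta> - b"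
      unfolding h_def b_def line_part_def
      by (subst integral_diff[OF \<eta>i integrable_linear[OF \<pi>i bounded_linear_scaleR_left, unfolded o_def]])
        (simp add: integral_bounded_linear[OF \<pi>i bounded_linear_scaleR_left])
    then have "endpoint G \<eta> - integral {0..1} \<eta> = (w \<otimes> b - w - b) + ((integral {0..1} z - integral {0..1} h) + (1/2) *\<^sub>R integral {0..1} c)"
      unfolding endpoint_trajectory[OF \<eta>] by (simp add: trajectory_def z_def[symmetric] w_def[symmetric] b_def[symmetric]) (simp add: w)
    also have "norm \<dots> \<le> \<epsilon> / 3 * n + (\<epsilon> / 3 * n + \<epsilon> / 3 * n)"
      by (intro order.trans[OF norm_triangle_ineq] add_mono 1 2 3)
    finally show ?thesis by (simp add: n_def)
  qed
  with d show ?thesis by blast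
qed

end

section \<open>The differential of the endpoint map\<close>

lemma absolutely_integrable_norm_integrable:
  fixes v :: "'a::euclidean_space \<Rightarrow> 'b::euclidean_space"
  shows
    "v absolutely_integrable_on S \<Longrightarrow> (\<lambda>t. norm (v t)) integrable_on S"
  by (simp add: absolutely_integrable_on_def)

context two_step_by_line begin

text \<open>By the perturbation identity the endpoint of \<open>u + v\<close> is \<open>E \<otimes> \<gamma> 1\<close>, where \<open>E\<close> is the
  endpoint of the control \<open>Ad (\<gamma> t) (v t)\<close>, and \<open>E\<close> equals the integral of that control to first
  order.\<close>

lemma endpoint_has_L1_differential:
  assumes V: "subspace V" and u: "u \<in> controls V" and \<gamma>: "velocity \<gamma> u" "\<gamma> 0 = 0"
  shows "has_L1_differential V (endpoint G)
    (\<lambda>v. right_diff (\<gamma> 1) (integral {0..1} (\<lambda>t. Ad (\<gamma> t) (v t)))) u"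
proof -
  define I where "I v = integral {0..1} (\<lambda>t. Ad (\<gamma> t) (v t))" for v
  have cont: "continuous_on {0..1} \<gamma>" by (rule velocity_imp_continuous[OF \<gamma>(1)])
  have abs: "v absolutely_integrable_on {0..1}" if "v \<in> controls V" for v using that by (simp add: controls_def)
  have Adi: "(\<lambda>t. Ad (\<gamma> t) (v t)) absolutely_integrable_on {0..1}" if "v \<in> controls V" for v
    by (rule absolutely_integrable_Ad[OF cont abs[OF that]])
  have Adi': "(\<lambda>t. Ad (\<gamma> t) (v t)) integrable_on {0..1}" if "v \<in> controls V" for v
    using Adi[OF that] by (simp add: absolutely_integrable_on_def)
  obtain B where B: "B > 0" "\<And>t v. t \<in> {0..1} \<Longrightarrow> norm (Ad (\<gamma> t) v) \<le> B * norm v"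
    using Ad_bounded_along_curve[OF cont] by blast
  obtain R where R: "R > 0" "\<And>x. norm (right_diff (\<gamma> 1) x) \<le> norm x * R"
    using bounded_linear.pos_bounded linear_right_diff linear_conv_bounded_linear by blast
  have Bn: "(\<lambda>t. B * norm (v t)) integrable_on {0..1}" "integral {0..1} (\<lambda>t. B * norm (v t)) = B * L1_norm v"
    if "v \<in> controls V" for v
    using integrable_cmul[OF absolutely_integrable_norm_integrable[OF abs[OF that]], of B] by (simp_all add: L1_norm_def)
  have IB: "norm (I v) \<le> B * L1_norm v" if v: "v \<in> controls V" for v
    using norm_integral_le_integral[OF Adi'[OF v] Bn(1)[OF v] B(2), of 1] unfolding I_def Bn(2)[OF v] by simp
  have LB: "L1_norm (\<lambda>t. Ad (\<gamma> t) (v t)) \<le> B * L1_norm v" if v: "v \<in> controls V" for v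
  proof -
    have "L1_norm (\<lambda>t. Ad (\<gamma> t) (v t)) \<le> integral {0..1} (\<lambda>t. B * norm (v t))"
      unfolding L1_norm_def
      by (rule integral_le[OF absolutely_integrable_norm_integrable[OF Adi[OF v]] Bn(1)[OF v]]) (rule B(2))
    then show ?thesis unfolding Bn(2)[OF v] .
  qed
  have lin: "I (\<lambda>t. a *\<^sub>R v t + b *\<^sub>R w t) = a *\<^sub>R I v + b *\<^sub>R I w" if "v \<in> controls V" "w \<in> controls V" for v w a b
  proof -
    have "I (\<lambda>t. a *\<^sub>R v t + b *\<^sub>R w t) = integral {0..1} (\<lambda>t. a *\<^sub>R Ad (\<gamma> t) (v t) + b *\<^sub>R Ad (\<gamma> t) (w t))"
      unfolding I_def by (simp add: linear_add[OF linear_Ad] Ad_scaleR)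
    also have "\<dots> = integral {0..1} (\<lambda>t. a *\<^sub>R Ad (\<gamma> t) (v t)) + integral {0..1} (\<lambda>t. b *\<^sub>R Ad (\<gamma> t) (w t))"
      by (intro integral_add integrable_cmul Adi' that)
    finally show ?thesis by (simp add: I_def)
  qed
  have first: "\<exists>d>0. \<forall>v\<in>controls V. L1_norm v < d \<longrightarrow>
        norm (endpoint G (\<lambda>t. u t + v t) - endpoint G u - right_diff (\<gamma> 1) (I v)) \<le> \<epsilon> * L1_norm v"
    if \<epsilon>: "\<epsilon> > 0" for \<epsilon>
  proof -
    define \<epsilon>1 where "\<epsilon>1 = \<epsilon> / (4 * B)"
    have \<epsilon>1: "\<epsilon>1 > 0" using \<epsilon> B by (simp add: \<epsilon>1_def)
    have "((\<lambda>y. y \<otimes> \<gamma> 1) has_derivative right_diff (\<gamma> 1)) (at 0 within UNIV)" using has_derivative_right_mult by simp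
    then obtain d1 where d1: "d1 > 0" "\<And>y. norm (y - 0) < d1 \<Longrightarrow>
        norm (y \<otimes> \<gamma> 1 - 0 \<otimes> \<gamma> 1 - right_diff (\<gamma> 1) (y - 0)) \<le> \<epsilon>1 * norm (y - 0)"
      using \<epsilon>1 unfolding has_derivative_within_alt by blast
    define \<epsilon>2 where "\<epsilon>2 = min 1 (\<epsilon> / (2 * R * B))"
    have \<epsilon>2: "\<epsilon>2 > 0" "\<epsilon>2 \<le> 1" "\<epsilon>2 * (R * B) \<le> \<epsilon> / 2"
    proof -
      show "\<epsilon>2 > 0" "\<epsilon>2 \<le> 1" using \<epsilon> R B by (simp_all add: \<epsilon>2_def)
      have "\<epsilon>2 * (R * B) \<le> \<epsilon> / (2 * R * B) * (R * B)" using R B by (intro mult_right_mono) (auto simp: \<epsilon>2_def)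
      also have "\<dots> = \<epsilon> / 2" using R B by simp
      finally show "\<epsilon>2 * (R * B) \<le> \<epsilon> / 2" .
    qed
    obtain d2 where d2: "d2 > 0" "\<And>\<eta>. \<eta> absolutely_integrable_on {0..1} \<Longrightarrow> L1_norm \<eta> < d2 \<Longrightarrow>
        norm (endpoint G \<eta> - integral {0..1} \<eta>) \<le> \<epsilon>2 * L1_norm \<eta>"
      using endpoint_first_order[OF \<epsilon>2(1)] by blast
    define d where "d = min (d1 / (2 * B)) (d2 / B)"
    have d: "d > 0" using d1 d2 B by (simp add: d_def)
    have "norm (endpoint G (\<lambda>t. u t + v t) - endpoint G u - right_diff (\<gamma> 1) (I v)) \<le> \<epsilon> * L1_norm v"
      if v: "v \<in> controls V" and small: "L1_norm v < d" for v
    proof -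
      define n where "n = L1_norm v"
      have n: "n \<ge> 0" by (simp add: n_def L1_norm_nonneg)
      have nd: "2 * B * n < d1" "B * n < d2" using small B by (simp_all add: n_def d_def field_simps)
      define \<eta> where "\<eta> = (\<lambda>t. Ad (\<gamma> t) (v t))"
      have \<eta>: "\<eta> absolutely_integrable_on {0..1}" unfolding \<eta>_def by (rule Adi[OF v])
      define E where "E = endpoint G \<eta>"
      have E: "E = trajectory \<eta> 1" unfolding E_def by (rule endpoint_trajectory[OF \<eta>])
      have vel: "velocity (\<lambda>t. trajectory \<eta> t \<otimes> \<gamma> t) (\<lambda>t. u t + v t)"
        by (rule velocity_perturbation[OF \<gamma>(1)]) (use velocity_trajectory[OF \<eta>] in \<open>simp add: \<eta>_def\<close>)
      have F: "endpoint G (\<lambda>t. u t + v t) = E \<otimes> \<gamma> 1"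
        using endpoint_eq[OF vel] by (simp add: trajectory_0 \<gamma>(2) E)
      have Fu: "endpoint G u = \<gamma> 1" by (rule endpoint_eq[OF \<gamma>])
      have L\<eta>: "L1_norm \<eta> \<le> B * n" unfolding \<eta>_def n_def by (rule LB[OF v])
      have "norm (E - I v) \<le> \<epsilon>2 * L1_norm \<eta>"
        using d2(2)[OF \<eta>] L\<eta> nd(2) by (simp add: E_def I_def \<eta>_def)
      also have "\<dots> \<le> \<epsilon>2 * (B * n)" using L\<eta> \<epsilon>2(1) by simp
      finally have EI: "norm (E - I v) \<le> \<epsilon>2 * (B * n)" .
      also have "\<dots> \<le> 1 * (B * n)" using \<epsilon>2(2) B(1) n by (intro mult_right_mono) auto
      finally have "norm E \<le> B * n + B * n"
        using IB[OF v] norm_triangle_sub[of E "I v"] by (simp add: n_def)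
      then have EB: "norm E \<le> 2 * B * n" by simp
      then have "norm (E \<otimes> \<gamma> 1 - \<gamma> 1 - right_diff (\<gamma> 1) E) \<le> \<epsilon>1 * norm E"
        using d1(2)[of E] nd(1) by simp
      also have "\<dots> \<le> \<epsilon>1 * (2 * B * n)" using EB \<epsilon>1 by simp
      also have "\<dots> = \<epsilon> / 2 * n" using B by (simp add: \<epsilon>1_def)
      finally have 1: "norm (E \<otimes> \<gamma> 1 - \<gamma> 1 - right_diff (\<gamma> 1) E) \<le> \<epsilon> / 2 * n" .
      have "norm (right_diff (\<gamma> 1) (E - I v)) \<le> norm (E - I v) * R" by (rule R(2))
      also have "\<dots> \<le> \<epsilon>2 * (B * n) * R" using EI R(1) by (intro mult_right_mono) auto
      also have "\<dots> = \<epsilon>2 * (R * B) * n" by simp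
      also have "\<dots> \<le> \<epsilon> / 2 * n" using \<epsilon>2(3) n by (intro mult_right_mono) auto
      finally have 2: "norm (right_diff (\<gamma> 1) (E - I v)) \<le> \<epsilon> / 2 * n" .
      have "endpoint G (\<lambda>t. u t + v t) - endpoint G u - right_diff (\<gamma> 1) (I v)
          = (E \<otimes> \<gamma> 1 - \<gamma> 1 - right_diff (\<gamma> 1) E) + right_diff (\<gamma> 1) (E - I v)"
        by (simp add: F Fu linear_diff[OF linear_right_diff])
      also have "norm \<dots> \<le> \<epsilon> / 2 * n + \<epsilon> / 2 * n"
        by (intro order.trans[OF norm_triangle_ineq] add_mono 1 2)
      finally show ?thesis by (simp add: n_def)
    qed
    with d show ?thesis by blast
  qed
  show ?thesis
    unfolding has_L1_differential_def I_def[symmetric]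
  proof (intro conjI allI impI ballI)
    show "right_diff (\<gamma> 1) (I (\<lambda>t. a *\<^sub>R v t + b *\<^sub>R w t)) = a *\<^sub>R right_diff (\<gamma> 1) (I v) + b *\<^sub>R right_diff (\<gamma> 1) (I w)"
      if "v \<in> controls V" "w \<in> controls V" for v w a b
      by (simp add: lin[OF that] linear_add[OF linear_right_diff] linear_cmul[OF linear_right_diff])
    have "norm (right_diff (\<gamma> 1) (I v)) \<le> B * R * L1_norm v" if "v \<in> controls V" for v
    proof -
      have "norm (right_diff (\<gamma> 1) (I v)) \<le> (B * L1_norm v) * R"
        using R(2)[of "I v"] mult_right_mono[OF IB[OF that], of R] R(1) by linarith
      then show ?thesis by (simp only: mult.assoc mult.commute[of R])
    qed
    then show "\<exists>C. \<forall>v\<in>controls V. norm (right_diff (\<gamma> 1) (I v)) \<le> C * L1_norm v" by blast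
  qed (use first in blast)
qed

text \<open>The image of the differential is a linear subspace, so it is proper iff some covector \<open>l\<close>
  annihilates it. Testing with the control \<open>\<phi> t *\<^sub>R X\<close>, where \<open>\<phi> t = l \<bullet> Ad (\<gamma> t) X\<close>, localises
  this condition at every time.\<close>

lemma singular_control_iff:
  assumes V: "subspace V" and u: "u \<in> controls V" and \<gamma>: "velocity \<gamma> u" "\<gamma> 0 = 0"
  shows "singular_control G V u \<longleftrightarrow> (\<exists>l. l \<noteq> 0 \<and> (\<forall>t\<in>{0..1}. \<forall>X\<in>V. l \<bullet> Ad (\<gamma> t) X = 0))"
proof -
  define I where "I v = integral {0..1} (\<lambda>t. Ad (\<gamma> t) (v t))" for v
  define D where "D v = right_diff (\<gamma> 1) (I v)" for v
  have D: "has_L1_differential V (endpoint G) D u"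
    unfolding D_def[abs_def] I_def by (rule endpoint_has_L1_differential[OF V u \<gamma>])
  have cont: "continuous_on {0..1} \<gamma>" by (rule velocity_imp_continuous[OF \<gamma>(1)])
  have Adi: "(\<lambda>t. Ad (\<gamma> t) (v t)) integrable_on {0..1}" if "v \<in> controls V" for v
    using absolutely_integrable_Ad[OF cont, of v] that by (simp add: controls_def absolutely_integrable_on_def)
  have lI: "l \<bullet> I v = integral {0..1} (\<lambda>t. l \<bullet> Ad (\<gamma> t) (v t))" if "v \<in> controls V" for l v
    unfolding I_def by (rule integral_bounded_linear[OF Adi[OF that] bounded_linear_inner_right, symmetric])
  show ?thesis
  proof
    assume "singular_control G V u"
    then obtain D' where D': "has_L1_differential V (endpoint G) D' u" "D' ` controls V \<noteq> UNIV"
      by (auto simp: singular_control_def)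
    have "D' ` controls V = D ` controls V"
      by (rule image_cong[OF refl]) (rule L1_differential_unique[OF D'(1) D V])
    then have "right_diff (\<gamma> 1) ` (I ` controls V) \<noteq> UNIV" using D'(2) by (simp add: D_def image_image)
    then have ne: "I ` controls V \<noteq> UNIV" using bij_is_surj[OF bij_right_diff, of "\<gamma> 1"] by metis
    have "subspace (I ` controls V)"
    proof -
      have "(\<lambda>t. 0) \<in> controls V" using subspace_0[OF V] by (simp add: controls_def)
      moreover have I0: "I (\<lambda>t. 0) = 0" by (simp add: I_def linear_0[OF linear_Ad])
      ultimately have "0 \<in> I ` controls V" by (metis image_eqI)
      moreover have "a *\<^sub>R x + b *\<^sub>R y \<in> I ` controls V" if xy: "x \<in> I ` controls V" "y \<in> I ` controls V" for x y a b
      proof -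
        obtain v w where vw: "v \<in> controls V" "w \<in> controls V" "x = I v" "y = I w" using xy by blast
        have eq: "I (\<lambda>t. a *\<^sub>R v t + b *\<^sub>R w t) = a *\<^sub>R x + b *\<^sub>R y"
        proof -
          have "I (\<lambda>t. a *\<^sub>R v t + b *\<^sub>R w t) = integral {0..1} (\<lambda>t. a *\<^sub>R Ad (\<gamma> t) (v t) + b *\<^sub>R Ad (\<gamma> t) (w t))"
            unfolding I_def by (simp add: linear_add[OF linear_Ad] Ad_scaleR)
          also have "\<dots> = integral {0..1} (\<lambda>t. a *\<^sub>R Ad (\<gamma> t) (v t)) + integral {0..1} (\<lambda>t. b *\<^sub>R Ad (\<gamma> t) (w t))"
            by (intro integral_add integrable_cmul Adi vw)
          finally show ?thesis by (simp add: I_def vw)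
        qed
        show ?thesis using imageI[OF controls_combination[OF V vw(1,2), of a b], of I] unfolding eq .
      qed
      note comb = this
      ultimately show ?thesis
        unfolding subspace_def using comb[of _ _ 1 1] comb[of _ _ _ 0] by simp
    qed
    then have "span (I ` controls V) \<noteq> UNIV" using ne by (simp add: span_eq_iff[THEN iffD2])
    then obtain l where l: "l \<noteq> 0" "\<forall>x\<in>span (I ` controls V). l \<bullet> x = 0"
      using span_not_UNIV_orthogonal by blast
    have "l \<bullet> Ad (\<gamma> t) X = 0" if t: "t \<in> {0..1}" and X: "X \<in> V" for t X
    proof -
      define \<phi> where "\<phi> = (\<lambda>t. l \<bullet> Ad (\<gamma> t) X)"
      have c\<phi>: "continuous_on {0..1} \<phi>"
        unfolding \<phi>_def by (intro continuous_intros continuous_on_Ad cont)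
      \<comment> \<open>Against this control the covector yields the integral of the square of \<open>\<phi>\<close>.\<close>
      define v where "v = (\<lambda>t. \<phi> t *\<^sub>R X)"
      have v: "v \<in> controls V"
        unfolding controls_def v_def using subspace_mul[OF V X] c\<phi>
        by (auto intro!: absolutely_integrable_continuous_real continuous_intros)
      have "integral {0..1} (\<lambda>t. \<phi> t * \<phi> t) = l \<bullet> I v"
        unfolding lI[OF v] by (simp add: v_def Ad_scaleR \<phi>_def)
      also have "\<dots> = 0" using l(2) v by (meson image_eqI span_base)
      finally have "integral {0..1} (\<lambda>t. \<phi> t * \<phi> t) = 0" .
      moreover have "continuous_on {0..1} (\<lambda>t. \<phi> t * \<phi> t)" by (intro continuous_intros c\<phi>)
      ultimately have "\<phi> t * \<phi> t = 0"
        using integral_eq_0_iff[of 0 1 "\<lambda>t. \<phi> t * \<phi> t"] t by simp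
      then show ?thesis by (simp add: \<phi>_def)
    qed
    with l(1) show "\<exists>l. l \<noteq> 0 \<and> (\<forall>t\<in>{0..1}. \<forall>X\<in>V. l \<bullet> Ad (\<gamma> t) X = 0)" by blast
  next
    assume "\<exists>l. l \<noteq> 0 \<and> (\<forall>t\<in>{0..1}. \<forall>X\<in>V. l \<bullet> Ad (\<gamma> t) X = 0)"
    then obtain l where l: "l \<noteq> 0" "\<And>t X. t \<in> {0..1} \<Longrightarrow> X \<in> V \<Longrightarrow> l \<bullet> Ad (\<gamma> t) X = 0" by blast
    have "right_diff (\<gamma> 1) l \<notin> D ` controls V"
    proof
      assume "right_diff (\<gamma> 1) l \<in> D ` controls V"
      then obtain v where v: "v \<in> controls V" "right_diff (\<gamma> 1) l = right_diff (\<gamma> 1) (I v)" by (auto simp: D_def)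
      then have lv: "l = I v" using injD[OF bij_is_inj[OF bij_right_diff]] by blast
      have "l \<bullet> I v = integral {0..1} (\<lambda>t::real. 0)"
        unfolding lI[OF v(1)] by (rule integral_cong) (use l(2) v(1) in \<open>auto simp: controls_def\<close>)
      then show False using l(1) lv by simp
    qed
    then have "D ` controls V \<noteq> UNIV" by blast
    with u D show "singular_control G V u" unfolding singular_control_def by blast
  qed
qed

lemma abnormal_set_eq:
  assumes V: "subspace V"
  shows "abnormal_set G V = {\<gamma> 1 |\<gamma> u l. u \<in> controls V \<and> velocity \<gamma> u \<and> \<gamma> 0 = 0 \<and> l \<noteq> 0 \<and>
    (\<forall>t\<in>{0..1}. \<forall>X\<in>V. l \<bullet> Ad (\<gamma> t) X = 0)}" (is "_ = ?R")
proof
  show "abnormal_set G V \<subseteq> ?R"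
  proof
    fix x assume "x \<in> abnormal_set G V"
    then obtain u where u: "singular_control G V u" "x = endpoint G u" by (auto simp: abnormal_set_def)
    then have uc: "u \<in> controls V" by (simp add: singular_control_def)
    then have ua: "u absolutely_integrable_on {0..1}" by (simp add: controls_def)
    note vel = velocity_trajectory[OF ua] trajectory_0[of u]
    obtain l where "l \<noteq> 0" "\<forall>t\<in>{0..1}. \<forall>X\<in>V. l \<bullet> Ad (trajectory u t) X = 0"
      using u(1) singular_control_iff[OF V uc vel] by blast
    with uc vel u(2) endpoint_trajectory[OF ua] show "x \<in> ?R" by blast
  qed
  show "?R \<subseteq> abnormal_set G V"
  proof
    fix x assume "x \<in> ?R"
    then obtain \<gamma> u l where *: "x = \<gamma> 1" "u \<in> controls V" "velocity \<gamma> u" "\<gamma> 0 = 0" "l \<noteq> 0"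
      "\<forall>t\<in>{0..1}. \<forall>X\<in>V. l \<bullet> Ad (\<gamma> t) X = 0" by blast
    then have "singular_control G V u" using singular_control_iff[OF V *(2,3,4)] by blast
    moreover have "endpoint G u = x" using endpoint_eq[OF *(3,4)] *(1) by simp
    ultimately show "x \<in> abnormal_set G V" by (auto simp: abnormal_set_def)
  qed
qed

end

section \<open>Polynomial dependence of products on their factors\<close>

lemma has_integral_power_scaleR:
  fixes a :: "'a::euclidean_space"
  assumes "0 \<le> r"
  shows "((\<lambda>t. (c * t ^ n) *\<^sub>R a) has_integral (c * (r ^ (n+1) / real (n+1))) *\<^sub>R a) {0..r}"
proof -
  have "((\<lambda>t. t ^ n) has_integral (r ^ (n+1) / real (n+1) - 0 ^ (n+1) / real (n+1))) {0..r}"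
  proof (rule fundamental_theorem_of_calculus[OF assms])
    fix t :: real
    have "((\<lambda>t. t ^ (n+1) / real (n+1)) has_real_derivative (real (n+1) * t ^ n / real (n+1))) (at t within {0..r})"
      by (rule derivative_eq_intros refl | simp)+
    then show "((\<lambda>t. t ^ (n+1) / real (n+1)) has_vector_derivative t ^ n) (at t within {0..r})"
      by (simp add: has_real_derivative_iff_has_vector_derivative del: of_nat_Suc of_nat_add)
  qed
  then have "((\<lambda>t. t ^ n) has_integral r ^ (n+1) / real (n+1)) {0..r}" by simp
  from has_integral_scaleR_left[OF has_integral_mult_right[OF this, of c]] show ?thesis .
qed

lemma polynomial_function_linear_compose:
  fixes h :: "'b::euclidean_space \<Rightarrow> 'c::euclidean_space"
  assumes "linear h" "polynomial_function f"
  shows "polynomial_function (\<lambda>x. h (f x))"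
  using polynomial_function_compose[OF assms(2) polynomial_function_bounded_linear[of h]] assms(1)
  by (simp add: o_def linear_conv_bounded_linear)

context exponential_group begin

lemma polynomial_function_bracket:
  assumes f: "polynomial_function f" and h: "polynomial_function h"
  shows "polynomial_function (\<lambda>x. lie_bracket G (f x) (h x))"
proof -
  have "lie_bracket G (f x) (h x) = (\<Sum>b\<in>Basis. (f x \<bullet> b) *\<^sub>R lie_bracket G b (h x))" for x
  proof -
    have "lie_bracket G (f x) (h x) = lie_bracket G (\<Sum>b\<in>Basis. (f x \<bullet> b) *\<^sub>R b) (h x)" by (simp add: euclidean_representation)
    then show ?thesis by (simp only: linear_sum[OF linear_bracket_left] linear_cmul[OF linear_bracket_left])
  qed
  moreover have "polynomial_function (\<lambda>x. \<Sum>b\<in>Basis. (f x \<bullet> b) *\<^sub>R lie_bracket G b (h x))"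
    by (intro polynomial_function_sum polynomial_function_mult polynomial_function_inner f
        polynomial_function_linear_compose[OF linear_bracket_right h]) simp
  ultimately show ?thesis by simp
qed

end

context two_step_by_line begin

abbreviation ade :: "nat \<Rightarrow> 'a \<Rightarrow> 'a" where "ade k \<equiv> lie_bracket G e ^^ k"

text \<open>The integral over \<open>t\<close> in \<open>[0, 1]\<close> of \<open>z t = Ad ((t * b) *\<^sub>R e) v\<close>, that is, the series
  \<open>(exp A - 1) / A\<close> at \<open>A = b ad e\<close>, applied to \<open>v\<close>.\<close>

definition line_average :: "real \<Rightarrow> 'a \<Rightarrow> 'a" where
  "line_average b v = (\<Sum>k<N. (b ^ k / (fact k * real (k+1))) *\<^sub>R ade k v)"

text \<open>The integral over \<open>r\<close> in \<open>[0, 1]\<close> of the bracket of \<open>integral {0..r} z\<close> with \<open>z r\<close>, for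
  the same \<open>z\<close>.\<close>

definition bracket_average :: "real \<Rightarrow> 'a \<Rightarrow> 'a" where
  "bracket_average b v = (\<Sum>k<N. \<Sum>l<N.
    (b ^ (k + l) / (fact k * fact l * real (k+1) * real (k+l+2))) *\<^sub>R lie_bracket G (ade k v) (ade l v))"

lemma N_pos: "N > 0"
proof (rule ccontr)
  assume "\<not> N > 0"
  then have "e = 0" using bracket_e_nilpotent[of e] by simp
  then show False using \<pi>_e by simp
qed

lemma \<pi>_ade: "\<pi> v = 0 \<Longrightarrow> \<pi> (ade k v) = 0"
  by (cases k) (simp_all add: \<pi>_bracket)

text \<open>The ray through \<open>b *\<^sub>R e + v\<close> is the curve with this constant velocity, so its value at
  time \<open>1\<close> can also be computed by the two integrations that define the trajectory.\<close>

lemma exponential_splitting: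
  assumes v: "\<pi> v = 0"
  shows "b *\<^sub>R e + v = (line_average b v + (1/2) *\<^sub>R bracket_average b v) \<otimes> (b *\<^sub>R e)"
proof -
  define x where "x = b *\<^sub>R e + v"
  define \<eta> where "\<eta> = (\<lambda>t::real. x)"
  have \<pi>x: "\<pi> x = b" by (simp add: x_def \<pi>_e v)
  have \<eta>: "\<eta> absolutely_integrable_on {0..1}" unfolding \<eta>_def by (intro absolutely_integrable_continuous_real continuous_intros)
  have one: "(\<lambda>t::real. 1::real) absolutely_integrable_on {0..1}"
    by (intro absolutely_integrable_continuous_real continuous_intros)
  have "velocity (\<lambda>t. (0 + integral {0..t} (\<lambda>t. 1)) *\<^sub>R x) \<eta>"
    using velocity_ray_integral[OF one, of 0 x] by (simp add: \<eta>_def)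
  from velocity_unique[OF this velocity_trajectory[OF \<eta>], of 1]
  have traj: "x = trajectory \<eta> 1" by (simp add: trajectory_0)
  have line: "line_part \<eta> t = t * b" if "t \<ge> 0" for t
    using that by (simp add: line_part_def \<eta>_def \<pi>x)
  have kernel: "kernel_part \<eta> t = (\<Sum>k<N. (b ^ k / fact k * t ^ k) *\<^sub>R ade k v)" if "t \<ge> 0" for t
  proof -
    have "kernel_part \<eta> t = Ad ((t * b) *\<^sub>R e) v"
      unfolding kernel_part_def line[OF that] by (simp add: \<eta>_def \<pi>x) (simp add: x_def)
    also have "\<dots> = (\<Sum>k<N. ((t * b) ^ k / fact k) *\<^sub>R ade k v)" by (rule Ad_ray_nilpotent[OF bracket_e_nilpotent])
    finally show ?thesis by (simp add: power_mult_distrib mult.commute)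
  qed
  define W where "W = (\<lambda>r. \<Sum>k<N. (b ^ k / fact k * (r ^ (k+1) / real (k+1))) *\<^sub>R ade k v)"
  have W: "integral {0..r} (kernel_part \<eta>) = W r" if r: "r \<ge> 0" for r
  proof -
    have "((\<lambda>t. \<Sum>k<N. (b ^ k / fact k * t ^ k) *\<^sub>R ade k v) has_integral W r) {0..r}"
      unfolding W_def by (intro has_integral_sum has_integral_power_scaleR r) simp
    then have "(kernel_part \<eta> has_integral W r) {0..r}"
      by (rule has_integral_eq[rotated]) (simp add: kernel)
    then show ?thesis by (rule integral_unique)
  qed
  have average: "bracket_average b v = (\<Sum>k<N. \<Sum>l<N. ((b ^ (k+l) / (fact k * fact l * real (k+1))) * (1 ^ (k+l+1+1) / real (k+l+1+1))) *\<^sub>R lie_bracket G (ade k v) (ade l v))"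
    unfolding bracket_average_def by (intro sum.cong refl arg_cong2[where f = scaleR]) simp
  have "integral {0..1} (\<lambda>r. lie_bracket G (integral {0..r} (kernel_part \<eta>)) (kernel_part \<eta> r)) = bracket_average b v"
  proof (rule integral_unique, rule has_integral_eq[rotated])
    show "((\<lambda>r. \<Sum>k<N. \<Sum>l<N. ((b ^ (k+l) / (fact k * fact l * real (k+1))) * r ^ (k+l+1)) *\<^sub>R lie_bracket G (ade k v) (ade l v))
        has_integral bracket_average b v) {0..1}"
      unfolding average by (intro has_integral_sum has_integral_power_scaleR) simp_all
    show "(\<Sum>k<N. \<Sum>l<N. ((b ^ (k+l) / (fact k * fact l * real (k+1))) * r ^ (k+l+1)) *\<^sub>R lie_bracket G (ade k v) (ade l v))
        = lie_bracket G (integral {0..r} (kernel_part \<eta>)) (kernel_part \<eta> r)" if "r \<in> {0..1}" for r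
    proof -
      have r: "r \<ge> 0" using that by simp
      have "lie_bracket G (integral {0..r} (kernel_part \<eta>)) (kernel_part \<eta> r)
          = (\<Sum>k<N. (b ^ k / fact k * (r ^ (k+1) / real (k+1))) *\<^sub>R lie_bracket G (ade k v) (\<Sum>l<N. (b ^ l / fact l * r ^ l) *\<^sub>R ade l v))"
        unfolding W[OF r] kernel[OF r] W_def
        by (simp only: linear_sum[OF linear_bracket_left] linear_cmul[OF linear_bracket_left])
      also have "\<dots> = (\<Sum>k<N. \<Sum>l<N. (b ^ k / fact k * (r ^ (k+1) / real (k+1))) *\<^sub>R (b ^ l / fact l * r ^ l) *\<^sub>R lie_bracket G (ade k v) (ade l v))"
        by (simp only: linear_sum[OF linear_bracket_right] linear_cmul[OF linear_bracket_right] scaleR_sum_right)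
      also have "\<dots> = (\<Sum>k<N. \<Sum>l<N. ((b ^ (k+l) / (fact k * fact l * real (k+1))) * r ^ (k+l+1)) *\<^sub>R lie_bracket G (ade k v) (ade l v))"
        unfolding scaleR_scaleR
        by (intro sum.cong refl arg_cong2[where f = scaleR]) (simp add: power_add ac_simps)
      finally show ?thesis by simp
    qed
  qed
  moreover have "W 1 = line_average b v"
    unfolding W_def line_average_def by (intro sum.cong refl arg_cong2[where f = scaleR]) simp
  ultimately have "kernel_primitive (kernel_part \<eta>) 1 = line_average b v + (1/2) *\<^sub>R bracket_average b v"
    by (simp add: kernel_primitive_def W)
  then have "trajectory \<eta> 1 = (line_average b v + (1/2) *\<^sub>R bracket_average b v) \<otimes> (b *\<^sub>R e)"
    by (simp add: trajectory_def line)
  with traj show ?thesis by (simp add: x_def)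
qed

lemma line_average_linear: "linear (line_average b)"
  unfolding line_average_def[abs_def]
  by (intro linear_compose_sum ballI linear_compose_scale_right linear_bracket_funpow)

lemma line_average_split: "line_average b v = v + (\<Sum>k\<in>{1..<N}. (b ^ k / (fact k * real (k+1))) *\<^sub>R ade k v)"
proof -
  have "{..<N} = insert 0 {1..<N}" using N_pos by auto
  then show ?thesis by (simp add: line_average_def)
qed

text \<open>The Neumann series of the unipotent map \<open>line_average b\<close>, written as an iteration because
  this makes it evident that every iterate is polynomial in \<open>b\<close> and \<open>w\<close>.\<close>

fun line_average_inverse_approx :: "nat \<Rightarrow> real \<Rightarrow> 'a \<Rightarrow> 'a" where
  "line_average_inverse_approx 0 b w = 0"
| "line_average_inverse_approx (Suc M) b w =
     w - (line_average b (line_average_inverse_approx M b w) - line_average_inverse_approx M b w)"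

definition line_average_inverse :: "real \<Rightarrow> 'a \<Rightarrow> 'a" where
  "line_average_inverse b w = line_average_inverse_approx N b w"

text \<open>The defect of each iterate is obtained from the previous one by a map that is divisible by
  \<open>ad e\<close>, and \<open>(ad e) ^ N = 0\<close>.\<close>

lemma line_average_inverse: "line_average b (line_average_inverse b w) = w"
proof -
  define F where "F M = line_average_inverse_approx M b w" for M
  define E where "E M = F M - F (Suc M)" for M
  have E: "E M = line_average b (F M) - w" for M by (simp add: E_def F_def)
  have raise: "ade p (line_average b x - x) = 0" if "ade (Suc p) x = 0" for p x
  proof -
    have "ade p ((b ^ k / (fact k * real (k+1))) *\<^sub>R ade k x) = 0" if k: "k \<in> {1..<N}" for k
    proof -
      have "ade p (ade k x) = ade (k - 1 + Suc p) x"
        using k by (simp add: funpow_add[symmetric, unfolded o_def fun_eq_iff, rule_format] add.commute)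
      also have "\<dots> = ade (k - 1) (ade (Suc p) x)" by (simp only: funpow_add o_apply)
      also have "\<dots> = 0" unfolding \<open>ade (Suc p) x = 0\<close> by (rule linear_0[OF linear_bracket_funpow])
      finally show ?thesis by (simp only: linear_cmul[OF linear_bracket_funpow] scaleR_zero_right)
    qed
    then have "(\<Sum>k\<in>{1..<N}. ade p ((b ^ k / (fact k * real (k+1))) *\<^sub>R ade k x)) = 0" by (intro sum.neutral) blast
    moreover have "ade p (line_average b x - x) = (\<Sum>k\<in>{1..<N}. ade p ((b ^ k / (fact k * real (k+1))) *\<^sub>R ade k x))"
      unfolding line_average_split by (simp only: add_diff_cancel_left' linear_sum[OF linear_bracket_funpow])
    ultimately show ?thesis by simp
  qed
  have "M \<le> N \<Longrightarrow> ade (N - M) (E M) = 0" for M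
  proof (induction M)
    case 0 then show ?case using bracket_e_nilpotent by simp
  next
    case (Suc M)
    then have "N - M = Suc (N - Suc M)" by simp
    with Suc have "ade (Suc (N - Suc M)) (E M) = 0" by simp
    from raise[OF this] have *: "ade (N - Suc M) (line_average b (E M) - E M) = 0" .
    have "E (Suc M) = - (line_average b (E M) - E M)"
      by (simp add: E_def F_def linear_diff[OF line_average_linear])
    then show ?case using * by (simp only: linear_neg[OF linear_bracket_funpow] minus_zero)
  qed
  from this[of N] have "E N = 0" by simp
  then show ?thesis using E[of N] by (simp add: F_def line_average_inverse_def)
qed

lemma \<pi>_line_average: "\<pi> v = 0 \<Longrightarrow> \<pi> (line_average b v) = 0"
  by (simp add: line_average_def linear_sum[OF linear_\<pi>] \<pi>_ade)

lemma \<pi>_line_average_inverse: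
  assumes "\<pi> w = 0"
  shows "\<pi> (line_average_inverse b w) = 0"
proof -
  have "\<pi> (line_average_inverse_approx M b w) = 0" for M
    by (induction M) (simp_all add: assms \<pi>_line_average)
  then show ?thesis by (simp add: line_average_inverse_def)
qed

lemma bracket_average_central:
  assumes "\<pi> v = 0"
  shows "lie_bracket G x (bracket_average b v) = 0" "lie_bracket G (bracket_average b v) x = 0"
proof -
  have "lie_bracket G x (lie_bracket G (ade k v) (ade l v)) = 0" for x k l
    by (rule bracket_central) (simp_all add: \<pi>_ade assms)
  then show *: "lie_bracket G x (bracket_average b v) = 0" for x
    unfolding bracket_average_def
    by (simp add: linear_sum[OF linear_bracket_right] linear_cmul[OF linear_bracket_right])
  show "lie_bracket G (bracket_average b v) x = 0" using *[of x] lie_bracket_skew[of _ x] by simp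
qed

text \<open>The inverse of the splitting above. Correcting \<open>line_average_inverse b w\<close> by a central
  element changes neither its bracket average nor, except for that element itself, its line
  average.\<close>

lemma kernel_mult_line:
  assumes w: "\<pi> w = 0"
  shows "w \<otimes> (b *\<^sub>R e) = b *\<^sub>R e + (line_average_inverse b w - (1/2) *\<^sub>R bracket_average b (line_average_inverse b w))"
proof -
  define v0 where "v0 = line_average_inverse b w"
  define C where "C = bracket_average b v0"
  define v where "v = v0 - (1/2) *\<^sub>R C"
  have \<pi>v0: "\<pi> v0 = 0" unfolding v0_def by (rule \<pi>_line_average_inverse[OF w])
  have \<pi>C: "\<pi> C = 0" unfolding C_def bracket_average_def by (simp add: linear_sum[OF linear_\<pi>] \<pi>_bracket)
  have cent: "lie_bracket G x C = 0" "lie_bracket G C x = 0" for x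
    unfolding C_def by (rule bracket_average_central[OF \<pi>v0])+
  have adeC: "ade (Suc k) C = 0" for k
    by (induction k) (simp_all add: cent linear_0[OF linear_bracket_right])
  have adev: "\<exists>c. ade k v = ade k v0 - c *\<^sub>R C" for k
  proof (cases k)
    case 0 then show ?thesis by (intro exI[of _ "1/2"]) (simp add: v_def)
  next
    case (Suc j)
    have "ade k v = ade k v0 - (1/2) *\<^sub>R ade k C"
      unfolding v_def by (simp only: linear_diff[OF linear_bracket_funpow] linear_cmul[OF linear_bracket_funpow])
    then have "ade k v = ade k v0 - 0 *\<^sub>R C" unfolding Suc adeC by simp
    then show ?thesis by blast
  qed
  have "lie_bracket G (ade k v) (ade l v) = lie_bracket G (ade k v0) (ade l v0)" for k l
  proof -
    obtain c d where "ade k v = ade k v0 - c *\<^sub>R C" "ade l v = ade l v0 - d *\<^sub>R C" using adev by metis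
    then show ?thesis
      by (simp only: linear_diff[OF linear_bracket_left] linear_cmul[OF linear_bracket_left]
          linear_diff[OF linear_bracket_right] linear_cmul[OF linear_bracket_right] cent) simp
  qed
  then have avg: "bracket_average b v = C" by (simp add: C_def bracket_average_def)
  have "(\<Sum>k\<in>{1..<N}. (b ^ k / (fact k * real (k+1))) *\<^sub>R ade k C) = 0"
  proof (rule sum.neutral, rule ballI)
    fix k assume "k \<in> {1..<N}"
    then show "(b ^ k / (fact k * real (k+1))) *\<^sub>R ade k C = 0" using adeC[of "k - 1"] by simp
  qed
  then have TC: "line_average b C = C" unfolding line_average_split by simp
  have "line_average b v = w - (1/2) *\<^sub>R C"
    unfolding v_def by (simp add: linear_diff[OF line_average_linear] linear_cmul[OF line_average_linear] TC)
      (simp add: v0_def line_average_inverse)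
  then have "b *\<^sub>R e + v = w \<otimes> (b *\<^sub>R e)"
    using exponential_splitting[of v b] avg by (simp add: v_def \<pi>v0 \<pi>C)
  then show ?thesis by (simp add: v_def v0_def C_def)
qed

lemma polynomial_function_line_average:
  assumes "polynomial_function c" "polynomial_function f"
  shows "polynomial_function (\<lambda>x. line_average (c x) (f x))"
proof -
  have "polynomial_function (\<lambda>x. (c x ^ k / (fact k * real (k+1))) *\<^sub>R ade k (f x))" for k
    by (intro polynomial_function_mult polynomial_function_linear_compose[OF linear_bracket_funpow assms(2)])
      (use assms(1) in \<open>simp only: real_polynomial_function_eq[symmetric]\<close>, intro real_polynomial_function_divide real_polynomial_function_power)
  then show ?thesis unfolding line_average_def by (intro polynomial_function_sum) auto
qed

lemma polynomial_function_bracket_average: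
  assumes "polynomial_function c" "polynomial_function f"
  shows "polynomial_function (\<lambda>x. bracket_average (c x) (f x))"
proof -
  have "polynomial_function (\<lambda>x. (c x ^ (k+l) / (fact k * fact l * real (k+1) * real (k+l+2))) *\<^sub>R lie_bracket G (ade k (f x)) (ade l (f x)))" for k l
    by (intro polynomial_function_mult polynomial_function_bracket polynomial_function_linear_compose[OF linear_bracket_funpow assms(2)])
      (use assms(1) in \<open>simp only: real_polynomial_function_eq[symmetric]\<close>, intro real_polynomial_function_divide real_polynomial_function_power)
  then show ?thesis unfolding bracket_average_def by (intro polynomial_function_sum) auto
qed

text \<open>Hence multiplication by elements of the line is polynomial in exponential coordinates.\<close>

lemma polynomial_function_kernel_mult_line:
  assumes c: "polynomial_function c" and w: "polynomial_function w" and \<pi>w: "\<And>x. \<pi> (w x) = 0"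
  shows "polynomial_function (\<lambda>x. w x \<otimes> (c x *\<^sub>R e))"
proof -
  have "polynomial_function (\<lambda>x. line_average_inverse_approx M (c x) (w x))" for M
  proof (induction M)
    case 0 show ?case by simp
  next
    case (Suc M)
    then show ?case
      by (simp only: line_average_inverse_approx.simps)
        (intro polynomial_function_diff w polynomial_function_line_average c)
  qed
  then have "polynomial_function (\<lambda>x. line_average_inverse (c x) (w x))" unfolding line_average_inverse_def .
  then show ?thesis
    unfolding kernel_mult_line[OF \<pi>w]
    by (intro polynomial_function_add polynomial_function_diff polynomial_function_mult polynomial_function_cmul
        polynomial_function_bracket_average polynomial_function_const c)
qed

end

section \<open>Varieties isomorphic to three-space\<close>

lemma real_polynomial_function_affine_line:
  fixes f :: "'a::euclidean_space \<Rightarrow> real"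
  assumes "real_polynomial_function f"
  shows "real_polynomial_function (\<lambda>t::real. f (a + t *\<^sub>R v))"
proof -
  have "polynomial_function (\<lambda>t::real. a + t *\<^sub>R v)"
    by (intro polynomial_function_add polynomial_function_const polynomial_function_bounded_linear bounded_linear_scaleR_left)
  from real_polynomial_function_compose[OF this assms] show ?thesis by (simp add: o_def)
qed

lemma real_polynomial_function_finite_zeros:
  fixes f :: "real \<Rightarrow> real"
  assumes "real_polynomial_function f" "f t \<noteq> 0"
  shows "finite {x. f x = 0}"
proof -
  obtain c n where f: "f = (\<lambda>x. \<Sum>i\<le>n. c i * x ^ i)"
    using assms(1) real_polynomial_function_iff_sum by metis
  have "\<exists>i\<le>n. c i \<noteq> 0"
  proof (rule ccontr)
    assume "\<not> (\<exists>i\<le>n. c i \<noteq> 0)"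
    then have "f t = 0" unfolding f by (intro sum.neutral) auto
    with assms(2) show False by simp
  qed
  then show ?thesis unfolding f by (simp only: polyfun_finite_roots)
qed

text \<open>Restrict both factors to the line through \<open>a\<close> and \<open>b\<close>: a nonzero polynomial in one
  variable has finitely many zeros.\<close>

lemma real_polynomial_function_mult_eq_0:
  fixes f g :: "'a::euclidean_space \<Rightarrow> real"
  assumes f: "real_polynomial_function f" and g: "real_polynomial_function g"
    and fg: "\<And>x. f x * g x = 0" and a: "f a \<noteq> 0"
  shows "g b = 0"
proof (rule ccontr)
  assume b: "g b \<noteq> 0"
  define F where "F = (\<lambda>t. f (a + t *\<^sub>R (b - a)))"
  define H where "H = (\<lambda>t. g (a + t *\<^sub>R (b - a)))"
  have "finite {t. F t = 0}"
    by (rule real_polynomial_function_finite_zeros[of _ 0])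
      (use a in \<open>simp_all add: F_def real_polynomial_function_affine_line[OF f]\<close>)
  moreover have "finite {t. H t = 0}"
    by (rule real_polynomial_function_finite_zeros[of _ 1])
      (use b in \<open>simp_all add: H_def real_polynomial_function_affine_line[OF g]\<close>)
  moreover have "{t. F t = 0} \<union> {t. H t = 0} = UNIV" using fg by (auto simp: F_def H_def)
  ultimately have "finite (UNIV :: real set)" by (metis finite_Un)
  then show False using infinite_UNIV_char_0 by blast
qed

text \<open>Gaussian elimination: an equation \<open>j\<close> with a nonzero coefficient \<open>A p j\<close> eliminates the
  unknown \<open>p\<close>.\<close>

lemma underdetermined_system:
  fixes A :: "'i \<Rightarrow> 'j \<Rightarrow> real"
  assumes "finite J" "finite I" "card J < card I"
  shows "\<exists>c. (\<exists>i\<in>I. c i \<noteq> 0) \<and> (\<forall>j\<in>J. (\<Sum>i\<in>I. c i * A i j) = 0)"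
  using assms
proof (induction J arbitrary: I A rule: finite_induct)
  case empty
  then have "I \<noteq> {}" by auto
  then show ?case by (intro exI[of _ "\<lambda>_. 1"]) auto
next
  case (insert j J)
  show ?case
  proof (cases "\<forall>i\<in>I. A i j = 0")
    case True
    have "card J < card I" using insert by simp
    then obtain c where "\<exists>i\<in>I. c i \<noteq> 0" "\<forall>q\<in>J. (\<Sum>i\<in>I. c i * A i q) = 0"
      using insert.IH[OF insert.prems(1), of A] by blast
    moreover have "(\<Sum>i\<in>I. c i * A i j) = 0" by (rule sum.neutral) (simp add: True)
    ultimately show ?thesis by blast
  next
    case False
    then obtain p where p: "p \<in> I" "A p j \<noteq> 0" by blast
    define I' where "I' = I - {p}"
    have I: "I = insert p I'" "p \<notin> I'" "finite I'" using p insert.prems(1) by (auto simp: I'_def)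
    have "card J < card I'" using insert I by simp
    then obtain c' where c': "\<exists>i\<in>I'. c' i \<noteq> 0"
      "\<forall>q\<in>J. (\<Sum>i\<in>I'. c' i * (A i q - A i j / A p j * A p q)) = 0"
      using insert.IH[OF I(3), of "\<lambda>i q. A i q - A i j / A p j * A p q"] by blast
    define c where "c i = (if i = p then - (\<Sum>i\<in>I'. c' i * A i j) / A p j else c' i)" for i
    have sum: "(\<Sum>i\<in>I. c i * A i q) = (\<Sum>i\<in>I'. c' i * A i q) - (\<Sum>i\<in>I'. c' i * A i j) / A p j * A p q" for q
    proof -
      have "(\<Sum>i\<in>I'. c i * A i q) = (\<Sum>i\<in>I'. c' i * A i q)"
        using I(2) by (intro sum.cong) (auto simp: c_def)
      then show ?thesis unfolding I(1) using I(2,3) by (simp add: c_def)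
    qed
    have "(\<Sum>i\<in>I. c i * A i j) = 0" unfolding sum using p(2) by simp
    moreover have "(\<Sum>i\<in>I. c i * A i q) = 0" if "q \<in> J" for q
    proof -
      have "(\<Sum>i\<in>I'. c' i * A i q) - (\<Sum>i\<in>I'. c' i * A i j) / A p j * A p q
          = (\<Sum>i\<in>I'. c' i * (A i q - A i j / A p j * A p q))"
        by (simp add: right_diff_distrib sum_subtractf sum_distrib_right sum_divide_distrib mult.assoc)
      then show ?thesis unfolding sum using c'(2) that by simp
    qed
    moreover have "\<exists>i\<in>I. c i \<noteq> 0" using c'(1) I by (auto simp: c_def)
    ultimately show ?thesis by (intro exI[of _ c]) blast
  qed
qed

fun monomial :: "nat \<times> nat \<times> nat \<Rightarrow> real \<times> real \<times> real \<Rightarrow> real" where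
  "monomial (i, j, k) (x, y, z) = x ^ i * y ^ j * z ^ k"

definition cube :: "nat \<Rightarrow> (nat \<times> nat \<times> nat) set" where
  "cube D = {..D} \<times> {..D} \<times> {..D}"

text \<open>The degree in each of the three variables separately is at most \<open>D\<close>.\<close>

definition degree_at_most :: "nat \<Rightarrow> (real \<times> real \<times> real \<Rightarrow> real) \<Rightarrow> bool" where
  "degree_at_most D F \<longleftrightarrow> (\<exists>c. \<forall>v. F v = (\<Sum>q\<in>cube D. c q * monomial q v))"

lemma finite_cube [simp]: "finite (cube D)" by (simp add: cube_def)

text \<open>Collect the terms with equal exponents. The monomials may be indexed by any finite set, in
  particular by the pairs of monomials in a product.\<close>

lemma degree_at_mostI:
  assumes "finite S" "e ` S \<subseteq> cube D" "\<And>v. F v = (\<Sum>s\<in>S. a s * monomial (e s) v)"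
  shows "degree_at_most D F"
  unfolding degree_at_most_def
proof (intro exI allI)
  fix v
  have "(\<Sum>q\<in>cube D. (\<Sum>s | s \<in> S \<and> e s = q. a s) * monomial q v) = (\<Sum>q\<in>cube D. \<Sum>s | s \<in> S \<and> e s = q. a s * monomial (e s) v)"
    by (intro sum.cong refl) (simp add: sum_distrib_right)
  also have "\<dots> = (\<Sum>s\<in>S. a s * monomial (e s) v)" by (rule sum.group[OF assms(1) finite_cube assms(2)])
  finally show "F v = (\<Sum>q\<in>cube D. (\<Sum>s | s \<in> S \<and> e s = q. a s) * monomial q v)" using assms(3) by simp
qed

lemma degree_at_most_mono: "degree_at_most D F \<Longrightarrow> D \<le> D' \<Longrightarrow> degree_at_most D' F"
  unfolding degree_at_most_def[of D F]
  by (elim exE, rule degree_at_mostI[of "cube D" "\<lambda>q. q"]) (auto simp: cube_def)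

lemma degree_at_most_const: "degree_at_most 0 (\<lambda>v. c)"
  by (rule degree_at_mostI[of "{(0,0,0)}" "\<lambda>q. q" _ _ "\<lambda>q. c"]) (auto simp: cube_def)

lemma degree_at_most_linear:
  assumes "bounded_linear F"
  shows "degree_at_most 1 F"
proof (rule degree_at_mostI[of "{(1,0,0), (0,1,0), (0,0,1)}" "\<lambda>q. q" _ _
      "\<lambda>(i,j,k). F (real i, real j, real k)"])
  interpret bounded_linear F by fact
  fix v :: "real \<times> real \<times> real"
  obtain x y z where v: "v = (x, y, z)" by (cases v) auto
  have "(x, y, z) = x *\<^sub>R (1, 0, 0) + y *\<^sub>R (0, 1, 0) + z *\<^sub>R (0, 0, 1)" by simp
  then have "F (x, y, z) = x *\<^sub>R F (1, 0, 0) + y *\<^sub>R F (0, 1, 0) + z *\<^sub>R F (0, 0, 1)"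
    by (simp only: add scale)
  then show "F v = (\<Sum>q\<in>{(1,0,0), (0,1,0), (0,0,1)}. (case q of (i,j,k) \<Rightarrow> F (real i, real j, real k)) * monomial q v)"
    by (simp add: v)
qed (auto simp: cube_def)

lemma degree_at_most_add:
  assumes "degree_at_most D F" "degree_at_most D H"
  shows "degree_at_most D (\<lambda>v. F v + H v)"
proof -
  obtain c d where "\<forall>v. F v = (\<Sum>q\<in>cube D. c q * monomial q v)" "\<forall>v. H v = (\<Sum>q\<in>cube D. d q * monomial q v)"
    using assms unfolding degree_at_most_def by blast
  then have "\<forall>v. F v + H v = (\<Sum>q\<in>cube D. (c q + d q) * monomial q v)"
    by (simp add: sum.distrib distrib_right)
  then show ?thesis unfolding degree_at_most_def by (rule exI[of _ "\<lambda>q. c q + d q"])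
qed

lemma degree_at_most_mult:
  assumes "degree_at_most D F" "degree_at_most D' H"
  shows "degree_at_most (D + D') (\<lambda>v. F v * H v)"
proof -
  obtain c d where cd: "\<And>v. F v = (\<Sum>q\<in>cube D. c q * monomial q v)" "\<And>v. H v = (\<Sum>q\<in>cube D'. d q * monomial q v)"
    using assms unfolding degree_at_most_def by blast
  define e :: "(nat \<times> nat \<times> nat) \<times> (nat \<times> nat \<times> nat) \<Rightarrow> nat \<times> nat \<times> nat"
    where "e = (\<lambda>((i,j,k),(i',j',k')). (i + i', j + j', k + k'))"
  have e: "monomial (e (q, r)) v = monomial q v * monomial r v" for q r v
    by (cases q; cases r; cases v) (simp add: e_def power_add)
  show ?thesis
  proof (rule degree_at_mostI[of "cube D \<times> cube D'" e _ _ "\<lambda>(q, r). c q * d r"])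
    fix v
    show "F v * H v = (\<Sum>s\<in>cube D \<times> cube D'. (case s of (q, r) \<Rightarrow> c q * d r) * monomial (e s) v)"
      unfolding cd sum_product sum.cartesian_product by (rule sum.cong) (auto simp: e algebra_simps)
  qed (auto simp: cube_def e_def)
qed

lemma real_polynomial_function_degree:
  fixes F :: "real \<times> real \<times> real \<Rightarrow> real"
  assumes "real_polynomial_function F"
  shows "\<exists>D. degree_at_most D F"
  using assms
proof (induction rule: real_polynomial_function.induct)
  case (linear f) then show ?case using degree_at_most_linear by blast
next
  case (const c) then show ?case using degree_at_most_const by blast
next
  case (add f g)
  then obtain D D' where "degree_at_most D f" "degree_at_most D' g" by blast
  then have "degree_at_most (max D D') f" "degree_at_most (max D D') g" by (auto intro: degree_at_most_mono)
  from degree_at_most_add[OF this] show ?case by blast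
next
  case (mult f g) then show ?case using degree_at_most_mult by blast
qed

lemma degree_at_most_power: "degree_at_most D F \<Longrightarrow> degree_at_most (m * D) (\<lambda>v. F v ^ m)"
proof (induction m)
  case 0 then show ?case using degree_at_most_const[of 1] by simp
next
  case (Suc m) then show ?case using degree_at_most_mult[of D F "m * D" "\<lambda>v. F v ^ m"] by simp
qed

lemma degree_at_most_prod:
  assumes "\<And>i. i < n \<Longrightarrow> degree_at_most D (F i)"
  shows "degree_at_most (n * D) (\<lambda>v. \<Prod>i<n. F i v)"
  using assms
proof (induction n)
  case 0 then show ?case using degree_at_most_const[of 1] by simp
next
  case (Suc n)
  have "degree_at_most (n * D + D) (\<lambda>v. (\<Prod>i<n. F i v) * F n v)"
    by (rule degree_at_most_mult) (use Suc in auto)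
  then show ?case by (simp add: add.commute mult.commute)
qed

text \<open>Counting: the monomials in \<open>n \<ge> 4\<close> polynomials with exponents below \<open>N\<close> are \<open>N ^ n\<close> many,
  and they lie in a space of polynomials of dimension at most \<open>((n * D + 1) * N) ^ 3\<close>, which is
  smaller when \<open>N > (n * D + 1) ^ 3\<close>.\<close>

lemma polynomials_on_R3_dependent:
  fixes F :: "nat \<Rightarrow> real \<times> real \<times> real \<Rightarrow> real"
  assumes F: "\<And>i. i < n \<Longrightarrow> real_polynomial_function (F i)" and n: "n \<ge> 4"
  shows "\<exists>M c. finite M \<and> M \<subseteq> ({..<n} \<rightarrow>\<^sub>E (UNIV :: nat set)) \<and>
    (\<forall>v. (\<Sum>m\<in>M. c m * (\<Prod>i<n. F i v ^ m i)) = 0) \<and> (\<exists>m\<in>M. c m \<noteq> 0)"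
proof -
  have "\<forall>i. \<exists>D. i < n \<longrightarrow> degree_at_most D (F i)" using F real_polynomial_function_degree by blast
  then obtain D0 where D0: "\<And>i. i < n \<Longrightarrow> degree_at_most (D0 i) (F i)" by metis
  define D where "D = (\<Sum>i<n. D0 i)"
  have D: "degree_at_most D (F i)" if "i < n" for i
    using D0[OF that] by (rule degree_at_most_mono) (use that in \<open>auto simp: D_def intro!: member_le_sum\<close>)
  \<comment> \<open>Chosen so that \<open>((n * D + 1) * N) ^ 3 < N ^ 4\<close>.\<close>
  define N where "N = (n * D + 1) ^ 3 + 1"
  define M where "M = ({..<n} \<rightarrow>\<^sub>E {..<N})"
  have finM: "finite M" unfolding M_def by (intro finite_PiE) auto
  have "degree_at_most (n * (N * D)) (\<lambda>v. \<Prod>i<n. F i v ^ m i)" if m: "m \<in> M" for m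
  proof (rule degree_at_most_prod)
    fix i assume i: "i < n"
    have "m i < N" using m i by (auto simp: M_def)
    then show "degree_at_most (N * D) (\<lambda>v. F i v ^ m i)"
      by (intro degree_at_most_mono[OF degree_at_most_power[OF D[OF i], of "m i"]] mult_right_mono) auto
  qed
  then have "\<forall>m. \<exists>A. m \<in> M \<longrightarrow> (\<forall>v. (\<Prod>i<n. F i v ^ m i) = (\<Sum>q\<in>cube (n * (N * D)). A q * monomial q v))"
    unfolding degree_at_most_def by blast
  then obtain A where A: "\<And>m v. m \<in> M \<Longrightarrow> (\<Prod>i<n. F i v ^ m i) = (\<Sum>q\<in>cube (n * (N * D)). A m q * monomial q v)"
    by metis
  have "card (cube (n * (N * D))) = (n * (N * D) + 1) ^ 3"
    by (simp add: cube_def card_cartesian_product power3_eq_cube algebra_simps)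
  also have "\<dots> \<le> ((n * D + 1) * N) ^ 3"
    by (rule power_mono) (auto simp: N_def algebra_simps)
  also have "\<dots> = (n * D + 1) ^ 3 * N ^ 3" by (rule power_mult_distrib)
  also have "\<dots> < N * N ^ 3" by (rule mult_strict_right_mono) (auto simp: N_def)
  also have "\<dots> = N ^ 4" by (simp add: eval_nat_numeral)
  also have "\<dots> \<le> N ^ n" using n by (intro power_increasing) (auto simp: N_def)
  also have "\<dots> = card M" by (simp add: M_def card_funcsetE)
  finally have "card (cube (n * (N * D))) < card M" .
  from underdetermined_system[OF finite_cube finM this, of A]
  obtain c where c: "\<exists>m\<in>M. c m \<noteq> 0" "\<And>q. q \<in> cube (n * (N * D)) \<Longrightarrow> (\<Sum>m\<in>M. c m * A m q) = 0" by blast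
  have "(\<Sum>m\<in>M. c m * (\<Prod>i<n. F i v ^ m i)) = 0" for v
  proof -
    have "(\<Sum>m\<in>M. c m * (\<Prod>i<n. F i v ^ m i)) = (\<Sum>m\<in>M. \<Sum>q\<in>cube (n * (N * D)). c m * A m q * monomial q v)"
      by (intro sum.cong refl) (simp add: A sum_distrib_left mult.assoc)
    also have "\<dots> = (\<Sum>q\<in>cube (n * (N * D)). \<Sum>m\<in>M. c m * A m q * monomial q v)" by (rule sum.swap)
    also have "\<dots> = (\<Sum>q\<in>cube (n * (N * D)). (\<Sum>m\<in>M. c m * A m q) * monomial q v)"
      by (simp add: sum_distrib_right)
    also have "\<dots> = 0" using c(2) by (intro sum.neutral) auto
    finally show ?thesis .
  qed
  moreover have "M \<subseteq> ({..<n} \<rightarrow>\<^sub>E UNIV)" unfolding M_def by (rule PiE_mono) auto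
  ultimately show ?thesis using c(1) finM by (intro exI[of _ M] exI[of _ c]) auto
qed

lemma base_digits_unique:
  fixes B :: nat
  assumes "a < B" "b < B" "a' < B" "b' < B" "a + B * (b + B * d) = a' + B * (b' + B * d')"
  shows "a = a' \<and> b = b' \<and> d = d'"
proof -
  have B: "B > 0" using assms(1) by simp
  have "(a + B * (b + B * d)) mod B = a" "(a' + B * (b' + B * d')) mod B = a'" using assms(1-4) by simp_all
  then have a: "a = a'" using assms(5) by argo
  then have 1: "b + B * d = b' + B * d'" using assms(5) B by simp
  have "(b + B * d) mod B = b" "(b' + B * d') mod B = b'" using assms(1-4) by simp_all
  then have b: "b = b'" using 1 by argo
  then show ?thesis using 1 a B by simp
qed

text \<open>Substituting \<open>t\<close>, \<open>t ^ B\<close>, \<open>t ^ (B * B)\<close> for the variables, with \<open>B\<close> larger than all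
  exponents of the first two, maps distinct monomials to distinct powers of \<open>t\<close>.\<close>

lemma monomials_on_R3_independent:
  fixes c :: "(nat \<Rightarrow> nat) \<Rightarrow> real"
  assumes M: "finite M" "M \<subseteq> ({..<3} \<rightarrow>\<^sub>E (UNIV :: nat set))"
    and zero: "\<And>x y z. (\<Sum>m\<in>M. c m * (x ^ m 0 * y ^ m 1 * z ^ m 2)) = 0"
    and m: "m \<in> M"
  shows "c m = 0"
proof -
  define B where "B = Suc (\<Sum>m\<in>M. m 0 + m 1)"
  have "m 0 + m 1 \<le> (\<Sum>m\<in>M. m 0 + m 1)" if "m \<in> M" for m
    using that M(1) by (intro member_le_sum) auto
  then have B: "m 0 < B" "m 1 < B" if "m \<in> M" for m using that by (fastforce simp: B_def)+
  define e where "e m = m 0 + B * (m 1 + B * m 2)" for m :: "nat \<Rightarrow> nat"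
  have inj: "m' = m''" if "m' \<in> M" "m'' \<in> M" "e m' = e m''" for m' m''
  proof -
    have *: "m' 0 = m'' 0 \<and> m' 1 = m'' 1 \<and> m' 2 = m'' 2"
      using base_digits_unique[OF B(1)[OF that(1)] B(2)[OF that(1)] B(1)[OF that(2)] B(2)[OF that(2)]] that(3)
      by (simp add: e_def)
    have "m' \<in> {..<3} \<rightarrow>\<^sub>E UNIV" "m'' \<in> {..<3} \<rightarrow>\<^sub>E UNIV" using M(2) that by auto
    then show ?thesis
    proof (rule PiE_ext)
      fix i :: nat assume "i \<in> {..<3}"
      then have "i = 0 \<or> i = 1 \<or> i = 2" by auto
      with * show "m' i = m'' i" by auto
    qed
  qed
  define K where "K = (\<Sum>m\<in>M. e m)"
  have eK: "e ` M \<subseteq> {..K}" using M(1) by (auto simp: K_def intro!: member_le_sum)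
  have "(\<Sum>k\<le>K. (\<Sum>m | m \<in> M \<and> e m = k. c m) * t ^ k) = 0" for t :: real
  proof -
    have "(\<Sum>k\<le>K. (\<Sum>m | m \<in> M \<and> e m = k. c m) * t ^ k) = (\<Sum>k\<le>K. \<Sum>m | m \<in> M \<and> e m = k. c m * t ^ e m)"
      by (intro sum.cong refl) (simp add: sum_distrib_right)
    also have "\<dots> = (\<Sum>m\<in>M. c m * t ^ e m)" by (rule sum.group[OF M(1) _ eK]) simp
    also have "\<dots> = (\<Sum>m\<in>M. c m * (t ^ m 0 * (t ^ B) ^ m 1 * (t ^ (B * B)) ^ m 2))"
      by (intro sum.cong refl) (simp add: e_def power_add power_mult[symmetric] distrib_left mult.assoc)
    also have "\<dots> = 0" by (rule zero)
    finally show ?thesis .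
  qed
  then have "\<forall>k\<le>K. (\<Sum>m | m \<in> M \<and> e m = k. c m) = 0"
    using polyfun_eq_0[of "\<lambda>k. \<Sum>m | m \<in> M \<and> e m = k. c m" K] by blast
  then have "(\<Sum>m' | m' \<in> M \<and> e m' = e m. c m') = 0" using m eK by auto
  moreover have "{m'. m' \<in> M \<and> e m' = e m} = {m}" using m inj by auto
  ultimately show ?thesis by simp
qed

lemma algebraic_set_zero_set: "real_polynomial_function f \<Longrightarrow> algebraic_set {x. f x = 0}"
  unfolding algebraic_set_def by (intro exI[of _ "{f}"]) auto

lemma algebraic_set_Int:
  assumes "algebraic_set V" "algebraic_set W"
  shows "algebraic_set (V \<inter> W)"
proof -
  obtain P Q where "\<forall>p\<in>P. real_polynomial_function p" "V = {x. \<forall>p\<in>P. p x = 0}"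
    "\<forall>p\<in>Q. real_polynomial_function p" "W = {x. \<forall>p\<in>Q. p x = 0}"
    using assms unfolding algebraic_set_def by blast
  then show ?thesis unfolding algebraic_set_def by (intro exI[of _ "P \<union> Q"]) auto
qed

lemma algebraic_set_equalizer:
  fixes f :: "'a::euclidean_space \<Rightarrow> 'b::euclidean_space"
  assumes f: "polynomial_function f" and h: "polynomial_function h"
  shows "algebraic_set {x. f x = h x}"
  unfolding algebraic_set_def
proof (intro exI conjI)
  show "\<forall>p\<in>(\<lambda>b x. (f x - h x) \<bullet> b) ` Basis. real_polynomial_function p"
    unfolding real_polynomial_function_eq
    by (auto intro!: polynomial_function_inner polynomial_function_diff f h)
  have eq: "f x = h x \<longleftrightarrow> (\<forall>b\<in>Basis. (f x - h x) \<bullet> b = 0)" for x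
    unfolding inner_diff_left right_minus_eq by (rule euclidean_eq_iff)
  show "{x. f x = h x} = {x. \<forall>p\<in>(\<lambda>b x. (f x - h x) \<bullet> b) ` Basis. p x = 0}"
    unfolding ball_simps(9) eq by (rule refl)
qed

lemma polynomial_separating_algebraic_subset:
  assumes "algebraic_set V1" "V1 \<subseteq> V" "V1 \<noteq> V"
  obtains f x where "real_polynomial_function f" "\<And>y. y \<in> V1 \<Longrightarrow> f y = 0" "x \<in> V" "f x \<noteq> 0"
proof -
  obtain P where P: "\<forall>p\<in>P. real_polynomial_function p" "V1 = {x. \<forall>p\<in>P. p x = 0}"
    using assms(1) unfolding algebraic_set_def by blast
  obtain x where x: "x \<in> V" "x \<notin> V1" using assms(2,3) by blast
  then obtain p where "p \<in> P" "p x \<noteq> 0" using P(2) by blast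
  with P x that show ?thesis by blast
qed

text \<open>A polynomial embedding of three-space with a polynomial left inverse. Its range is
  isomorphic to three-space as an affine variety.\<close>

locale polynomial_section =
  fixes p :: "real \<times> real \<times> real \<Rightarrow> 'a::euclidean_space" and \<kappa> :: "'a \<Rightarrow> real \<times> real \<times> real"
  assumes p: "polynomial_function p" and \<kappa>: "polynomial_function \<kappa>" and \<kappa>_p: "\<And>v. \<kappa> (p v) = v"
begin

lemma p_eq_iff: "p v = p w \<longleftrightarrow> v = w"
  by (metis \<kappa>_p)

lemma range_eq: "range p = {x. p (\<kappa> x) = x}"
proof -
  have "\<exists>v. x = p v" if "p (\<kappa> x) = x" for x using that by (intro exI[of _ "\<kappa> x"]) simp
  then show ?thesis by (auto simp: \<kappa>_p)
qed

lemma algebraic_range: "algebraic_set (range p)"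
  unfolding range_eq
  using algebraic_set_equalizer[of "p \<circ> \<kappa>" "\<lambda>x. x"] polynomial_function_compose[OF \<kappa> p] by simp

text \<open>Polynomials on the range pull back to polynomials on three-space, which have no zero
  divisors.\<close>

lemma algebraic_variety_range: "algebraic_variety (range p)"
  unfolding algebraic_variety_def
proof (intro conjI allI impI)
  show "algebraic_set (range p)" by (rule algebraic_range)
  fix V1 V2 assume V: "algebraic_set V1 \<and> algebraic_set V2 \<and> range p = V1 \<union> V2"
  show "range p = V1 \<or> range p = V2"
  proof (rule ccontr)
    assume "\<not> (range p = V1 \<or> range p = V2)"
    then have ne: "V1 \<noteq> range p" "V2 \<noteq> range p" by auto
    have sub: "V1 \<subseteq> range p" "V2 \<subseteq> range p" using V by auto
    obtain f x where f: "real_polynomial_function f" "\<And>y. y \<in> V1 \<Longrightarrow> f y = 0" "x \<in> range p" "f x \<noteq> 0"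
      using polynomial_separating_algebraic_subset[of V1 "range p"] V sub ne by blast
    obtain g y where g: "real_polynomial_function g" "\<And>y. y \<in> V2 \<Longrightarrow> g y = 0" "y \<in> range p" "g y \<noteq> 0"
      using polynomial_separating_algebraic_subset[of V2 "range p"] V sub ne by blast
    obtain a b where ab: "x = p a" "y = p b" using f(3) g(3) by blast
    have "(g \<circ> p) b = 0"
    proof (rule real_polynomial_function_mult_eq_0[of "f \<circ> p" "g \<circ> p" a])
      show "real_polynomial_function (f \<circ> p)" "real_polynomial_function (g \<circ> p)"
        using real_polynomial_function_compose[OF p] f(1) g(1) by auto
      show "(f \<circ> p) v * (g \<circ> p) v = 0" for v
      proof -
        have "p v \<in> V1 \<or> p v \<in> V2" using V by auto
        then show ?thesis using f(2) g(2) by auto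
      qed
      show "(f \<circ> p) a \<noteq> 0" using f(4) ab by simp
    qed
    then show False using g(4) ab by simp
  qed
qed simp

lemma real_polynomial_coordinates:
  "real_polynomial_function (\<lambda>x. fst (\<kappa> x))"
  "real_polynomial_function (\<lambda>x. fst (snd (\<kappa> x)))"
  "real_polynomial_function (\<lambda>x. snd (snd (\<kappa> x)))"
proof -
  have *: "real_polynomial_function (\<lambda>x. h (\<kappa> x))" if "bounded_linear h" for h :: "real \<times> real \<times> real \<Rightarrow> real"
    using real_polynomial_function_compose[OF \<kappa> real_polynomial_function.intros(1)[OF that]] by (simp add: o_def)
  show "real_polynomial_function (\<lambda>x. fst (\<kappa> x))" by (rule *) (rule bounded_linear_fst)
  show "real_polynomial_function (\<lambda>x. fst (snd (\<kappa> x)))"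
    by (rule *) (rule bounded_linear_compose[OF bounded_linear_fst bounded_linear_snd])
  show "real_polynomial_function (\<lambda>x. snd (snd (\<kappa> x)))"
    by (rule *) (rule bounded_linear_compose[OF bounded_linear_snd bounded_linear_snd])
qed

lemma has_algebraic_dim_range: "has_algebraic_dim (range p) 3"
  unfolding has_algebraic_dim_def
proof (intro conjI exI allI impI)
  define f where "f = (\<lambda>(i::nat) x. if i = 0 then fst (\<kappa> x) else if i = 1 then fst (snd (\<kappa> x)) else snd (snd (\<kappa> x)))"
  show "algebraically_independent_on (range p) 3 f"
    unfolding algebraically_independent_on_def
  proof (intro conjI allI impI ballI)
    fix i :: nat
    consider "i = 0" | "i = 1" | "i \<noteq> 0 \<and> i \<noteq> 1" by blast
    then show "real_polynomial_function (f i)"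
      by cases (simp_all add: f_def real_polynomial_coordinates)
  next
    fix M :: "(nat \<Rightarrow> nat) set" and c m
    assume *: "finite M \<and> M \<subseteq> ({..<3} \<rightarrow>\<^sub>E UNIV) \<and> (\<forall>x\<in>range p. (\<Sum>m\<in>M. c m * (\<Prod>i<3. f i x ^ m i)) = 0)"
      and m: "m \<in> M"
    show "c m = 0"
    proof (rule monomials_on_R3_independent[OF _ _ _ m])
      fix x y z
      have "(\<Sum>m\<in>M. c m * (\<Prod>i<3. f i (p (x, y, z)) ^ m i)) = 0" using * by blast
      moreover have "(\<Prod>i<3. f i (p (x, y, z)) ^ m i) = x ^ m 0 * y ^ m 1 * z ^ m 2" for m
        by (simp add: eval_nat_numeral f_def \<kappa>_p)
      ultimately show "(\<Sum>m\<in>M. c m * (x ^ m 0 * y ^ m 1 * z ^ m 2)) = 0" by simp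
    qed (use * in auto)
  qed
next
  fix n f assume ind: "algebraically_independent_on (range p) n f"
  show "n \<le> 3"
  proof (rule ccontr)
    assume "\<not> n \<le> 3"
    then have n: "n \<ge> 4" by simp
    have F: "real_polynomial_function (f i \<circ> p)" if "i < n" for i
      using real_polynomial_function_compose[OF p] ind that by (auto simp: algebraically_independent_on_def)
    obtain M c where M: "finite M" "M \<subseteq> ({..<n} \<rightarrow>\<^sub>E (UNIV :: nat set))"
      "\<And>v. (\<Sum>m\<in>M. c m * (\<Prod>i<n. (f i \<circ> p) v ^ m i)) = 0" "\<exists>m\<in>M. c m \<noteq> 0"
      using polynomials_on_R3_dependent[of n "\<lambda>i. f i \<circ> p", OF F n] by blast
    have "\<forall>x\<in>range p. (\<Sum>m\<in>M. c m * (\<Prod>i<n. f i x ^ m i)) = 0" using M(3) by auto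
    then have "\<forall>m\<in>M. c m = 0" using ind M(1,2) unfolding algebraically_independent_on_def by blast
    with M(4) show False by blast
  qed
qed

text \<open>The part with \<open>fst v \<noteq> 0\<close> is the complement in the range of the zero set \<open>W\<close> of the first
  coordinate; the rest is cut out of \<open>W\<close> by the third coordinate.\<close>

lemma constructible_image:
  assumes S: "S = p ` {v. fst v \<noteq> 0 \<or> snd (snd v) = 0}"
  shows "\<exists>V W L. algebraic_variety V \<and> has_algebraic_dim V 3 \<and>
          algebraic_set W \<and> W \<subset> V \<and> algebraic_set L \<and> L \<subseteq> W \<and> S = (V - W) \<union> L"
proof -
  define W where "W = range p \<inter> {x. fst (\<kappa> x) = 0}"
  define L where "L = W \<inter> {x. snd (snd (\<kappa> x)) = 0}"
  have aW: "algebraic_set W" unfolding W_def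
    by (intro algebraic_set_Int algebraic_range algebraic_set_zero_set real_polynomial_coordinates)
  have aL: "algebraic_set L" unfolding L_def
    by (intro algebraic_set_Int aW algebraic_set_zero_set real_polynomial_coordinates)
  have "p (1, 0, 0) \<notin> W" by (simp add: W_def \<kappa>_p)
  then have "W \<subset> range p" unfolding W_def by blast
  moreover have "S = p ` {v. fst v \<noteq> 0} \<union> p ` {v. fst v = 0 \<and> snd (snd v) = 0}"
    unfolding S by auto
  moreover have "p ` {v. fst v \<noteq> 0} = range p - W"
    by (auto simp: W_def \<kappa>_p p_eq_iff)
  moreover have "p ` {v. fst v = 0 \<and> snd (snd v) = 0} = L"
    by (auto simp: W_def L_def \<kappa>_p)
  ultimately show ?thesis
    using algebraic_variety_range has_algebraic_dim_range aW aL
    by (intro exI[of _ "range p"] exI[of _ W] exI[of _ L]) (auto simp: L_def)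
qed

end

section \<open>Momenta of abnormal curves in a filiform frame\<close>

lemma linear_functional_inner:
  fixes f :: "'a::euclidean_space \<Rightarrow> real"
  assumes "linear f"
  obtains l where "\<And>x. f x = l \<bullet> x"
proof
  fix x
  have "f x = f (\<Sum>b\<in>Basis. (x \<bullet> b) *\<^sub>R b)" by (simp add: euclidean_representation)
  also have "\<dots> = (\<Sum>b\<in>Basis. (x \<bullet> b) * f b)" by (simp add: linear_sum[OF assms] linear_cmul[OF assms])
  also have "\<dots> = (\<Sum>b\<in>Basis. (f b *\<^sub>R b) \<bullet> x)"
    by (intro sum.cong refl) (simp add: inner_commute mult.commute)
  also have "\<dots> = (\<Sum>b\<in>Basis. f b *\<^sub>R b) \<bullet> x" by (rule inner_sum_left[symmetric])
  finally show "f x = (\<Sum>b\<in>Basis. f b *\<^sub>R b) \<bullet> x" .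
qed

lemma step_function_integral:
  fixes k p q t :: real
  assumes "0 \<le> p" "p \<le> q" "0 \<le> t"
  shows "integral {0..t} (\<lambda>x. if x \<in> {p..q} then k else 0) = k * max 0 (min t q - p)"
proof -
  have "integral {0..t} (\<lambda>x. if x \<in> {p..q} then k else 0) = integral ({p..q} \<inter> {0..t}) (\<lambda>x. k)"
    by (rule integral_restrict_Int)
  also have "{p..q} \<inter> {0..t} = {p..min t q}" using assms by auto
  finally show ?thesis using assms by (simp add: content_real_if max_def min_def)
qed

lemma step_function_absolutely_integrable:
  fixes k :: real
  shows "(\<lambda>x. if x \<in> {p..q} then k else 0) absolutely_integrable_on {0..1::real}"
proof -
  have *: "(\<lambda>x. if x \<in> {p..q} then c else 0) integrable_on {0..1::real}" for c :: real
    unfolding integrable_restrict_Int by (simp add: Int_atLeastAtMost integrable_const_ivl)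
  have "(\<lambda>x::real. norm (if x \<in> {p..q} then k else 0)) = (\<lambda>x. if x \<in> {p..q} then \<bar>k\<bar> else 0)" by auto
  with *[of k] *[of "\<bar>k\<bar>"] show ?thesis by (simp only: absolutely_integrable_on_def)
qed

text \<open>Both types at once: bracketing with \<open>X 1\<close> shifts the frame up to the index \<open>m + 1\<close>, where
  \<open>m = s\<close> in type I and \<open>m = s - 1\<close> in type II, and the other brackets are multiples of the
  central element \<open>X (s+1)\<close>. The last assumption says that \<open>X 2\<close> commutes with \<open>X 2, \<dots>, X m\<close>, so
  that the chain \<open>X 2, \<dots>, X (m+1)\<close> is governed by \<open>X 1\<close> alone.\<close>

locale filiform_frame = exponential_group +
  fixes X :: "nat \<Rightarrow> 'a" and s m :: nat and \<omega> :: "nat \<Rightarrow> nat \<Rightarrow> real"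
  assumes m_ge: "3 \<le> m" and m_le: "m \<le> s"
    and inj_X: "inj_on X {1..s+1}" and independent_X: "independent (X ` {1..s+1})"
    and span_X: "span (X ` {1..s+1}) = UNIV"
    and bracket_X1: "\<And>j. 2 \<le> j \<Longrightarrow> j \<le> s+1 \<Longrightarrow> lie_bracket G (X 1) (X j) = (if j \<le> m then X (j+1) else 0)"
    and bracket_rest: "\<And>i j. 2 \<le> i \<Longrightarrow> i \<le> s+1 \<Longrightarrow> 2 \<le> j \<Longrightarrow> j \<le> s+1 \<Longrightarrow>
        lie_bracket G (X i) (X j) = \<omega> i j *\<^sub>R X (s+1)"
    and \<omega>_top: "\<And>i. \<omega> i (s+1) = 0" and \<omega>_2: "\<And>j. 2 \<le> j \<Longrightarrow> j \<le> m \<Longrightarrow> \<omega> 2 j = 0"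
begin

definition coord :: "nat \<Rightarrow> 'a \<Rightarrow> real" where
  "coord i x = representation (X ` {1..s+1}) x (X i)"

lemma in_span_X: "x \<in> span (X ` {1..s+1})"
  by (simp only: span_X UNIV_I)

lemma linear_coord: "linear (coord i)"
  by (rule linearI)
    (simp_all only: coord_def representation_add[OF independent_X in_span_X in_span_X]
      representation_scale[OF independent_X in_span_X] real_scaleR_def)

lemma coord_simps [simp]: "coord i (x + y) = coord i x + coord i y" "coord i (x - y) = coord i x - coord i y"
  "coord i (c *\<^sub>R x) = c * coord i x" "coord i 0 = 0" "coord i (- x) = - coord i x"
  using linear_coord[of i] by (simp_all add: linear_add linear_diff linear_cmul linear_0 linear_neg)

lemma bounded_linear_coord: "bounded_linear (coord i)"
  using linear_coord linear_conv_bounded_linear by blast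

lemma coord_sum: "coord i (sum f A) = (\<Sum>a\<in>A. coord i (f a))"
  by (rule linear_sum[OF linear_coord])

lemma coord_X: "i \<in> {1..s+1} \<Longrightarrow> j \<in> {1..s+1} \<Longrightarrow> coord i (X j) = (if i = j then 1 else 0)"
  using representation_basis[OF independent_X, of "X j"] inj_on_eq_iff[OF inj_X, of i j]
  by (auto simp: coord_def)

lemma coord_expand: "x = (\<Sum>i\<in>{1..s+1}. coord i x *\<^sub>R X i)"
proof -
  have "(\<Sum>b\<in>X ` {1..s+1}. representation (X ` {1..s+1}) x b *\<^sub>R b) = x"
    by (rule sum_representation_eq[OF independent_X in_span_X]) auto
  then show ?thesis unfolding sum.reindex[OF inj_X] by (simp add: coord_def o_def)
qed

lemma linear_zero_on_frame:
  assumes f: "linear f" and zero: "\<And>i. i \<in> {1..s+1} \<Longrightarrow> f (X i) = 0"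
  shows "f x = 0"
proof -
  have "f x = (\<Sum>i\<in>{1..s+1}. coord i x *\<^sub>R f (X i))"
    by (subst coord_expand[of x]) (simp only: linear_sum[OF f] linear_cmul[OF f])
  also have "\<dots> = 0" using zero by (intro sum.neutral) auto
  finally show ?thesis .
qed

lemma linear_eq_on_frame:
  assumes f: "linear f" and h: "linear h" and eq: "\<And>i. i \<in> {1..s+1} \<Longrightarrow> f (X i) = h (X i)"
  shows "f x = h x"
proof -
  have "f x - h x = 0"
    by (rule linear_zero_on_frame[OF linear_compose_sub[OF f h]]) (simp add: eq)
  then show ?thesis by simp
qed

lemma frame_index_cases:
  assumes "i \<in> {1..s+1}"
  obtains "i = 1" | "2 \<le> i" "i \<le> s+1"
  using assms by fastforce

lemma bracket_top: "lie_bracket G x (X (s+1)) = 0"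
proof (rule linear_zero_on_frame[OF linear_bracket_left])
  fix i assume "i \<in> {1..s+1}"
  then show "lie_bracket G (X i) (X (s+1)) = 0"
  proof (cases rule: frame_index_cases)
    case 1 then show ?thesis using bracket_X1[of "s+1"] m_ge m_le by simp
  next
    case 2 then show ?thesis using bracket_rest[of i "s+1"] m_ge m_le \<omega>_top[of i] by simp
  qed
qed

lemma coord_bracket:
  assumes "\<And>i j. i \<in> {1..s+1} \<Longrightarrow> j \<in> {1..s+1} \<Longrightarrow> coord q (lie_bracket G (X i) (X j)) = 0"
  shows "coord q (lie_bracket G x y) = 0"
proof -
  have "linear (\<lambda>x. coord q (lie_bracket G x y))"
    using linear_compose[OF linear_bracket_left linear_coord] by (simp add: o_def)
  then show ?thesis
  proof (rule linear_zero_on_frame)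
    fix i assume i: "i \<in> {1..s+1}"
    have "linear (\<lambda>y. coord q (lie_bracket G (X i) y))"
      using linear_compose[OF linear_bracket_right linear_coord] by (simp add: o_def)
    then show "coord q (lie_bracket G (X i) y) = 0"
      by (rule linear_zero_on_frame) (use assms i in blast)
  qed
qed

lemma bracket_X_cases:
  assumes "i \<in> {1..s+1}" "j \<in> {1..s+1}"
  shows "\<exists>k\<in>{3..s+1}. \<exists>c. lie_bracket G (X i) (X j) = c *\<^sub>R X k"
  using assms(1)
proof (cases rule: frame_index_cases)
  case 1
  show ?thesis
    using assms(2)
  proof (cases rule: frame_index_cases)
    case 1 with \<open>i = 1\<close> show ?thesis using bracket_self[of "X 1"] m_ge m_le by (intro bexI[of _ 3] exI[of _ 0]) auto
  next
    case 2
    show ?thesis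
    proof (cases "j \<le> m")
      case True
      then show ?thesis using bracket_X1[of j] \<open>i = 1\<close> 2 m_le by (intro bexI[of _ "j+1"] exI[of _ 1]) auto
    next
      case False
      then show ?thesis using bracket_X1[of j] \<open>i = 1\<close> 2 m_ge m_le by (intro bexI[of _ 3] exI[of _ 0]) auto
    qed
  qed
next
  case 2
  show ?thesis
    using assms(2)
  proof (cases rule: frame_index_cases)
    case 1
    have *: "lie_bracket G (X i) (X j) = (if i \<le> m then - X (i+1) else 0)"
      using lie_bracket_skew[of "X i" "X j"] bracket_X1[of i] 1 2 by simp
    show ?thesis
    proof (cases "i \<le> m")
      case True
      then show ?thesis using * 2 m_le by (intro bexI[of _ "i+1"] exI[of _ "-1"]) auto
    next
      case False
      then show ?thesis using * m_ge m_le by (intro bexI[of _ 3] exI[of _ 0]) auto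
    qed
  next
    case 2 with \<open>2 \<le> i\<close> \<open>i \<le> s+1\<close> show ?thesis using bracket_rest[of i j] m_ge m_le by (intro bexI[of _ "s+1"]) auto
  qed
qed

lemma coord_12_bracket: "q \<in> {1,2} \<Longrightarrow> coord q (lie_bracket G x y) = 0"
proof (rule coord_bracket)
  fix i j assume q: "q \<in> {1,2}" and "i \<in> {1..s+1}" "j \<in> {1..s+1}"
  then obtain k c where "k \<in> {3..s+1}" "lie_bracket G (X i) (X j) = c *\<^sub>R X k" using bracket_X_cases by blast
  with q show "coord q (lie_bracket G (X i) (X j)) = 0" using coord_X[of q k] by auto
qed

lemma kernel_expand: "coord 1 v = 0 \<Longrightarrow> v = (\<Sum>i\<in>{2..s+1}. coord i v *\<^sub>R X i)"
proof -
  assume "coord 1 v = 0"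
  have "{1..s+1} = insert 1 {2..s+1}" by auto
  then show ?thesis using coord_expand[of v] \<open>coord 1 v = 0\<close> by simp
qed

lemma bracket_kernel:
  assumes "coord 1 v = 0" "coord 1 w = 0"
  shows "lie_bracket G v w = (\<Sum>i\<in>{2..s+1}. \<Sum>j\<in>{2..s+1}. coord i v * coord j w * \<omega> i j) *\<^sub>R X (s+1)"
proof -
  have "lie_bracket G v w = (\<Sum>i\<in>{2..s+1}. \<Sum>j\<in>{2..s+1}. coord i v *\<^sub>R coord j w *\<^sub>R lie_bracket G (X i) (X j))"
    unfolding arg_cong2[OF kernel_expand[OF assms(1)] kernel_expand[OF assms(2)], of "lie_bracket G"]
    by (simp only: linear_sum[OF linear_bracket_left] linear_cmul[OF linear_bracket_left])
      (simp only: linear_sum[OF linear_bracket_right] linear_cmul[OF linear_bracket_right] scaleR_sum_right)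
  also have "\<dots> = (\<Sum>i\<in>{2..s+1}. \<Sum>j\<in>{2..s+1}. (coord i v * coord j w * \<omega> i j) *\<^sub>R X (s+1))"
    by (intro sum.cong refl) (simp add: bracket_rest)
  finally show ?thesis by (simp only: scaleR_sum_left)
qed

lemma bracket_X1_power:
  assumes j: "2 \<le> j" "j \<le> m + 1"
  shows "(lie_bracket G (X 1) ^^ k) (X j) = (if j + k \<le> m + 1 then X (j + k) else 0)"
proof (induction k)
  case 0 then show ?case using j by simp
next
  case (Suc k)
  have b0: "lie_bracket G (X 1) 0 = 0" by (rule linear_0[OF linear_bracket_right])
  show ?case
    using Suc.IH bracket_X1[of "j + k"] j m_le b0 by auto
qed

lemma bracket_X1_nilpotent: "(lie_bracket G (X 1) ^^ (s+1)) x = 0"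
proof (rule linear_zero_on_frame[of "lie_bracket G (X 1) ^^ (s+1)"])
  show "linear (lie_bracket G (X 1) ^^ (s+1))" by (rule linear_bracket_funpow)
  fix i assume i: "i \<in> {1..s+1}"
  have b0: "(lie_bracket G (X 1) ^^ n) 0 = 0" for n
    by (induction n) (simp_all add: linear_0[OF linear_bracket_right])
  show "(lie_bracket G (X 1) ^^ (s+1)) (X i) = 0"
    using i
  proof (cases rule: frame_index_cases)
    case 1
    then show ?thesis using b0[of s] bracket_self[of "X 1"] by (simp add: funpow_swap1)
  next
    case 2
    show ?thesis
    proof (cases "i \<le> m + 1")
      case True then show ?thesis using bracket_X1_power[OF 2(1) True, of "s+1"] m_le 2 by simp
    next
      case False
      then have "lie_bracket G (X 1) (X i) = 0" using bracket_X1[of i] 2 by simp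
      then show ?thesis using b0[of s] by (simp add: funpow_swap1)
    qed
  qed
qed

sublocale two_step_by_line G "X 1" "coord 1" "s+1"
proof (intro two_step_by_line.intro two_step_by_line_axioms.intro exponential_group_axioms)
  show "linear (coord 1)" by (rule linear_coord)
  show "coord 1 (X 1) = 1" using coord_X[of 1 1] by simp
  show "coord 1 (lie_bracket G x y) = 0" for x y by (rule coord_12_bracket) simp
  show "lie_bracket G x (lie_bracket G v w) = 0" if "coord 1 v = 0" "coord 1 w = 0" for x v w
    unfolding bracket_kernel[OF that] by (simp only: linear_cmul[OF linear_bracket_right] bracket_top scaleR_zero_right)
  show "(lie_bracket G (X 1) ^^ (s+1)) x = 0" for x by (rule bracket_X1_nilpotent)
qed

definition horizontal :: "'a set" where "horizontal = span {X 1, X 2}"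

lemma subspace_horizontal: "subspace horizontal" by (simp add: horizontal_def)

lemma X_in_horizontal: "X 1 \<in> horizontal" "X 2 \<in> horizontal"
  by (auto simp: horizontal_def intro: span_base)

lemma horizontal_combination: "a *\<^sub>R X 1 + b *\<^sub>R X 2 \<in> horizontal"
  by (intro subspace_add subspace_mul subspace_horizontal X_in_horizontal)

lemma horizontal_expand:
  assumes "v \<in> horizontal"
  shows "v = coord 1 v *\<^sub>R X 1 + coord 2 v *\<^sub>R X 2"
proof -
  obtain a b where v: "v = a *\<^sub>R X 1 + b *\<^sub>R X 2"
    using assms unfolding horizontal_def span_insert by (auto simp: algebra_simps span_singleton)
  have "coord 1 v = a" "coord 2 v = b" using m_ge m_le by (simp_all add: v coord_X)
  with v show ?thesis by simp
qed

lemma Ad_top: "Ad x (X (s+1)) = X (s+1)"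
  using Ad_ray_fixed[OF bracket_top, of 1 x] by simp

lemma bracket_horizontal_X:
  assumes v: "v \<in> horizontal" and k: "2 \<le> k" "k \<le> m"
  shows "lie_bracket G v (X k) = coord 1 v *\<^sub>R X (k+1)"
proof -
  have "lie_bracket G v (X k) = coord 1 v *\<^sub>R lie_bracket G (X 1) (X k) + coord 2 v *\<^sub>R lie_bracket G (X 2) (X k)"
    by (subst horizontal_expand[OF v]) (simp only: linear_add[OF linear_bracket_left] linear_cmul[OF linear_bracket_left])
  then show ?thesis using bracket_X1[of k] bracket_rest[of 2 k] \<omega>_2[OF k] k m_le m_ge by simp
qed

context
  fixes u \<gamma> l
  assumes u: "u \<in> controls horizontal" and \<gamma>: "velocity \<gamma> u" "\<gamma> 0 = 0" and l: "l \<noteq> 0"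
    and annihilates: "\<And>t Y. t \<in> {0..1} \<Longrightarrow> Y \<in> horizontal \<Longrightarrow> l \<bullet> Ad (\<gamma> t) Y = 0"
begin

text \<open>The covector \<open>l\<close> transported along the curve and evaluated at the frame. In an abnormal
  curve the first two of these functions vanish, and their derivatives involve the subsequent
  ones.\<close>

definition momentum :: "nat \<Rightarrow> real \<Rightarrow> real" where "momentum k t = l \<bullet> Ad (\<gamma> t) (X k)"

lemma AC_momentum: "AC 0 1 (momentum k)"
proof -
  have \<gamma>ac: "AC 0 1 \<gamma>" using \<gamma>(1) by (simp add: velocity_def)
  have "AC 0 1 (\<lambda>t. - \<gamma> t)"
    by (rule AC_bounded_linear[OF \<gamma>ac]) (rule bounded_linear_minus[OF bounded_linear_ident])
  then have "AC 0 1 (\<lambda>t. Ad (\<gamma> t) (X k))" unfolding Ad_def by (intro AC_mult AC_const \<gamma>ac)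
  then show ?thesis unfolding momentum_def[abs_def] by (rule AC_bounded_linear) (rule bounded_linear_inner_right)
qed

lemma derivative_momentum:
  "AE t in lebesgue. t \<in> {0..1} \<longrightarrow>
    (momentum k has_vector_derivative l \<bullet> Ad (\<gamma> t) (lie_bracket G (u t) (X k))) (at t within {0..1})"
proof -
  have "AE t in lebesgue. t \<in> {0..1} \<longrightarrow> (\<gamma> has_vector_derivative left_diff G (\<gamma> t) (u t)) (at t within {0..1})"
    using \<gamma>(1) by (simp add: velocity_def)
  then show ?thesis
  proof eventually_elim
    case (elim t)
    show ?case
    proof
      assume "t \<in> {0..1}"
      with elim have "((\<lambda>t. Ad (\<gamma> t) (X k)) has_vector_derivative Ad (\<gamma> t) (lie_bracket G (u t) (X k))) (at t within {0..1})"
        by (intro left_invariant_derivative_Ad) blast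
      then show "(momentum k has_vector_derivative l \<bullet> Ad (\<gamma> t) (lie_bracket G (u t) (X k))) (at t within {0..1})"
        unfolding momentum_def[abs_def] by (rule bounded_linear.has_vector_derivative[OF bounded_linear_inner_right])
    qed
  qed
qed

lemma u_horizontal: "t \<in> {0..1} \<Longrightarrow> u t \<in> horizontal" using u by (simp add: controls_def)

lemma derivative_momentum_chain:
  assumes k: "2 \<le> k" "k \<le> m"
  shows "AE t in lebesgue. t \<in> {0..1} \<longrightarrow>
    (momentum k has_vector_derivative coord 1 (u t) * momentum (k+1) t) (at t within {0..1})"
  using derivative_momentum[of k]
proof eventually_elim
  case (elim t)
  then show ?case
    using bracket_horizontal_X[OF u_horizontal k, of t] by (auto simp: Ad_scaleR momentum_def)
qed

lemma momentum_0: "momentum k 0 = l \<bullet> X k" by (simp add: momentum_def \<gamma>(2))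

lemma momentum_1_2: "t \<in> {0..1} \<Longrightarrow> momentum 1 t = 0" "t \<in> {0..1} \<Longrightarrow> momentum 2 t = 0"
  using annihilates X_in_horizontal by (auto simp: momentum_def)

lemma momentum_vanishing_step:
  assumes k: "2 \<le> k" "k \<le> m" and zero: "\<And>t. t \<in> {0..1} \<Longrightarrow> momentum k t = 0"
  shows "AE t in lebesgue. t \<in> {0..1} \<longrightarrow> coord 1 (u t) * momentum (k+1) t = 0"
  using derivative_momentum_chain[OF k]
proof eventually_elim
  case (elim t)
  show ?case
  proof
    assume t: "t \<in> {0..1}"
    have d1: "((\<lambda>t. 0) has_vector_derivative coord 1 (u t) * momentum (k+1) t) (at t within {0..1})"
      by (rule has_vector_derivative_transform[OF t _ elim[rule_format, OF t]]) (simp add: zero)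
    have d2: "((\<lambda>t. 0::real) has_vector_derivative 0) (at t within {0..1})" by (rule has_vector_derivative_const)
    show "coord 1 (u t) * momentum (k+1) t = 0"
      by (rule vector_derivative_unique_within_closed_interval[OF _ _ d1[folded box_real(2)] d2[folded box_real(2)]]) (use t in auto)
  qed
qed

text \<open>The square of the \<open>k\<close>-th momentum has derivative \<open>2 P\<^sub>k P\<^sub>k\<^sub>+\<^sub>1 u\<^sub>1 = 0\<close>, hence is
  constant; if the constant is not zero, then \<open>coord 1 (u t) = 0\<close> almost everywhere.\<close>

lemma momentum_zero_or_u1_zero:
  assumes k: "2 \<le> k" "k \<le> m" and ae: "AE t in lebesgue. t \<in> {0..1} \<longrightarrow> coord 1 (u t) * momentum k t = 0"
  shows "(AE t in lebesgue. t \<in> {0..1} \<longrightarrow> coord 1 (u t) = 0) \<or> (\<forall>t\<in>{0..1}. momentum k t = 0)"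
proof -
  have "AC 0 1 (\<lambda>t. momentum k t * momentum k t)"
    by (rule AC_bounded_bilinear[OF AC_momentum AC_momentum bounded_bilinear_mult])
  moreover have "AE t in lebesgue. t \<in> {0..1} \<longrightarrow> ((\<lambda>t. momentum k t * momentum k t) has_vector_derivative 0) (at t within {0..1})"
    using derivative_momentum_chain[OF k] ae
  proof eventually_elim
    case (elim t)
    show ?case
    proof
      assume t: "t \<in> {0..1}"
      have d: "(momentum k has_vector_derivative coord 1 (u t) * momentum (k+1) t) (at t within {0..1})" using elim t by blast
      have "momentum k t * (coord 1 (u t) * momentum (k+1) t) + coord 1 (u t) * momentum (k+1) t * momentum k t = 0"
        using elim t by auto
      note eq = this
      show "((\<lambda>t. momentum k t * momentum k t) has_vector_derivative 0) (at t within {0..1})"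
        using bounded_bilinear.has_vector_derivative[OF bounded_bilinear_mult d d] unfolding eq .
    qed
  qed
  ultimately have const: "momentum k t * momentum k t = momentum k 0 * momentum k 0" if "t \<in> {0..1}" for t
    using that by (rule AC_zero_derivative_const)
  show ?thesis
  proof (cases "momentum k 0 = 0")
    case True
    then have "\<forall>t\<in>{0..1}. momentum k t = 0" using const by auto
    then show ?thesis by blast
  next
    case False
    have "AE t in lebesgue. t \<in> {0..1} \<longrightarrow> coord 1 (u t) = 0"
      using ae
    proof eventually_elim
      case (elim t)
      show ?case
      proof
        assume t: "t \<in> {0..1}"
        have "momentum k t \<noteq> 0" using const[OF t] False by auto
        with elim t show "coord 1 (u t) = 0" by auto
      qed
    qed
    then show ?thesis by blast
  qed
qed

text \<open>Alternate the two preceding lemmas along \<open>k = 2, \<dots>, m\<close>.\<close>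

lemma abnormal_chain:
  "(AE t in lebesgue. t \<in> {0..1} \<longrightarrow> coord 1 (u t) = 0) \<or>
   ((\<forall>k\<in>{1..m}. \<forall>t\<in>{0..1}. momentum k t = 0) \<and> (AE t in lebesgue. t \<in> {0..1} \<longrightarrow> coord 1 (u t) * momentum (m+1) t = 0))"
proof (cases "AE t in lebesgue. t \<in> {0..1} \<longrightarrow> coord 1 (u t) = 0")
  case True
  then show ?thesis by blast
next
  case no: False
  have zero: "\<forall>t\<in>{0..1}. momentum k t = 0" if "2 \<le> k" "k \<le> m" for k
    using that
  proof (induction k rule: dec_induct)
    case base then show ?case using momentum_1_2 by blast
  next
    case (step k)
    then have "AE t in lebesgue. t \<in> {0..1} \<longrightarrow> coord 1 (u t) * momentum (k+1) t = 0"
      by (intro momentum_vanishing_step) auto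
    with momentum_zero_or_u1_zero[of "k+1"] step no show ?case by auto
  qed
  have "momentum k t = 0" if "k \<in> {1..m}" "t \<in> {0..1}" for k t
  proof (cases "k = 1")
    case True then show ?thesis using momentum_1_2(1) that by simp
  next
    case False then show ?thesis using zero[of k] that by auto
  qed
  moreover have "AE t in lebesgue. t \<in> {0..1} \<longrightarrow> coord 1 (u t) * momentum (m+1) t = 0"
    using zero[of m] m_ge by (intro momentum_vanishing_step) auto
  ultimately show ?thesis by blast
qed

lemma l_frame_nonzero: "\<exists>k\<in>{1..s+1}. l \<bullet> X k \<noteq> 0"
proof (rule ccontr)
  assume "\<not> (\<exists>k\<in>{1..s+1}. l \<bullet> X k \<noteq> 0)"
  then have zero: "l \<bullet> X k = 0" if "k \<in> {1..s+1}" for k using that by blast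
  have "linear (\<lambda>x. l \<bullet> x)" by (rule bounded_linear.linear[OF bounded_linear_inner_right])
  from linear_zero_on_frame[OF this zero] have "l \<bullet> l = 0" .
  with l show False by simp
qed

lemma momentum_top: "momentum (s+1) t = l \<bullet> X (s+1)" by (simp add: momentum_def Ad_top[simplified])

lemma control_coord_integrable: "(\<lambda>t. coord i (u t)) absolutely_integrable_on {0..1}"
  by (rule absolutely_integrable_bounded_linear[OF _ bounded_linear_coord]) (use u in \<open>simp add: controls_def\<close>)

text \<open>In type I the chain ends at a central element, where the momentum is constant. If it were
  zero, then all momenta would vanish at time \<open>0\<close>, that is, \<open>l = 0\<close>.\<close>

lemma abnormal_u1_zero:
  assumes m: "m = s"
  shows "AE t in lebesgue. t \<in> {0..1} \<longrightarrow> coord 1 (u t) = 0"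
proof (rule ccontr)
  assume no: "\<not> ?thesis"
  with abnormal_chain have z: "\<forall>k\<in>{1..s}. \<forall>t\<in>{0..1}. momentum k t = 0"
    and ae: "AE t in lebesgue. t \<in> {0..1} \<longrightarrow> coord 1 (u t) * momentum (s+1) t = 0" by (auto simp: m)
  have "l \<bullet> X (s+1) \<noteq> 0"
  proof
    assume 0: "l \<bullet> X (s+1) = 0"
    have "l \<bullet> X k = 0" if "k \<in> {1..s+1}" for k
    proof (cases "k = s+1")
      case False
      then have "momentum k 0 = 0" using z that by auto
      then show ?thesis by (simp add: momentum_0)
    qed (use 0 in simp)
    then show False using l_frame_nonzero by blast
  qed
  then have "AE t in lebesgue. t \<in> {0..1} \<longrightarrow> coord 1 (u t) = 0"
    using ae unfolding momentum_top by simp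
  with no show False by blast
qed

text \<open>In type II the chain ends at \<open>X s\<close>, where the momentum is an affine function of the second
  coordinate of the curve, because \<open>[X\<^sub>2, X\<^sub>s]\<close> is central. So the curve can move along \<open>X 1\<close>
  only while its second coordinate equals a constant \<open>c\<close>.\<close>

lemma abnormal_u1_w2:
  assumes m: "m + 1 = s" and \<omega>: "\<omega> 2 s = 1"
  shows "\<exists>c. AE t in lebesgue. t \<in> {0..1} \<longrightarrow> coord 1 (u t) * (integral {0..t} (\<lambda>r. coord 2 (u r)) - c) = 0"
proof (cases "AE t in lebesgue. t \<in> {0..1} \<longrightarrow> coord 1 (u t) = 0")
  case True
  then have "AE t in lebesgue. t \<in> {0..1} \<longrightarrow> coord 1 (u t) * (integral {0..t} (\<lambda>r. coord 2 (u r)) - 0) = 0"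
    by eventually_elim auto
  then show ?thesis by blast
next
  case no: False
  with abnormal_chain have z: "\<forall>k\<in>{1..m}. \<forall>t\<in>{0..1}. momentum k t = 0"
    and ae: "AE t in lebesgue. t \<in> {0..1} \<longrightarrow> coord 1 (u t) * momentum s t = 0" by (auto simp: m[symmetric])
  define \<mu> where "\<mu> = l \<bullet> X (s+1)"
  have Ps: "momentum s t = l \<bullet> X s + \<mu> * integral {0..t} (\<lambda>r. coord 2 (u r))" if t: "t \<in> {0..1}" for t
  proof -
    have br: "l \<bullet> Ad (\<gamma> t) (lie_bracket G v (X s)) = \<mu> * coord 2 v" if v: "v \<in> horizontal" for v t
    proof -
      have "lie_bracket G v (X s) = coord 1 v *\<^sub>R lie_bracket G (X 1) (X s) + coord 2 v *\<^sub>R lie_bracket G (X 2) (X s)"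
        by (subst horizontal_expand[OF v]) (simp only: linear_add[OF linear_bracket_left] linear_cmul[OF linear_bracket_left])
      also have "\<dots> = coord 2 v *\<^sub>R X (s+1)"
        using bracket_X1[of s] bracket_rest[of 2 s] \<omega> m m_ge by simp
      finally show ?thesis by (simp add: Ad_scaleR Ad_top[simplified] \<mu>_def)
    qed
    have "AE t in lebesgue. t \<in> {0..1} \<longrightarrow> (momentum s has_vector_derivative \<mu> * coord 2 (u t)) (at t within {0..1})"
      using derivative_momentum[of s]
    proof eventually_elim
      case (elim t) then show ?case using br[OF u_horizontal, of t t] by auto
    qed
    moreover have "(\<lambda>t. \<mu> * coord 2 (u t)) absolutely_integrable_on {0..1}"
      by (rule absolutely_integrable_bounded_linear[OF control_coord_integrable bounded_linear_mult_right])
    ultimately have "momentum s t = momentum s 0 + integral {0..t} (\<lambda>r. \<mu> * coord 2 (u r))"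
      using AC_eq_integral_derivative[OF AC_momentum] t by blast
    then show ?thesis by (simp add: momentum_0)
  qed
  show ?thesis
  proof (cases "\<mu> = 0")
    case False
    have "AE t in lebesgue. t \<in> {0..1} \<longrightarrow>
        coord 1 (u t) * (integral {0..t} (\<lambda>r. coord 2 (u r)) - (- (l \<bullet> X s) / \<mu>)) = 0"
      using ae
    proof eventually_elim
      case (elim t)
      show ?case
      proof
        assume t: "t \<in> {0..1}"
        have "momentum s t = \<mu> * (integral {0..t} (\<lambda>r. coord 2 (u r)) - (- (l \<bullet> X s) / \<mu>))"
          unfolding Ps[OF t] using False by (simp add: field_simps)
        with elim t False show "coord 1 (u t) * (integral {0..t} (\<lambda>r. coord 2 (u r)) - (- (l \<bullet> X s) / \<mu>)) = 0" by auto
      qed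
    qed
    then show ?thesis by blast
  next
    case True
    have "l \<bullet> X s \<noteq> 0"
    proof
      assume 0: "l \<bullet> X s = 0"
      have "l \<bullet> X k = 0" if k: "k \<in> {1..s+1}" for k
      proof -
        consider "k \<in> {1..m}" | "k = s" | "k = s+1" using k m by fastforce
        then show ?thesis
        proof cases
          case 1
          then have "momentum k 0 = 0" using z by auto
          then show ?thesis by (simp add: momentum_0)
        qed (use 0 True in \<open>auto simp: \<mu>_def\<close>)
      qed
      then show False using l_frame_nonzero by blast
    qed
    with ae have "AE t in lebesgue. t \<in> {0..1} \<longrightarrow> coord 1 (u t) = 0"
    proof (elim eventually_mono, intro impI)
      fix t assume *: "t \<in> {0..1} \<longrightarrow> coord 1 (u t) * momentum s t = 0" and "t \<in> {0..1}" and "l \<bullet> X s \<noteq> 0"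
      then show "coord 1 (u t) = 0" using Ps[of t] True by simp
    qed
    with no show ?thesis by blast
  qed
qed

end

end

section \<open>Endpoints of abnormal curves\<close>

context filiform_frame begin

lemma bracket_X2_X1: "lie_bracket G (X 2) (X 1) = - X 3"
  using lie_bracket_skew[of "X 2" "X 1"] bracket_X1[of 2] m_ge m_le by simp

lemma bracket_X2_X3: "lie_bracket G (X 2) (X 3) = 0"
  using bracket_rest[of 2 3] \<omega>_2[of 3] m_ge m_le by simp

lemma Ad_X2_X1: "Ad (v *\<^sub>R X 2) (X 1) = X 1 - v *\<^sub>R X 3"
proof -
  have two: "(f ^^ 2) x = f (f x)" "(\<Sum>k<2. h k) = h 0 + h 1" for f and x :: 'a and h :: "nat \<Rightarrow> 'a"
    by (simp_all add: numeral_2_eq_2)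
  have "(lie_bracket G (X 2) ^^ 2) (X 1) = 0"
    unfolding two bracket_X2_X1 linear_neg[OF linear_bracket_right] bracket_X2_X3 by simp
  from Ad_ray_nilpotent[OF this, of v] show ?thesis
    unfolding two by (simp add: bracket_X2_X1[simplified])
qed

lemma coord_top_Ad_X1:
  assumes y: "y = 0 \<or> m + 1 = s" and j: "j \<in> {2, 3}"
  shows "coord (s+1) (Ad (y *\<^sub>R X 1) (X j)) = 0"
proof (cases "y = 0")
  case True
  then show ?thesis using coord_X[of "s+1" j] j m_ge m_le by auto
next
  case False
  then have m: "m + 1 \<le> s" using y by simp
  have "coord (s+1) ((lie_bracket G (X 1) ^^ k) (X j)) = 0" for k
    using bracket_X1_power[of j k] j m_ge m by (auto simp: coord_X)
  then show ?thesis
    unfolding Ad_ray_nilpotent[OF bracket_X1_nilpotent] coord_sum by simp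
qed

text \<open>In type II the bracket with \<open>X 1\<close> maps the span of \<open>X 1, \<dots>, X s\<close> into itself, and in type
  I this lemma is used only with \<open>y = 0\<close>.\<close>

lemma coord_top_Ad_horizontal:
  assumes y: "y = 0 \<or> m + 1 = s" and Y: "Y \<in> horizontal"
  shows "coord (s+1) (Ad (y *\<^sub>R X 1) (Ad (v *\<^sub>R X 2) Y)) = 0"
proof -
  have A1: "Ad (v *\<^sub>R X 2) (X 2) = X 2" by (rule Ad_ray_fixed[OF bracket_self])
  have A2: "Ad (y *\<^sub>R X 1) (X 1) = X 1" by (rule Ad_ray_fixed[OF bracket_self])
  have "Ad (v *\<^sub>R X 2) Y = coord 1 Y *\<^sub>R (X 1 - v *\<^sub>R X 3) + coord 2 Y *\<^sub>R X 2"
    by (subst horizontal_expand[OF Y]) (simp only: linear_add[OF linear_Ad] Ad_scaleR Ad_X2_X1 A1)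
  then have "Ad (y *\<^sub>R X 1) (Ad (v *\<^sub>R X 2) Y) = coord 1 Y *\<^sub>R (X 1 - v *\<^sub>R Ad (y *\<^sub>R X 1) (X 3))
      + coord 2 Y *\<^sub>R Ad (y *\<^sub>R X 1) (X 2)"
    by (simp only: linear_add[OF linear_Ad] linear_diff[OF linear_Ad] Ad_scaleR A2)
  moreover have "coord (s+1) (X 1) = 0" using coord_X[of "s+1" 1] m_ge m_le by simp
  ultimately show ?thesis
    using coord_top_Ad_X1[OF y, of 3] coord_top_Ad_X1[OF y, of 2] by simp
qed

text \<open>Whenever the curve moves along \<open>X 1\<close>, the last factor is trivial, so the conjugation by it
  is not felt.\<close>

lemma velocity_X2_X1_X2:
  assumes u1: "u1 absolutely_integrable_on {0..1}" and u2: "u2 absolutely_integrable_on {0..1}"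
    and ae: "AE t in lebesgue. t \<in> {0..1} \<longrightarrow> u1 t * (integral {0..t} u2 - c) = 0"
  shows "velocity (\<lambda>t. (c *\<^sub>R X 2) \<otimes> (integral {0..t} u1 *\<^sub>R X 1) \<otimes> ((integral {0..t} u2 - c) *\<^sub>R X 2))
    (\<lambda>t. u1 t *\<^sub>R X 1 + u2 t *\<^sub>R X 2)"
proof -
  have 1: "velocity (\<lambda>t. integral {0..t} u1 *\<^sub>R X 1) (\<lambda>t. u1 t *\<^sub>R X 1)"
    using velocity_ray_integral[OF u1, of 0 "X 1"] by simp
  have 2: "velocity (\<lambda>t. (integral {0..t} u2 - c) *\<^sub>R X 2) (\<lambda>t. u2 t *\<^sub>R X 2)"
    using velocity_ray_integral[OF u2, of "- c" "X 2"] by simp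
  have "velocity (\<lambda>t. (c *\<^sub>R X 2) \<otimes> (integral {0..t} u1 *\<^sub>R X 1)) (\<lambda>t. u1 t *\<^sub>R X 1)"
    using velocity_mult[OF velocity_const 1, of "c *\<^sub>R X 2"] by (simp add: linear_0[OF linear_Ad])
  from velocity_mult[OF this 2]
  show ?thesis
  proof (rule velocity_cong_AE)
    show "AE t in lebesgue. t \<in> {0..1} \<longrightarrow>
      Ad (- ((integral {0..t} u2 - c) *\<^sub>R X 2)) (u1 t *\<^sub>R X 1) + u2 t *\<^sub>R X 2 = u1 t *\<^sub>R X 1 + u2 t *\<^sub>R X 2"
      using ae
    proof eventually_elim
      case (elim t)
      show ?case
      proof
        assume "t \<in> {0..1}"
        with elim have "u1 t = 0 \<or> integral {0..t} u2 - c = 0" by simp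
        then have "Ad (- ((integral {0..t} u2 - c) *\<^sub>R X 2)) (u1 t *\<^sub>R X 1) = u1 t *\<^sub>R X 1"
          by (elim disjE) (simp_all only: scaleR_zero_left minus_zero Ad_0 linear_0[OF linear_Ad])
        then show "Ad (- ((integral {0..t} u2 - c) *\<^sub>R X 2)) (u1 t *\<^sub>R X 1) + u2 t *\<^sub>R X 2 = u1 t *\<^sub>R X 1 + u2 t *\<^sub>R X 2"
          by simp
      qed
    qed
  qed
qed

text \<open>The curve of the preceding lemma has the same control, so uniqueness identifies the two.\<close>

lemma control_endpoint_X2_X1_X2:
  assumes u: "u \<in> controls horizontal" and \<gamma>: "velocity \<gamma> u" "\<gamma> 0 = 0"
    and ae: "AE t in lebesgue. t \<in> {0..1} \<longrightarrow> coord 1 (u t) * (integral {0..t} (\<lambda>r. coord 2 (u r)) - c) = 0"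
  shows "\<gamma> 1 = (c *\<^sub>R X 2) \<otimes> (integral {0..1} (\<lambda>r. coord 1 (u r)) *\<^sub>R X 1)
    \<otimes> ((integral {0..1} (\<lambda>r. coord 2 (u r)) - c) *\<^sub>R X 2)"
proof -
  have ui: "(\<lambda>t. coord i (u t)) absolutely_integrable_on {0..1}" for i
    by (rule absolutely_integrable_bounded_linear[OF _ bounded_linear_coord]) (use u in \<open>simp add: controls_def\<close>)
  have "velocity (\<lambda>t. (c *\<^sub>R X 2) \<otimes> (integral {0..t} (\<lambda>r. coord 1 (u r)) *\<^sub>R X 1)
      \<otimes> ((integral {0..t} (\<lambda>r. coord 2 (u r)) - c) *\<^sub>R X 2)) u"
  proof (rule velocity_cong_AE[OF velocity_X2_X1_X2[OF ui ui ae]])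
    have "coord 1 (u t) *\<^sub>R X 1 + coord 2 (u t) *\<^sub>R X 2 = u t" if "t \<in> {0..1}" for t
      using horizontal_expand[of "u t"] u that by (simp add: controls_def)
    then show "AE t in lebesgue. t \<in> {0..1} \<longrightarrow> coord 1 (u t) *\<^sub>R X 1 + coord 2 (u t) *\<^sub>R X 2 = u t"
      by (intro AE_I2) blast
  qed
  from velocity_unique[OF \<gamma>(1) this, of 1] show ?thesis by (simp add: \<gamma>(2))
qed

lemma abnormal_set_subset_line:
  assumes m: "m = s"
  shows "abnormal_set G horizontal \<subseteq> {t *\<^sub>R X 2 |t. True}"
proof
  fix x assume "x \<in> abnormal_set G horizontal"
  then obtain \<gamma> u l where *: "x = \<gamma> 1" "u \<in> controls horizontal" "velocity \<gamma> u" "\<gamma> 0 = 0" "l \<noteq> 0"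
    "\<And>t Y. t \<in> {0..1} \<Longrightarrow> Y \<in> horizontal \<Longrightarrow> l \<bullet> Ad (\<gamma> t) Y = 0"
    unfolding abnormal_set_eq[OF subspace_horizontal] by blast
  have ae: "AE t in lebesgue. t \<in> {0..1} \<longrightarrow> coord 1 (u t) = 0"
    by (rule abnormal_u1_zero[OF *(2-6) m])
  then have ae0: "AE t in lebesgue. t \<in> {0..1} \<longrightarrow> coord 1 (u t) * (integral {0..t} (\<lambda>r. coord 2 (u r)) - 0) = 0"
    by eventually_elim auto
  obtain N where N: "negligible N" "\<And>t. t \<notin> N \<Longrightarrow> t \<in> {0..1} \<Longrightarrow> coord 1 (u t) = 0"
    using AE_lebesgue_negligible[OF ae] by blast
  have "integral {0..1} (\<lambda>r. coord 1 (u r)) = integral {0..1} (\<lambda>r::real. 0)"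
    by (rule integral_spike[OF N(1)]) (use N(2) in auto)
  then have "x = integral {0..1} (\<lambda>r. coord 2 (u r)) *\<^sub>R X 2"
    using control_endpoint_X2_X1_X2[OF *(2-4) ae0] *(1) by simp
  then show "x \<in> {t *\<^sub>R X 2 |t. True}" by blast
qed

lemma abnormal_set_subset_X2_X1_X2:
  assumes "m + 1 = s" "\<omega> 2 s = 1"
  shows "abnormal_set G horizontal \<subseteq> {(c *\<^sub>R X 2) \<otimes> (b *\<^sub>R X 1) \<otimes> (d *\<^sub>R X 2) |c b d. True}"
proof
  fix x assume "x \<in> abnormal_set G horizontal"
  then obtain \<gamma> u l where *: "x = \<gamma> 1" "u \<in> controls horizontal" "velocity \<gamma> u" "\<gamma> 0 = 0" "l \<noteq> 0"
    "\<And>t Y. t \<in> {0..1} \<Longrightarrow> Y \<in> horizontal \<Longrightarrow> l \<bullet> Ad (\<gamma> t) Y = 0"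
    unfolding abnormal_set_eq[OF subspace_horizontal] by blast
  obtain c where "AE t in lebesgue. t \<in> {0..1} \<longrightarrow> coord 1 (u t) * (integral {0..t} (\<lambda>r. coord 2 (u r)) - c) = 0"
    using abnormal_u1_w2[OF *(2-6) assms] by blast
  from control_endpoint_X2_X1_X2[OF *(2-4) this] *(1)
  show "x \<in> {(c *\<^sub>R X 2) \<otimes> (b *\<^sub>R X 1) \<otimes> (d *\<^sub>R X 2) |c b d. True}" by blast
qed

text \<open>Run along \<open>X 2\<close>, \<open>X 1\<close> and \<open>X 2\<close> during one third of the time each. The covector is the
  coordinate of \<open>X (s+1)\<close> transported back by \<open>Ad (- (c *\<^sub>R X 2))\<close>.\<close>

lemma X2_X1_X2_abnormal:
  assumes b: "b = 0 \<or> m + 1 = s"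
  shows "(c *\<^sub>R X 2) \<otimes> (b *\<^sub>R X 1) \<otimes> (d *\<^sub>R X 2) \<in> abnormal_set G horizontal"
proof -
  define u1 where "u1 = (\<lambda>x::real. if x \<in> {1/3..2/3} then 3 * b else 0)"
  define u2 where "u2 = (\<lambda>x::real. (if x \<in> {0..1/3} then 3 * c else 0) + (if x \<in> {2/3..1} then 3 * d else 0))"
  have u1: "u1 absolutely_integrable_on {0..1}" unfolding u1_def by (rule step_function_absolutely_integrable)
  have u2: "u2 absolutely_integrable_on {0..1}" unfolding u2_def
    by (intro set_integral_add step_function_absolutely_integrable)
  have y: "integral {0..t} u1 = 3 * b * max 0 (min t (2/3) - 1/3)" if "t \<in> {0..1}" for t
    unfolding u1_def using that by (intro step_function_integral) auto
  have w: "integral {0..t} u2 = 3 * c * max 0 (min t (1/3) - 0) + 3 * d * max 0 (min t 1 - 2/3)" if t: "t \<in> {0..1}" for t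
  proof -
    have i: "(\<lambda>x. if x \<in> {p..q} then k else 0) integrable_on {0..t}" for p q k :: real
    proof -
      have "(\<lambda>x. if x \<in> {p..q} then k else 0) integrable_on {0..1}"
        using step_function_absolutely_integrable[of p q k] by (simp only: absolutely_integrable_on_def)
      from integrable_on_Icc_subset[OF this t] show ?thesis .
    qed
    show ?thesis
      unfolding u2_def integral_add[OF i i] using t
      by (intro arg_cong2[where f = "(+)"] step_function_integral) auto
  qed
  define \<gamma> where "\<gamma> = (\<lambda>t. (c *\<^sub>R X 2) \<otimes> (integral {0..t} u1 *\<^sub>R X 1) \<otimes> ((integral {0..t} u2 - c) *\<^sub>R X 2))"
  define u where "u = (\<lambda>t. u1 t *\<^sub>R X 1 + u2 t *\<^sub>R X 2)"
  have "u1 t * (integral {0..t} u2 - c) = 0" if t: "t \<in> {0..1}" for t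
    unfolding w[OF t] by (auto simp: u1_def max_def min_def)
  then have vel: "velocity \<gamma> u"
    unfolding \<gamma>_def u_def by (intro velocity_X2_X1_X2 u1 u2 AE_I2) blast
  have "u1 t *\<^sub>R X 1 + u2 t *\<^sub>R X 2 \<in> horizontal" for t by (rule horizontal_combination)
  then have uc: "u \<in> controls horizontal"
    unfolding controls_def u_def
    using set_integral_add(1)[OF absolutely_integrable_bounded_linear[OF u1 bounded_linear_scaleR_left]
        absolutely_integrable_bounded_linear[OF u2 bounded_linear_scaleR_left]]
    by simp
  have \<gamma>0: "\<gamma> 0 = 0" using w[of 0] y[of 0] by (simp add: \<gamma>_def scaleR_mult_scaleR[where b = "- c", simplified])
  have "linear (\<lambda>x. coord (s+1) (Ad (- (c *\<^sub>R X 2)) x))"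
    using linear_compose[OF linear_Ad linear_coord] by (simp add: o_def)
  then obtain l where l: "\<And>x. coord (s+1) (Ad (- (c *\<^sub>R X 2)) x) = l \<bullet> x"
    using linear_functional_inner by blast
  have "l \<bullet> X (s+1) = 1" using l[of "X (s+1)"] by (simp only: Ad_top) (simp add: coord_X)
  then have l0: "l \<noteq> 0" by auto
  have "l \<bullet> Ad (\<gamma> t) Y = 0" if t: "t \<in> {0..1}" and Y: "Y \<in> horizontal" for t Y
  proof -
    have "l \<bullet> Ad (\<gamma> t) Y = coord (s+1) (Ad (integral {0..t} u1 *\<^sub>R X 1) (Ad ((integral {0..t} u2 - c) *\<^sub>R X 2) Y))"
      unfolding l[symmetric] \<gamma>_def Ad_mult Ad_minus_cancel by (rule refl)
    also have "\<dots> = 0" by (rule coord_top_Ad_horizontal[OF _ Y]) (use b y[OF t] in auto)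
    finally show ?thesis .
  qed
  then have "\<gamma> 1 \<in> abnormal_set G horizontal"
    unfolding abnormal_set_eq[OF subspace_horizontal] using uc vel \<gamma>0 l0 by blast
  moreover have "\<gamma> 1 = (c *\<^sub>R X 2) \<otimes> (b *\<^sub>R X 1) \<otimes> (d *\<^sub>R X 2)"
    using w[of 1] y[of 1] by (simp add: \<gamma>_def)
  ultimately show ?thesis by simp
qed

lemma abnormal_set_line:
  assumes "m = s"
  shows "abnormal_set G horizontal = {t *\<^sub>R X 2 |t. True}"
proof
  show "{t *\<^sub>R X 2 |t. True} \<subseteq> abnormal_set G horizontal"
  proof
    fix x assume "x \<in> {t *\<^sub>R X 2 |t. True}"
    then obtain t where "x = t *\<^sub>R X 2" by blast
    then show "x \<in> abnormal_set G horizontal" using X2_X1_X2_abnormal[of 0 0 t] by simp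
  qed
qed (rule abnormal_set_subset_line[OF assms])

lemma abnormal_set_X2_X1_X2:
  assumes "m + 1 = s" "\<omega> 2 s = 1"
  shows "abnormal_set G horizontal = {(c *\<^sub>R X 2) \<otimes> (b *\<^sub>R X 1) \<otimes> (d *\<^sub>R X 2) |c b d. True}"
  using abnormal_set_subset_X2_X1_X2[OF assms] X2_X1_X2_abnormal assms(1) by blast

end

section \<open>The abnormal sets of filiform groups\<close>

context filiform_frame begin

lemma coord_3_bracket_X1: "coord 3 (lie_bracket G (X 1) x) = coord 2 x"
proof (rule linear_eq_on_frame)
  show "linear (\<lambda>x. coord 3 (lie_bracket G (X 1) x))"
    using linear_compose[OF linear_bracket_right linear_coord] by (simp add: o_def)
  show "linear (coord 2)" by (rule linear_coord)
  fix i assume i: "i \<in> {1..s+1}"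
  then show "coord 3 (lie_bracket G (X 1) (X i)) = coord 2 (X i)"
  proof (cases rule: frame_index_cases)
    case 1
    then show ?thesis using bracket_self[of "X 1"] coord_X[of 2 1] m_ge m_le by simp
  next
    case 2
    show ?thesis
    proof (cases "i \<le> m")
      case True
      then show ?thesis using bracket_X1[of i] coord_X[of 3 "i+1"] coord_X[of 2 i] 2 m_ge m_le by simp
    next
      case False
      then show ?thesis using bracket_X1[of i] coord_X[of 2 i] 2 m_ge m_le by simp
    qed
  qed
qed

lemma coord_kernel_bracket:
  assumes "coord 1 v = 0" "coord 1 w = 0" "q \<in> {1..s}"
  shows "coord q (lie_bracket G v w) = 0"
  unfolding bracket_kernel[OF assms(1,2)] using coord_X[of q "s+1"] assms(3) by simp

text \<open>The bracket with \<open>X 1\<close> shifts the frame, so only its zeroth and first powers contribute to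
  the coordinates \<open>2\<close> and \<open>3\<close>.\<close>

lemma coord_line_average:
  assumes v: "coord 1 v = 0"
  shows "coord 2 (line_average b v) = coord 2 v" "coord 3 (line_average b v) = coord 3 v + b / 2 * coord 2 v"
proof -
  have ade2: "coord 2 (ade (Suc k) v) = 0" for k
    using coord_12_bracket[of 2] by simp
  have ade3: "coord 3 (ade (Suc (Suc k)) v) = 0" for k
  proof -
    have "coord 3 (ade (Suc (Suc k)) v) = coord 2 (ade (Suc k) v)"
      using coord_3_bracket_X1 by simp
    then show ?thesis using ade2 by simp
  qed
  have ade2': "coord 2 (ade 1 v) = 0" using ade2[of 0] by simp
  have ade3': "coord 3 (ade 1 v) = coord 2 v" using coord_3_bracket_X1[of v] by simp
  obtain n where n: "s + 1 = Suc (Suc n)" using m_ge m_le by (metis Suc_eq_plus1 Suc_le_D le_trans numeral_3_eq_3)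
  have split: "(\<Sum>k<s+1. f k) = f 0 + (f 1 + (\<Sum>k<n. f (Suc (Suc k))))" for f :: "nat \<Rightarrow> real"
    unfolding n by (simp only: sum.lessThan_Suc_shift One_nat_def)
  show "coord 2 (line_average b v) = coord 2 v"
    unfolding line_average_def coord_sum coord_simps split ade2 ade2' by simp
  show "coord 3 (line_average b v) = coord 3 v + b / 2 * coord 2 v"
    unfolding line_average_def coord_sum coord_simps split ade3 ade3' by simp
qed

text \<open>On products \<open>w \<otimes> (b *\<^sub>R X 1)\<close> with \<open>coord 1 w = 0\<close> these are \<open>b\<close> and the second and third
  coordinates of \<open>w\<close>.\<close>

definition chart :: "'a \<Rightarrow> real \<times> real \<times> real" where
  "chart x = (coord 1 x, coord 2 x, coord 3 x + coord 1 x * coord 2 x / 2)"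

lemma chart_kernel_mult_line:
  assumes w: "coord 1 w = 0"
  shows "chart (w \<otimes> (b *\<^sub>R X 1)) = (b, coord 2 w, coord 3 w)"
proof -
  define v where "v = line_average_inverse b w - (1/2) *\<^sub>R bracket_average b (line_average_inverse b w)"
  have x: "w \<otimes> (b *\<^sub>R X 1) = b *\<^sub>R X 1 + v" unfolding v_def by (rule kernel_mult_line[OF w])
  have \<pi>i: "coord 1 (line_average_inverse b w) = 0" by (rule \<pi>_line_average_inverse[OF w])
  have avg0: "coord q (bracket_average b z) = 0" if "coord 1 z = 0" "q \<in> {1..s}" for z q
  proof -
    have "coord q (lie_bracket G (ade k z) (ade l z)) = 0" for k l
      by (rule coord_kernel_bracket[OF \<pi>_ade[OF that(1)] \<pi>_ade[OF that(1)] that(2)])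
    then show ?thesis unfolding bracket_average_def coord_sum coord_simps by (simp only: mult_zero_right sum.neutral_const)
  qed
  have v1: "coord 1 v = 0"
    unfolding v_def using \<pi>i avg0[OF \<pi>i, of 1] m_ge m_le by simp
  have "(line_average b v + (1/2) *\<^sub>R bracket_average b v) \<otimes> (b *\<^sub>R X 1) = w \<otimes> (b *\<^sub>R X 1)"
    unfolding x by (rule exponential_splitting[OF v1, symmetric])
  then have "(line_average b v + (1/2) *\<^sub>R bracket_average b v) \<otimes> (b *\<^sub>R X 1) \<otimes> - (b *\<^sub>R X 1) = w \<otimes> (b *\<^sub>R X 1) \<otimes> - (b *\<^sub>R X 1)"
    by simp
  then have w_eq: "w = line_average b v + (1/2) *\<^sub>R bracket_average b v"
    by (simp only: mult_assoc mult_minus mult_0)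
  have avgv: "coord 2 (bracket_average b v) = 0" "coord 3 (bracket_average b v) = 0"
    using avg0[OF v1] m_ge m_le by auto
  have w23: "coord 2 w = coord 2 v" "coord 3 w = coord 3 v + b / 2 * coord 2 v"
    unfolding w_eq using avgv coord_line_average[OF v1, of b] by simp_all
  have c: "coord 1 (b *\<^sub>R X 1 + v) = b" "coord 2 (b *\<^sub>R X 1 + v) = coord 2 v" "coord 3 (b *\<^sub>R X 1 + v) = coord 3 v"
    using v1 coord_X[of 1 1] coord_X[of 2 1] coord_X[of 3 1] m_ge m_le by simp_all
  show ?thesis unfolding chart_def x c w23 by simp
qed

text \<open>With \<open>p = c + d\<close> and \<open>q = d * b\<close>, this is the kernel part of
  \<open>exp (c X\<^sub>2) exp (b X\<^sub>1) exp (d X\<^sub>2)\<close>. In these variables it is polynomial also at \<open>b = 0\<close>,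
  where \<open>d\<close> cannot be recovered from \<open>q\<close>.\<close>

definition graph_section :: "real \<Rightarrow> real \<Rightarrow> real \<Rightarrow> 'a" where
  "graph_section b p q = p *\<^sub>R X 2 + (\<Sum>k\<in>{1..s-2}. (q * b ^ (k-1) / fact k) *\<^sub>R X (k+2))
    + ((p * q * b ^ (s-3) - q\<^sup>2 * b ^ (s-4)) / (2 * fact (s-2))) *\<^sub>R X (s+1)"

lemma coord_graph_section:
  assumes s: "s \<ge> 5"
  shows "coord 1 (graph_section b p q) = 0" "coord 2 (graph_section b p q) = p" "coord 3 (graph_section b p q) = q"
proof -
  have c: "coord i (X (k+2)) = (if k + 2 = i then 1 else 0)" if "i \<in> {1,2,3}" "k \<in> {1..s-2}" for i k
    using that s by (subst coord_X) auto
  have top: "coord i (X (s+1)) = 0" "coord i (X 2) = (if i = 2 then 1 else 0)" if "i \<in> {1,2,3}" for i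
    using that s by (subst coord_X; auto)+
  have sum: "coord i (\<Sum>k\<in>{1..s-2}. (q * b ^ (k-1) / fact k) *\<^sub>R X (k+2)) = (if i = 3 then q else 0)" if i: "i \<in> {1,2,3}" for i
  proof -
    have "coord i (\<Sum>k\<in>{1..s-2}. (q * b ^ (k-1) / fact k) *\<^sub>R X (k+2))
        = (\<Sum>k\<in>{1..s-2}. if k = 1 then (if i = 3 then q else 0) else 0)"
      unfolding coord_sum
    proof (rule sum.cong[OF refl])
      fix k assume k: "k \<in> {1..s-2}"
      have "coord i ((q * b ^ (k-1) / fact k) *\<^sub>R X (k+2)) = (q * b ^ (k-1) / fact k) * (if k + 2 = i then 1 else 0)"
        unfolding coord_simps c[OF i k] by (rule refl)
      then show "coord i ((q * b ^ (k-1) / fact k) *\<^sub>R X (k+2)) = (if k = 1 then (if i = 3 then q else 0) else 0)"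
        using i k by (cases "k = 1") auto
    qed
    also have "\<dots> = (if i = 3 then q else 0)"
    proof -
      have "Suc 0 \<le> s - 2" using s by simp
      then show ?thesis by simp
    qed
    finally show ?thesis .
  qed
  show "coord 1 (graph_section b p q) = 0" "coord 2 (graph_section b p q) = p" "coord 3 (graph_section b p q) = q"
    unfolding graph_section_def coord_simps using sum top by simp_all
qed

text \<open>Move the last factor to the left of \<open>b *\<^sub>R X 1\<close> and apply the product formula of the
  kernel.\<close>

lemma X2_X1_X2_eq_graph_section:
  assumes s: "s \<ge> 5" and m: "m + 1 = s" and \<omega>: "\<omega> 2 s = 1"
  shows "(c *\<^sub>R X 2) \<otimes> (b *\<^sub>R X 1) \<otimes> (d *\<^sub>R X 2) = graph_section b (c + d) (d * b) \<otimes> (b *\<^sub>R X 1)"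
proof -
  define V where "V = Ad (b *\<^sub>R X 1) (d *\<^sub>R X 2)"
  have "(c *\<^sub>R X 2) \<otimes> (b *\<^sub>R X 1) \<otimes> (d *\<^sub>R X 2) = (c *\<^sub>R X 2 \<otimes> V) \<otimes> (b *\<^sub>R X 1)"
    unfolding V_def by (simp only: mult_assoc Ad_mult_right)
  also have "c *\<^sub>R X 2 \<otimes> V = graph_section b (c + d) (d * b)"
  proof -
    have "V = (\<Sum>k<s+1. (d * (b ^ k / fact k)) *\<^sub>R ade k (X 2))"
      unfolding V_def Ad_scaleR Ad_ray_nilpotent[OF bracket_X1_nilpotent] scaleR_sum_right scaleR_scaleR by (rule refl)
    also have "\<dots> = (\<Sum>k\<in>{0..s-2}. (d * (b ^ k / fact k)) *\<^sub>R X (k+2))"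
    proof (rule sum.mono_neutral_cong_right)
      fix k assume "k \<in> {0..s-2}"
      then show "(d * (b ^ k / fact k)) *\<^sub>R ade k (X 2) = (d * (b ^ k / fact k)) *\<^sub>R X (k+2)"
      proof -
        assume "k \<in> {0..s-2}"
        then have "2 + k \<le> m + 1" using m m_ge by auto
        then have "ade k (X 2) = X (k+2)" using bracket_X1_power[of 2 k] m_ge by (simp add: add.commute)
        then show ?thesis by (simp only:)
      qed
    next
      show "\<forall>k\<in>{..<s+1} - {0..s-2}. (d * (b ^ k / fact k)) *\<^sub>R ade k (X 2) = 0"
      proof
        fix k assume "k \<in> {..<s+1} - {0..s-2}"
        then have "\<not> 2 + k \<le> m + 1" using m m_ge by auto
        then have "ade k (X 2) = 0" using bracket_X1_power[of 2 k] m_ge by simp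
        then show "(d * (b ^ k / fact k)) *\<^sub>R ade k (X 2) = 0" by (simp only: scaleR_zero_right)
      qed
    qed (use s in auto)
    finally have V: "V = (\<Sum>k\<in>{0..s-2}. (d * (b ^ k / fact k)) *\<^sub>R X (k+2))" .
    have X2b: "lie_bracket G (X 2) (X (k+2)) = (if k = s - 2 then X (s+1) else 0)" if "k \<in> {0..s-2}" for k
    proof (cases "k = s - 2")
      case True
      then have "k + 2 = s" using s by simp
      then show ?thesis using bracket_rest[of 2 s] \<omega> s True by simp
    next
      case False
      then have "k + 2 \<le> m" using that s m by auto
      then show ?thesis using bracket_rest[of 2 "k+2"] \<omega>_2[of "k+2"] False m_le s by simp
    qed
    have "lie_bracket G (c *\<^sub>R X 2) V = c *\<^sub>R (\<Sum>k\<in>{0..s-2}. (d * (b ^ k / fact k)) *\<^sub>R lie_bracket G (X 2) (X (k+2)))"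
      unfolding V linear_cmul[OF linear_bracket_left]
      by (simp only: linear_sum[OF linear_bracket_right] linear_cmul[OF linear_bracket_right])
    also have "(\<Sum>k\<in>{0..s-2}. (d * (b ^ k / fact k)) *\<^sub>R lie_bracket G (X 2) (X (k+2)))
        = (\<Sum>k\<in>{0..s-2}. if k = s - 2 then (d * (b ^ (s-2) / fact (s-2))) *\<^sub>R X (s+1) else 0)"
      by (rule sum.cong[OF refl]) (subst X2b, simp_all)
    also have "\<dots> = (d * (b ^ (s-2) / fact (s-2))) *\<^sub>R X (s+1)" by simp
    finally have br: "lie_bracket G (c *\<^sub>R X 2) V = (c * (d * (b ^ (s-2) / fact (s-2)))) *\<^sub>R X (s+1)" by simp
    have V': "V = d *\<^sub>R X 2 + (\<Sum>k\<in>{1..s-2}. (d * b * b ^ (k-1) / fact k) *\<^sub>R X (k+2))"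
    proof -
      have "{0..s-2} = insert 0 {1..s-2}" by auto
      then have "V = d *\<^sub>R X 2 + (\<Sum>k\<in>{1..s-2}. (d * (b ^ k / fact k)) *\<^sub>R X (k+2))"
        unfolding V by (simp add: numeral_2_eq_2)
      also have "(\<Sum>k\<in>{1..s-2}. (d * (b ^ k / fact k)) *\<^sub>R X (k+2)) = (\<Sum>k\<in>{1..s-2}. (d * b * b ^ (k-1) / fact k) *\<^sub>R X (k+2))"
      proof (rule sum.cong[OF refl])
        fix k assume "k \<in> {1..s-2}"
        then obtain j where "k = Suc j" by (cases k) auto
        then show "(d * (b ^ k / fact k)) *\<^sub>R X (k+2) = (d * b * b ^ (k-1) / fact k) *\<^sub>R X (k+2)" by simp
      qed
      finally show ?thesis .
    qed
    have c1: "coord 1 V = 0" unfolding V_def using \<pi>_Ad_e[of b "d *\<^sub>R X 2"] coord_X[of 1 2] s by simp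
    have c2: "coord 1 (c *\<^sub>R X 2) = 0" using coord_X[of 1 2] s by simp
    define r where "r = s - 4"
    have r: "s - 3 = Suc r" "s - 4 = r" "s - 2 = Suc (Suc r)" using s by (simp_all add: r_def)
    have coef: "((c + d) * (d * b) * b ^ (s-3) - (d * b)\<^sup>2 * b ^ (s-4)) / (2 * fact (s-2)) = (1/2) * (c * (d * (b ^ (s-2) / fact (s-2))))"
      unfolding r by (simp add: power2_eq_square algebra_simps)
    have "c *\<^sub>R X 2 \<otimes> V = c *\<^sub>R X 2 + V + (1/2) *\<^sub>R lie_bracket G (c *\<^sub>R X 2) V" by (rule mult_kernel[OF c1 c2])
    also have "\<dots> = graph_section b (c + d) (d * b)"
      unfolding graph_section_def br coef scaleR_scaleR unfolding V' by (simp add: scaleR_add_left)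
    finally show ?thesis .
  qed
  finally show ?thesis .
qed

lemma polynomial_section_graph:
  assumes s: "s \<ge> 5"
  shows "polynomial_section (\<lambda>(b, p, q). graph_section b p q \<otimes> (b *\<^sub>R X 1)) chart"
proof
  define B P Q :: "real \<times> real \<times> real \<Rightarrow> real" where "B = fst" and "P = fst \<circ> snd" and "Q = snd \<circ> snd"
  have BPQ: "real_polynomial_function B" "real_polynomial_function P" "real_polynomial_function Q"
    unfolding B_def P_def Q_def
    by (intro real_polynomial_function.intros(1) bounded_linear_fst bounded_linear_compose[OF bounded_linear_fst bounded_linear_snd, folded o_def]
      bounded_linear_compose[OF bounded_linear_snd bounded_linear_snd, folded o_def])+
  have "polynomial_function (\<lambda>v. graph_section (B v) (P v) (Q v))"
    unfolding graph_section_def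
    by (intro polynomial_function_add polynomial_function_mult polynomial_function_sum polynomial_function_const
        real_polynomial_function_eq[THEN iffD1] real_polynomial_function_divide real_polynomial_function_diff
        real_polynomial_function.intros(4) real_polynomial_function_power BPQ) simp_all
  then have "polynomial_function (\<lambda>v. graph_section (B v) (P v) (Q v) \<otimes> (B v *\<^sub>R X 1))"
    by (intro polynomial_function_kernel_mult_line) (use BPQ coord_graph_section[OF s] in \<open>simp_all add: real_polynomial_function_eq\<close>)
  then show "polynomial_function (\<lambda>(b, p, q). graph_section b p q \<otimes> (b *\<^sub>R X 1))"
    by (simp add: B_def P_def Q_def case_prod_unfold)
  have lin: "real_polynomial_function (coord i)" for i
    by (rule real_polynomial_function.intros(1)[OF bounded_linear_coord])
  have c3: "real_polynomial_function (\<lambda>x. coord 3 x + coord 1 x * coord 2 x / 2)"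
    by (intro real_polynomial_function.intros(3) real_polynomial_function_divide real_polynomial_function.intros(4) lin)
  show "polynomial_function chart"
    unfolding polynomial_function_iff_Basis_inner
    using lin[of 1] lin[of 2] c3
    by (auto simp: chart_def Basis_prod_def real_polynomial_function_eq inner_Pair)
  show "chart (case v of (b, p, q) \<Rightarrow> graph_section b p q \<otimes> (b *\<^sub>R X 1)) = v" for v
    by (cases v) (simp only: prod.case chart_kernel_mult_line[OF coord_graph_section(1)[OF s]] coord_graph_section[OF s])
qed

text \<open>The parameters \<open>(b, c + d, d * b)\<close> take exactly the values with \<open>b \<noteq> 0\<close> or third component
  \<open>0\<close>.\<close>

theorem abnormal_set_constructible:
  assumes s: "s \<ge> 5" and m: "m + 1 = s" and \<omega>: "\<omega> 2 s = 1"
  shows "\<exists>V W L. algebraic_variety V \<and> has_algebraic_dim V 3 \<and>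
          algebraic_set W \<and> W \<subset> V \<and> algebraic_set L \<and> L \<subseteq> W \<and>
          abnormal_set G horizontal = (V - W) \<union> L"
proof -
  interpret polynomial_section "\<lambda>(b, p, q). graph_section b p q \<otimes> (b *\<^sub>R X 1)" chart
    by (rule polynomial_section_graph[OF s])
  show ?thesis
  proof (rule constructible_image)
    show "abnormal_set G horizontal = (\<lambda>(b, p, q). graph_section b p q \<otimes> (b *\<^sub>R X 1)) ` {v. fst v \<noteq> 0 \<or> snd (snd v) = 0}"
      (is "_ = ?p ` ?S")
    proof
      show "abnormal_set G horizontal \<subseteq> ?p ` ?S"
      proof
        fix x assume "x \<in> abnormal_set G horizontal"
        then obtain c b d where "x = (c *\<^sub>R X 2) \<otimes> (b *\<^sub>R X 1) \<otimes> (d *\<^sub>R X 2)"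
          unfolding abnormal_set_X2_X1_X2[OF m \<omega>] by blast
        then have "x = ?p (b, c + d, d * b)" using X2_X1_X2_eq_graph_section[OF s m \<omega>] by simp
        moreover have "(b, c + d, d * b) \<in> ?S" by simp
        ultimately show "x \<in> ?p ` ?S" by (rule image_eqI)
      qed
      show "?p ` ?S \<subseteq> abnormal_set G horizontal"
      proof
        fix x assume "x \<in> ?p ` ?S"
        then obtain b p q where x: "x = graph_section b p q \<otimes> (b *\<^sub>R X 1)" and bq: "b \<noteq> 0 \<or> q = 0" by auto
        \<comment> \<open>For \<open>b = 0\<close> the third coordinate vanishes and the splitting of \<open>p\<close> into \<open>c + d\<close> is arbitrary.\<close>
        define d where "d = (if b = 0 then 0 else q / b)"
        have "q = d * b" using bq by (auto simp: d_def)
        then have "x = ((p - d) *\<^sub>R X 2) \<otimes> (b *\<^sub>R X 1) \<otimes> (d *\<^sub>R X 2)"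
          using X2_X1_X2_eq_graph_section[OF s m \<omega>, of "p - d" b d] x by simp
        then show "x \<in> abnormal_set G horizontal" unfolding abnormal_set_X2_X1_X2[OF m \<omega>] by blast
      qed
    qed
  qed
qed

end

lemma carnot_group_imp_exponential_group:
  assumes "carnot_group G g s"
  shows "exponential_group G"
proof -
  interpret carnot_group G g s by fact
  show ?thesis
    by unfold_locales (rule carrier_eq smooth_mult exp_id)+
qed

lemma filiform_basis_span:
  assumes "filiform_basis g s X"
  shows "g 1 = span {X 1, X 2}" "inj_on X {1..s+1}" "independent (X ` {1..s+1})" "span (X ` {1..s+1}) = UNIV"
  using assms unfolding filiform_basis_def by blast+

lemma abnormal_set_type_I:
  assumes G: "filiform_group G g s" and s: "s \<ge> 3" and I: "type_I G g s"
  shows "horizontal_line (g 1) (abnormal_set G (g 1))"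
proof -
  have "exponential_group G"
    using G carnot_group_imp_exponential_group unfolding filiform_group_def by blast
  then interpret exponential_group G .
  obtain X where X: "filiform_basis g s X"
    and b1: "\<And>j. j \<in> {2..s} \<Longrightarrow> X (j+1) = lie_bracket G (X 1) (X j)"
    and b0: "\<And>i j. 1 \<le> i \<Longrightarrow> i < j \<Longrightarrow> j \<le> s+1 \<Longrightarrow> \<not> (i = 1 \<and> j \<le> s) \<Longrightarrow> lie_bracket G (X i) (X j) = 0"
    using I unfolding type_I_def by blast
  have rest: "lie_bracket G (X i) (X j) = 0" if "2 \<le> i" "i \<le> s+1" "2 \<le> j" "j \<le> s+1" for i j
  proof -
    consider "i < j" | "i = j" | "j < i" by linarith
    then show ?thesis
    proof cases
      case 1 then show ?thesis using b0[of i j] that by simp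
    next
      case 2 then show ?thesis using bracket_self by simp
    next
      case 3 then show ?thesis using b0[of j i] that lie_bracket_skew[of "X i" "X j"] by simp
    qed
  qed
  interpret filiform_frame G X s s "\<lambda>i j. 0"
  proof (intro filiform_frame.intro filiform_frame_axioms.intro exponential_group_axioms filiform_basis_span(2-4)[OF X])
    show "lie_bracket G (X 1) (X j) = (if j \<le> s then X (j+1) else 0)" if "2 \<le> j" "j \<le> s+1" for j
      using b1[of j] b0[of 1 j] that by auto
  qed (use s rest in auto)
  have g1: "g 1 = horizontal" using filiform_basis_span(1)[OF X] by (simp add: horizontal_def)
  have "X 2 \<noteq> 0" using coord_X[of 2 2] s by auto
  then show ?thesis
    unfolding horizontal_line_def g1 abnormal_set_line[OF refl] using X_in_horizontal(2) by blast
qed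

lemma abnormal_set_type_II:
  assumes G: "filiform_group G g s" and II: "type_II G g s"
  shows "\<exists>V W L. algebraic_variety V \<and> has_algebraic_dim V 3 \<and>
          algebraic_set W \<and> W \<subset> V \<and> algebraic_set L \<and> L \<subseteq> W \<and>
          abnormal_set G (g 1) = (V - W) \<union> L"
proof -
  have "exponential_group G"
    using G carnot_group_imp_exponential_group unfolding filiform_group_def by blast
  then interpret exponential_group G .
  have s: "s \<ge> 5" using II by (simp add: type_II_def)
  obtain X where X: "filiform_basis g s X"
    and b1: "\<And>j. j \<in> {2..s-1} \<Longrightarrow> X (j+1) = lie_bracket G (X 1) (X j)"
    and b2: "\<And>i. i \<in> {2..s} \<Longrightarrow> X (s+1) = (-1) ^ i *\<^sub>R lie_bracket G (X i) (X (s+2-i))"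
    and b0: "\<And>i j. 1 \<le> i \<Longrightarrow> i < j \<Longrightarrow> j \<le> s+1 \<Longrightarrow> \<not> (i = 1 \<and> j \<le> s-1) \<Longrightarrow> \<not> (2 \<le> i \<and> i + j = s+2) \<Longrightarrow>
        lie_bracket G (X i) (X j) = 0"
    using II unfolding type_II_def by blast
  define \<omega> where "\<omega> = (\<lambda>i j::nat. if i + j = s + 2 \<and> 2 \<le> i \<and> 2 \<le> j then (-1) ^ i else (0::real))"
  have rest: "lie_bracket G (X i) (X j) = \<omega> i j *\<^sub>R X (s+1)" if ij: "2 \<le> i" "i \<le> s+1" "2 \<le> j" "j \<le> s+1" for i j
  proof (cases "i + j = s + 2")
    case True
    then have j: "j = s + 2 - i" and i: "i \<in> {2..s}" using ij by auto
    have "(-1) ^ i *\<^sub>R X (s+1) = ((-1) ^ i * (-1) ^ i) *\<^sub>R lie_bracket G (X i) (X j)"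
      using b2[OF i] j by simp
    also have "(-1) ^ i * (-1) ^ i = (1::real)" by (simp add: power_mult_distrib[symmetric])
    finally show ?thesis using True ij by (simp add: \<omega>_def)
  next
    case False
    consider "i < j" | "i = j" | "j < i" by linarith
    then have "lie_bracket G (X i) (X j) = 0"
    proof cases
      case 1 then show ?thesis using b0[of i j] ij False by simp
    next
      case 2 then show ?thesis using bracket_self by simp
    next
      case 3 then show ?thesis using b0[of j i] ij False lie_bracket_skew[of "X i" "X j"] by simp
    qed
    then show ?thesis using False by (simp add: \<omega>_def)
  qed
  interpret filiform_frame G X s "s - 1" \<omega>
  proof (intro filiform_frame.intro filiform_frame_axioms.intro exponential_group_axioms filiform_basis_span(2-4)[OF X])
    show "lie_bracket G (X 1) (X j) = (if j \<le> s - 1 then X (j+1) else 0)" if "2 \<le> j" "j \<le> s+1" for j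
      using b1[of j] b0[of 1 j] that by auto
  qed (use s rest in \<open>auto simp: \<omega>_def\<close>)
  have g1: "g 1 = horizontal" using filiform_basis_span(1)[OF X] by (simp add: horizontal_def)
  show ?thesis
    unfolding g1 by (rule abnormal_set_constructible) (use s in \<open>auto simp: \<omega>_def\<close>)
qed

theorem theorem1p2:
  fixes G :: "'a::euclidean_space monoid" and g :: "nat \<Rightarrow> 'a set" and s :: nat
  assumes "filiform_group G g s" and "s \<ge> 3"
  shows "(type_I G g s \<longrightarrow> horizontal_line (g 1) (abnormal_set G (g 1))) \<and>
    (type_II G g s \<longrightarrow>
       (\<exists>V W L. algebraic_variety V \<and> has_algebraic_dim V 3 \<and>
          algebraic_set W \<and> W \<subset> V \<and> algebraic_set L \<and> L \<subseteq> W \<and>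
          abnormal_set G (g 1) = (V - W) \<union> L))"
  using abnormal_set_type_I[OF assms] abnormal_set_type_II[OF assms(1)] by blast

end
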